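(* Let $k$ be a field and $A$ a cocommutative Hopf algebra over $k$. For each $n\ge 1$, if $\mathrm{ch}(k)\nmid n+1$, then $\widetilde{\mathrm S}_n(A)$ is a projective left $A$-module.
   Context: $\otimes=\otimes_k$; $\mathrm{ch}(k)$ is the characteristic of $k$ (when $\mathrm{ch}(k)=0$, the condition $\mathrm{ch}(k)\nmid n+1$ holds for all $n\ge 0$). $A$ has coproduct $\Delta$, and Sweedler notation $\Delta(a)=a^{(1)}\otimes a^{(2)}$ (summation suppressed, and similarly for iterated coproducts) is used. $A$ is cocommutative if $a^{(1)}\otimes a^{(2)}=a^{(2)}\otimes a^{(1)}$ for all $a\in A$. For $n\ge0$, $\widetilde{\mathrm T}_n(A)=A^{\otimes n+1}$ is a left $A$-module via $b\cdot(a_0\otimes\cdots\otimes a_n)=b^{(1)}a_0\otimes b^{(2)}a_1\otimes\cdots\otimes b^{(n+1)}a_n$. The symmetric group $S_{n+1}$, generated by the transpositions $\sigma_i=(i,i+1)$ for $1\le i\le n$, acts on the right on $\widetilde{\mathrm T}_n(A)$ by $$(a_0\otimes\cdots\otimes a_n)\cdot\sigma_i=-a_0\otimes\cdots\otimes a_{i-2}\otimes a_i\otimes a_{i-1}\otimes a_{i+1}\otimes\cdots\otimes a_n,$$ making it a right $kS_{n+1}$-module. Define $\widetilde{\mathrm S}_n(A)=\widetilde{\mathrm T}_n(A)\otimes_{kS_{n+1}}k$, where $k$ is the trivial left $kS_{n+1}$-module, with left $A$-module structure induced from $\widetilde{\mathrm T}_n(A)$. *)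

theory Defs
  imports "HOL-Algebra.Module" "HOL-Algebra.IntRing" "HOL-Algebra.Sym_Groups"
begin

section \<open>Modules over arbitrary rings\<close>

text \<open>The library locale \<open>module\<close> requires a commutative ring of scalars, so left modules over
  a general ring, homomorphisms between them and projectivity are introduced here. As in the
  library, a module is a \<open>module\<close> record; since that record extends \<open>ring\<close>, it also carries fields
  \<open>mult\<close> and \<open>one\<close>, which play no role in a module.\<close>

locale left_module = R?: ring R + M?: abelian_group M
  for R :: "('r, 'z) ring_scheme" (structure) and M :: "('r, 'm, 'x) module_scheme" (structure) +
  assumes smult_closed: "\<lbrakk>a \<in> carrier R; x \<in> carrier M\<rbrakk> \<Longrightarrow> a \<odot>\<^bsub>M\<^esub> x \<in> carrier M"
    and smult_l_distr: "\<lbrakk>a \<in> carrier R; b \<in> carrier R; x \<in> carrier M\<rbrakk> \<Longrightarrow>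
      (a \<oplus> b) \<odot>\<^bsub>M\<^esub> x = a \<odot>\<^bsub>M\<^esub> x \<oplus>\<^bsub>M\<^esub> b \<odot>\<^bsub>M\<^esub> x"
    and smult_r_distr: "\<lbrakk>a \<in> carrier R; x \<in> carrier M; y \<in> carrier M\<rbrakk> \<Longrightarrow>
      a \<odot>\<^bsub>M\<^esub> (x \<oplus>\<^bsub>M\<^esub> y) = a \<odot>\<^bsub>M\<^esub> x \<oplus>\<^bsub>M\<^esub> a \<odot>\<^bsub>M\<^esub> y"
    and smult_assoc: "\<lbrakk>a \<in> carrier R; b \<in> carrier R; x \<in> carrier M\<rbrakk> \<Longrightarrow>
      (a \<otimes> b) \<odot>\<^bsub>M\<^esub> x = a \<odot>\<^bsub>M\<^esub> (b \<odot>\<^bsub>M\<^esub> x)"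
    and smult_one: "x \<in> carrier M \<Longrightarrow> \<one> \<odot>\<^bsub>M\<^esub> x = x"

definition module_hom ::
  "('r, 'z) ring_scheme \<Rightarrow> ('r, 'm, 'x) module_scheme \<Rightarrow> ('r, 'n, 'y) module_scheme \<Rightarrow> ('m \<Rightarrow> 'n) set"
  where "module_hom R M N = {f. (\<forall>x\<in>carrier M. f x \<in> carrier N) \<and>
     (\<forall>x\<in>carrier M. \<forall>y\<in>carrier M. f (x \<oplus>\<^bsub>M\<^esub> y) = f x \<oplus>\<^bsub>N\<^esub> f y) \<and>
     (\<forall>r\<in>carrier R. \<forall>x\<in>carrier M. f (r \<odot>\<^bsub>M\<^esub> x) = r \<odot>\<^bsub>N\<^esub> f x)}"

text \<open>Projectivity is the lifting property against surjections \<open>N \<rightarrow> P\<close> of left \<open>R\<close>-modules.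
  A definition cannot quantify over types, so the types of the elements of the test modules are
  parameters; a theorem concluding \<open>projective_module TYPE('n) TYPE('p) R M\<close> with \<open>'n\<close> and \<open>'p\<close>
  free asserts the lifting property for all test modules.\<close>

definition projective_module ::
  "'n itself \<Rightarrow> 'p itself \<Rightarrow> ('r, 'z) ring_scheme \<Rightarrow> ('r, 'm, 'x) module_scheme \<Rightarrow> bool"
  where "projective_module _ _ R M \<longleftrightarrow> left_module R M \<and>
    (\<forall>(N :: ('r, 'n) module) (P :: ('r, 'p) module) f g.
       left_module R N \<longrightarrow> left_module R P \<longrightarrow>
       f \<in> module_hom R M P \<longrightarrow> g \<in> module_hom R N P \<longrightarrow> g ` carrier N = carrier P \<longrightarrow>
       (\<exists>h \<in> module_hom R M N. \<forall>x \<in> carrier M. g (h x) = f x))"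

text \<open>The abelian group \<open>M\<close> with a new scalar multiplication.\<close>

definition with_action :: "('m, 'z) ring_scheme \<Rightarrow> ('r \<Rightarrow> 'm \<Rightarrow> 'm) \<Rightarrow> ('r, 'm) module"
  where "with_action M act = \<lparr>carrier = carrier M, monoid.mult = monoid.mult M, one = one M,
     ring.zero = ring.zero M, add = add M, smult = act\<rparr>"

definition regular_module :: "('r, 'z) ring_scheme \<Rightarrow> ('r, 'r) module"
  where "regular_module R = with_action R (monoid.mult R)"

definition ring_char :: "('r, 'z) ring_scheme \<Rightarrow> nat"
  where "ring_char R =
    (if \<exists>m::nat. m > 0 \<and> [m] \<cdot>\<^bsub>R\<^esub> \<one>\<^bsub>R\<^esub> = \<zero>\<^bsub>R\<^esub>
     then LEAST m::nat. m > 0 \<and> [m] \<cdot>\<^bsub>R\<^esub> \<one>\<^bsub>R\<^esub> = \<zero>\<^bsub>R\<^esub> else 0)"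


section \<open>Modules given by generators and relations\<close>

text \<open>The free \<open>R\<close>-module on \<open>X\<close> consists of the finitely supported functions \<open>X \<rightarrow> R\<close>, represented
  as functions on the whole type that vanish outside \<open>X\<close>.\<close>

definition free_module :: "('r, 'z) ring_scheme \<Rightarrow> 'x set \<Rightarrow> ('r, 'x \<Rightarrow> 'r) module"
  where "free_module R X =
    \<lparr>carrier = {f. (\<forall>x. f x \<in> carrier R) \<and> finite {x. f x \<noteq> \<zero>\<^bsub>R\<^esub>} \<and> {x. f x \<noteq> \<zero>\<^bsub>R\<^esub>} \<subseteq> X},
     monoid.mult = undefined, one = undefined,
     ring.zero = (\<lambda>x. \<zero>\<^bsub>R\<^esub>), add = (\<lambda>f g x. f x \<oplus>\<^bsub>R\<^esub> g x), smult = (\<lambda>r f x. r \<otimes>\<^bsub>R\<^esub> f x)\<rparr>"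

definition basis_vector :: "('r, 'z) ring_scheme \<Rightarrow> 'x \<Rightarrow> 'x \<Rightarrow> 'r"
  where "basis_vector R x = (\<lambda>y. if y = x then \<one>\<^bsub>R\<^esub> else \<zero>\<^bsub>R\<^esub>)"

definition linear_extension ::
  "('r, 'z) ring_scheme \<Rightarrow> ('r, 'v, 'y) module_scheme \<Rightarrow> ('x \<Rightarrow> 'v) \<Rightarrow> ('x \<Rightarrow> 'r) \<Rightarrow> 'v"
  where "linear_extension R V \<phi> f = (\<Oplus>\<^bsub>V\<^esub>x\<in>{x. f x \<noteq> \<zero>\<^bsub>R\<^esub>}. f x \<odot>\<^bsub>V\<^esub> \<phi> x)"

definition quotient_module :: "('r, 'm, 'x) module_scheme \<Rightarrow> 'm set \<Rightarrow> ('r, 'm set) module"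
  where "quotient_module M H =
    \<lparr>carrier = a_rcosets\<^bsub>M\<^esub> H, monoid.mult = undefined, one = undefined,
     ring.zero = H, add = set_add M, smult = (\<lambda>r C. \<Union>x\<in>C. H +>\<^bsub>M\<^esub> (r \<odot>\<^bsub>M\<^esub> x))\<rparr>"

definition relation_submodule ::
  "('r, 'z) ring_scheme \<Rightarrow> 'x set \<Rightarrow> ('x \<Rightarrow> 'r) set \<Rightarrow> ('x \<Rightarrow> 'r) set"
  where "relation_submodule R X rels = \<Inter> {H. submodule H R (free_module R X) \<and> rels \<subseteq> H}"

definition presented_module ::
  "('r, 'z) ring_scheme \<Rightarrow> 'x set \<Rightarrow> ('x \<Rightarrow> 'r) set \<Rightarrow> ('r, ('x \<Rightarrow> 'r) set) module"
  where "presented_module R X rels =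
     quotient_module (free_module R X) (relation_submodule R X rels)"

definition generator ::
  "('r, 'z) ring_scheme \<Rightarrow> 'x set \<Rightarrow> ('x \<Rightarrow> 'r) set \<Rightarrow> 'x \<Rightarrow> ('x \<Rightarrow> 'r) set"
  where "generator R X rels x = relation_submodule R X rels +>\<^bsub>free_module R X\<^esub> basis_vector R x"

text \<open>The linear map out of a presented module that sends the generator of each \<open>x\<close> to \<open>\<phi> x\<close>:
  apply the linear extension of \<open>\<phi>\<close> to a representative of the coset \<open>t\<close>. This is
  independent of the representative whenever the linear extension of \<open>\<phi>\<close> kills the relations, and
  it is used below only in such situations.\<close>

definition induced_map ::
  "('r, 'z) ring_scheme \<Rightarrow> ('r, 'v, 'y) module_scheme \<Rightarrow> ('x \<Rightarrow> 'v) \<Rightarrow> ('x \<Rightarrow> 'r) set \<Rightarrow> 'v"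
  where "induced_map R V \<phi> t = linear_extension R V \<phi> (SOME f. f \<in> t)"


section \<open>Tensor powers over a commutative ring\<close>

text \<open>\<open>A\<^sup>\<otimes>\<^sup>m\<close> is generated by the \<open>m\<close>-tuples over \<open>A\<close> (lists of length \<open>m\<close>), subject to multilinearity.\<close>

definition tuples :: "('a, 'z) ring_scheme \<Rightarrow> nat \<Rightarrow> 'a list set"
  where "tuples A m = {xs. length xs = m \<and> set xs \<subseteq> carrier A}"

definition multilinearity_relations ::
  "('k, 'z) ring_scheme \<Rightarrow> ('k, 'a, 'x) module_scheme \<Rightarrow> nat \<Rightarrow> ('a list \<Rightarrow> 'k) set"
  where "multilinearity_relations K A m = (let F = free_module K (tuples A m); e = basis_vector K in
     {e (xs[i := x \<oplus>\<^bsub>A\<^esub> y]) \<ominus>\<^bsub>F\<^esub> (e (xs[i := x]) \<oplus>\<^bsub>F\<^esub> e (xs[i := y])) | xs i x y.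
        xs \<in> tuples A m \<and> i < m \<and> x \<in> carrier A \<and> y \<in> carrier A} \<union>
     {e (xs[i := c \<odot>\<^bsub>A\<^esub> x]) \<ominus>\<^bsub>F\<^esub> (c \<odot>\<^bsub>F\<^esub> e (xs[i := x])) | xs i c x.
        xs \<in> tuples A m \<and> i < m \<and> c \<in> carrier K \<and> x \<in> carrier A})"

definition tensor_power ::
  "('k, 'z) ring_scheme \<Rightarrow> ('k, 'a, 'x) module_scheme \<Rightarrow> nat \<Rightarrow> ('k, ('a list \<Rightarrow> 'k) set) module"
  where "tensor_power K A m = presented_module K (tuples A m) (multilinearity_relations K A m)"

text \<open>\<open>pure_tensor K A [a\<^sub>0, \<dots>, a\<^sub>n]\<close> is \<open>a\<^sub>0 \<otimes> \<dots> \<otimes> a\<^sub>n\<close>.\<close>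

definition pure_tensor ::
  "('k, 'z) ring_scheme \<Rightarrow> ('k, 'a, 'x) module_scheme \<Rightarrow> 'a list \<Rightarrow> ('a list \<Rightarrow> 'k) set"
  where "pure_tensor K A xs =
     generator K (tuples A (length xs)) (multilinearity_relations K A (length xs)) xs"

text \<open>The product of the algebra \<open>A\<^sup>\<otimes>\<^sup>m\<close>:
  \<open>(a\<^sub>1 \<otimes> \<dots> \<otimes> a\<^sub>m) (b\<^sub>1 \<otimes> \<dots> \<otimes> b\<^sub>m) = a\<^sub>1 b\<^sub>1 \<otimes> \<dots> \<otimes> a\<^sub>m b\<^sub>m\<close>.\<close>

definition tensor_mult ::
  "('k, 'z) ring_scheme \<Rightarrow> ('k, 'a, 'x) module_scheme \<Rightarrow> nat \<Rightarrow>
   ('a list \<Rightarrow> 'k) set \<Rightarrow> ('a list \<Rightarrow> 'k) set \<Rightarrow> ('a list \<Rightarrow> 'k) set"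
  where "tensor_mult K A m s t = (let T = tensor_power K A m in
     induced_map K T (\<lambda>xs. induced_map K T (\<lambda>ys. pure_tensor K A (map2 (monoid.mult A) xs ys)) t) s)"


section \<open>Hopf algebras\<close>

text \<open>\<open>comult_at K A \<Delta> m i\<close> is \<open>id\<^sup>\<otimes>\<^sup>i \<otimes> \<Delta> \<otimes> id\<^sup>\<otimes>\<^sup>(\<^sup>m\<^sup>-\<^sup>i\<^sup>-\<^sup>1\<^sup>) : A\<^sup>\<otimes>\<^sup>m \<rightarrow> A\<^sup>\<otimes>\<^sup>(\<^sup>m\<^sup>+\<^sup>1\<^sup>)\<close>, for \<open>i < m\<close>.\<close>

definition comult_at ::
  "('k, 'z) ring_scheme \<Rightarrow> ('k, 'a, 'x) module_scheme \<Rightarrow> ('a \<Rightarrow> ('a list \<Rightarrow> 'k) set) \<Rightarrow> nat \<Rightarrow> nat \<Rightarrow>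
   ('a list \<Rightarrow> 'k) set \<Rightarrow> ('a list \<Rightarrow> 'k) set"
  where "comult_at K A \<Delta> m i t = (let T = tensor_power K A (Suc m) in
     induced_map K T
       (\<lambda>xs. induced_map K T (\<lambda>ys. pure_tensor K A (take i xs @ ys @ drop (Suc i) xs)) (\<Delta> (xs ! i))) t)"

locale hopf_algebra = K?: field K + module K A + A?: ring A
  for K :: "('k, 'z) ring_scheme" (structure) and A :: "('k, 'a, 'x) module_scheme" (structure) +
  fixes \<Delta> :: "'a \<Rightarrow> ('a list \<Rightarrow> 'k) set" and \<epsilon> :: "'a \<Rightarrow> 'k" and S :: "'a \<Rightarrow> 'a"
  assumes smult_mult_left: "\<lbrakk>c \<in> carrier K; x \<in> carrier A; y \<in> carrier A\<rbrakk> \<Longrightarrow>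
      (c \<odot>\<^bsub>A\<^esub> x) \<otimes>\<^bsub>A\<^esub> y = c \<odot>\<^bsub>A\<^esub> (x \<otimes>\<^bsub>A\<^esub> y)"
    and smult_mult_right: "\<lbrakk>c \<in> carrier K; x \<in> carrier A; y \<in> carrier A\<rbrakk> \<Longrightarrow>
      x \<otimes>\<^bsub>A\<^esub> (c \<odot>\<^bsub>A\<^esub> y) = c \<odot>\<^bsub>A\<^esub> (x \<otimes>\<^bsub>A\<^esub> y)"
    and comult_linear: "\<Delta> \<in> module_hom K A (tensor_power K A 2)"
    and counit_linear: "\<epsilon> \<in> module_hom K A (regular_module K)"
    and antipode_linear: "S \<in> module_hom K A A"
    and coassociative: "a \<in> carrier A \<Longrightarrow>
      comult_at K A \<Delta> 2 0 (\<Delta> a) = comult_at K A \<Delta> 2 1 (\<Delta> a)"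
    and counit_left: "a \<in> carrier A \<Longrightarrow>
      induced_map K A (\<lambda>xs. \<epsilon> (xs ! 0) \<odot>\<^bsub>A\<^esub> xs ! 1) (\<Delta> a) = a"
    and counit_right: "a \<in> carrier A \<Longrightarrow>
      induced_map K A (\<lambda>xs. \<epsilon> (xs ! 1) \<odot>\<^bsub>A\<^esub> xs ! 0) (\<Delta> a) = a"
    and comult_mult: "\<lbrakk>a \<in> carrier A; b \<in> carrier A\<rbrakk> \<Longrightarrow>
      \<Delta> (a \<otimes>\<^bsub>A\<^esub> b) = tensor_mult K A 2 (\<Delta> a) (\<Delta> b)"
    and comult_one: "\<Delta> \<one>\<^bsub>A\<^esub> = pure_tensor K A [\<one>\<^bsub>A\<^esub>, \<one>\<^bsub>A\<^esub>]"
    and counit_mult: "\<lbrakk>a \<in> carrier A; b \<in> carrier A\<rbrakk> \<Longrightarrow> \<epsilon> (a \<otimes>\<^bsub>A\<^esub> b) = \<epsilon> a \<otimes> \<epsilon> b"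
    and counit_one: "\<epsilon> \<one>\<^bsub>A\<^esub> = \<one>"
    and antipode_left: "a \<in> carrier A \<Longrightarrow>
      induced_map K A (\<lambda>xs. S (xs ! 0) \<otimes>\<^bsub>A\<^esub> xs ! 1) (\<Delta> a) = \<epsilon> a \<odot>\<^bsub>A\<^esub> \<one>\<^bsub>A\<^esub>"
    and antipode_right: "a \<in> carrier A \<Longrightarrow>
      induced_map K A (\<lambda>xs. xs ! 0 \<otimes>\<^bsub>A\<^esub> S (xs ! 1)) (\<Delta> a) = \<epsilon> a \<odot>\<^bsub>A\<^esub> \<one>\<^bsub>A\<^esub>"

definition cocommutative ::
  "('k, 'z) ring_scheme \<Rightarrow> ('k, 'a, 'x) module_scheme \<Rightarrow> ('a \<Rightarrow> ('a list \<Rightarrow> 'k) set) \<Rightarrow> bool"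
  where "cocommutative K A \<Delta> \<longleftrightarrow> (\<forall>a\<in>carrier A.
     induced_map K (tensor_power K A 2) (\<lambda>xs. pure_tensor K A [xs ! 1, xs ! 0]) (\<Delta> a) = \<Delta> a)"

text \<open>\<open>iterated_comult K A \<Delta> n a\<close> is \<open>a\<^sup>(\<^sup>1\<^sup>) \<otimes> \<dots> \<otimes> a\<^sup>(\<^sup>n\<^sup>+\<^sup>1\<^sup>)\<close>, an element of \<open>A\<^sup>\<otimes>\<^sup>(\<^sup>n\<^sup>+\<^sup>1\<^sup>)\<close>.\<close>

primrec iterated_comult ::
  "('k, 'z) ring_scheme \<Rightarrow> ('k, 'a, 'x) module_scheme \<Rightarrow> ('a \<Rightarrow> ('a list \<Rightarrow> 'k) set) \<Rightarrow>
   nat \<Rightarrow> 'a \<Rightarrow> ('a list \<Rightarrow> 'k) set"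
  where
    "iterated_comult K A \<Delta> 0 a = pure_tensor K A [a]"
  | "iterated_comult K A \<Delta> (Suc n) a = comult_at K A \<Delta> (Suc n) 0 (iterated_comult K A \<Delta> n a)"


section \<open>Group algebras\<close>

definition group_algebra :: "('k, 'z) ring_scheme \<Rightarrow> ('g, 'y) monoid_scheme \<Rightarrow> ('k, 'g \<Rightarrow> 'k) module"
  where "group_algebra K G = (let F = free_module K (carrier G) in
     F\<lparr>monoid.mult := (\<lambda>r s. linear_extension K F
                  (\<lambda>g. linear_extension K F (\<lambda>h. basis_vector K (g \<otimes>\<^bsub>G\<^esub> h)) s) r),
       one := basis_vector K \<one>\<^bsub>G\<^esub>\<rparr>)"

text \<open>A linear action \<open>\<rho>\<close> of a group on a \<open>K\<close>-module \<open>V\<close>, left or right, extended linearly to an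
  action of the group algebra. For a right action, the product \<open>v \<cdot> r\<close> of \<open>v\<close> with the group algebra
  element \<open>r\<close> is stored as \<open>r \<odot> v\<close>.\<close>

definition group_algebra_module ::
  "('k, 'z) ring_scheme \<Rightarrow> ('k, 'v, 'y) module_scheme \<Rightarrow> ('g \<Rightarrow> 'v \<Rightarrow> 'v) \<Rightarrow> ('g \<Rightarrow> 'k, 'v) module"
  where "group_algebra_module K V \<rho> =
     with_action V (\<lambda>r v. linear_extension K V (\<lambda>g. \<rho> g v) r)"

definition trivial_module :: "('k, 'z) ring_scheme \<Rightarrow> ('g \<Rightarrow> 'k, 'k) module"
  where "trivial_module K = group_algebra_module K (regular_module K) (\<lambda>g c. c)"


section \<open>Tensor products over a noncommutative ring\<close>

text \<open>\<open>M \<otimes>\<^sub>R N\<close> for a right module \<open>M\<close> and a left module \<open>N\<close> over \<open>R\<close>: the abelian group generated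
  by the pairs \<open>(m, n)\<close> subject to biadditivity and \<open>(m \<cdot> r, n) = (m, r \<cdot> n)\<close>. The right
  multiplication \<open>m \<cdot> r\<close> is stored in the record as \<open>r \<odot>\<^bsub>M\<^esub> m\<close>.\<close>

definition balancing_relations ::
  "('r, 'z) ring_scheme \<Rightarrow> ('r, 'm, 'x) module_scheme \<Rightarrow> ('r, 'n, 'y) module_scheme \<Rightarrow>
   ('m \<times> 'n \<Rightarrow> int) set"
  where "balancing_relations R M N =
    (let F = free_module \<Z> (carrier M \<times> carrier N); e = basis_vector \<Z> in
     {e (m \<oplus>\<^bsub>M\<^esub> m', n) \<ominus>\<^bsub>F\<^esub> (e (m, n) \<oplus>\<^bsub>F\<^esub> e (m', n)) | m m' n.
        m \<in> carrier M \<and> m' \<in> carrier M \<and> n \<in> carrier N} \<union>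
     {e (m, n \<oplus>\<^bsub>N\<^esub> n') \<ominus>\<^bsub>F\<^esub> (e (m, n) \<oplus>\<^bsub>F\<^esub> e (m, n')) | m n n'.
        m \<in> carrier M \<and> n \<in> carrier N \<and> n' \<in> carrier N} \<union>
     {e (r \<odot>\<^bsub>M\<^esub> m, n) \<ominus>\<^bsub>F\<^esub> e (m, r \<odot>\<^bsub>N\<^esub> n) | r m n.
        r \<in> carrier R \<and> m \<in> carrier M \<and> n \<in> carrier N})"

definition tensor_product ::
  "('r, 'z) ring_scheme \<Rightarrow> ('r, 'm, 'x) module_scheme \<Rightarrow> ('r, 'n, 'y) module_scheme \<Rightarrow>
   (int, ('m \<times> 'n \<Rightarrow> int) set) module"
  where "tensor_product R M N =
     presented_module \<Z> (carrier M \<times> carrier N) (balancing_relations R M N)"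

text \<open>The left module structure \<open>b \<cdot> (m \<otimes> n) = (b \<cdot> m) \<otimes> n\<close> on \<open>M \<otimes>\<^sub>R N\<close> induced by a left action
  on \<open>M\<close> that commutes with the right action of \<open>R\<close>.\<close>

definition tensor_product_left_module ::
  "('r, 'z) ring_scheme \<Rightarrow> ('r, 'm, 'x) module_scheme \<Rightarrow> ('r, 'n, 'y) module_scheme \<Rightarrow>
   ('b \<Rightarrow> 'm \<Rightarrow> 'm) \<Rightarrow> ('b, ('m \<times> 'n \<Rightarrow> int) set) module"
  where "tensor_product_left_module R M N act = (let MN = tensor_product R M N in
     with_action MN (\<lambda>b. induced_map \<Z> MN
       (\<lambda>(m, n). generator \<Z> (carrier M \<times> carrier N) (balancing_relations R M N) (act b m, n))))"


section \<open>The modules \<open>T\<^sub>n(A)\<close> and \<open>S\<^sub>n(A)\<close>\<close>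

definition T_tilde ::
  "('k, 'z) ring_scheme \<Rightarrow> ('k, 'a, 'x) module_scheme \<Rightarrow> ('a \<Rightarrow> ('a list \<Rightarrow> 'k) set) \<Rightarrow> nat \<Rightarrow>
   ('a, ('a list \<Rightarrow> 'k) set) module"
  where "T_tilde K A \<Delta> n = with_action (tensor_power K A (Suc n))
     (\<lambda>b t. tensor_mult K A (Suc n) (iterated_comult K A \<Delta> n b) t)"

text \<open>A permutation of \<open>{1..n+1}\<close> permutes the tensor factors, where the factor \<open>a\<^sub>j\<close> has number
  \<open>j + 1\<close>. This is a right action for the product \<open>\<circ>\<close> of \<^const>\<open>sym_group\<close>.\<close>

definition permute_tuple :: "(nat \<Rightarrow> nat) \<Rightarrow> 'a list \<Rightarrow> 'a list"
  where "permute_tuple p xs = map (\<lambda>j. xs ! (p (Suc j) - 1)) [0..<length xs]"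

definition signed_permutation_action ::
  "('k, 'z) ring_scheme \<Rightarrow> ('k, 'a, 'x) module_scheme \<Rightarrow> nat \<Rightarrow> (nat \<Rightarrow> nat) \<Rightarrow>
   ('a list \<Rightarrow> 'k) set \<Rightarrow> ('a list \<Rightarrow> 'k) set"
  where "signed_permutation_action K A n p t = (let T = tensor_power K A (Suc n) in
     induced_map K T (\<lambda>xs. if evenperm p then pure_tensor K A (permute_tuple p xs)
                           else \<ominus>\<^bsub>T\<^esub> pure_tensor K A (permute_tuple p xs)) t)"

text \<open>On the generators \<open>\<sigma>\<^sub>i = (i, i+1)\<close> the action is the one prescribed by
  \<open>(a\<^sub>0 \<otimes> \<dots> \<otimes> a\<^sub>n) \<cdot> \<sigma>\<^sub>i = - (a\<^sub>0 \<otimes> \<dots> \<otimes> a\<^sub>i \<otimes> a\<^sub>i\<^sub>-\<^sub>1 \<otimes> \<dots> \<otimes> a\<^sub>n)\<close>, and permuting tuples is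
  compatible with composition.\<close>

lemma permute_tuple_generator:
  assumes "length xs = Suc n" "1 \<le> i" "i \<le> n"
  shows "permute_tuple (transpose i (i + 1)) xs = xs[i - 1 := xs ! i, i := xs ! (i - 1)]"
    and "\<not> evenperm (transpose i (i + 1))"
proof -
  show "permute_tuple (transpose i (i + 1)) xs = xs[i - 1 := xs ! i, i := xs ! (i - 1)]"
    using assms by (intro nth_equalityI)
      (auto simp: permute_tuple_def transpose_def nth_list_update simp del: upt_Suc)
  show "\<not> evenperm (transpose i (i + 1))"
    by (simp add: evenperm_swap)
qed

lemma permute_tuple_comp:
  assumes "p permutes {1..length xs}" "q permutes {1..length xs}"
  shows "permute_tuple (p \<circ> q) xs = permute_tuple q (permute_tuple p xs)"
proof (rule nth_equalityI)
  fix j assume "j < length (permute_tuple (p \<circ> q) xs)"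
  then have j: "j < length xs" by (simp add: permute_tuple_def)
  have "q (Suc j) \<in> {1..length xs}"
    using j permutes_in_image[OF assms(2), of "Suc j"] by simp
  then show "permute_tuple (p \<circ> q) xs ! j = permute_tuple q (permute_tuple p xs) ! j"
    using j by (auto simp: permute_tuple_def)
qed (simp add: permute_tuple_def)

text \<open>\<open>S\<^sub>n(A) = T\<^sub>n(A) \<otimes>\<^bsub>kS\<^sub>n\<^sub>+\<^sub>1\<^esub> k\<close> with its induced left \<open>A\<close>-module structure.\<close>

definition S_tilde ::
  "('k, 'z) ring_scheme \<Rightarrow> ('k, 'a, 'x) module_scheme \<Rightarrow> ('a \<Rightarrow> ('a list \<Rightarrow> 'k) set) \<Rightarrow> nat \<Rightarrow>
   ('a, (('a list \<Rightarrow> 'k) set \<times> 'k \<Rightarrow> int) set) module"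
  where "S_tilde K A \<Delta> n = tensor_product_left_module
     (group_algebra K (sym_group (Suc n)))
     (group_algebra_module K (tensor_power K A (Suc n)) (signed_permutation_action K A n))
     (trivial_module K)
     (smult (T_tilde K A \<Delta> n))"

end

theory Submission
  imports Defs
begin

text \<open>Write \<open>T\<close> for \<open>T\<^sub>n(A)\<close>. An \<open>A\<close>-linear map \<open>f\<close> on \<open>S\<^sub>n(A)\<close> is the same as
  an \<open>A\<close>-linear map \<open>F t = f (t \<otimes> 1)\<close> on \<open>T\<close> that is invariant under the signed permutations, so
  projectivity of \<open>S\<^sub>n(A)\<close> asks for an invariant \<open>A\<close>-linear lift of such an \<open>F\<close> through a given
  surjection \<open>g\<close> of \<open>A\<close>-modules.

  An \<open>A\<close>-linear lift exists because \<open>T\<close> is a Hopf module, free over \<open>A\<close> on \<open>A\<^sup>\<otimes>\<^sup>n\<close>. Explicitly, choose a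
  \<open>k\<close>-linear section \<open>\<sigma>\<close> of \<open>g\<close> (\<open>linear_section\<close>) and twist it by one of the tensor factors: for
  \<open>i \<le> n\<close> put
  \<open>L\<^sub>i (x\<^sub>0 \<otimes> \<dots> \<otimes> x\<^sub>n) = \<Sum> x\<^sub>i\<^sup>(\<^sup>1\<^sup>) \<sigma> (S(x\<^sub>i\<^sup>(\<^sup>2\<^sup>)) F (x\<^sub>0 \<otimes> \<dots> \<otimes> x\<^sub>i\<^sup>(\<^sup>3\<^sup>) \<otimes> \<dots> \<otimes> x\<^sub>n))\<close>.
  Applying \<open>g\<close> removes \<open>\<sigma>\<close>, and the antipode axiom then leaves \<open>F\<close> (\<open>lift_map_lifts\<close>). For \<open>i = 0\<close>
  the map \<open>L\<^sub>i\<close> is \<open>A\<close>-linear because the antipode \<open>S\<close> reverses products (\<open>antipode_mult\<close>) and \<open>F\<close> is \<open>A\<close>-linear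
  (\<open>lift_map_0_act_pure\<close>).

  Since \<open>F\<close> is invariant, a signed permutation \<open>p\<close> merely carries \<open>L\<^sub>i\<close> to \<open>L\<^bsub>p(i)\<^esub>\<close>
  (\<open>lift_map_permute\<close>). Cocommutativity makes the permutations commute with the action of \<open>A\<close>
  (\<open>act_signed_permutation\<close>), so \<open>A\<close>-linearity passes from \<open>L\<^sub>0\<close> to every \<open>L\<^sub>i\<close>, and the average
  \<open>(L\<^sub>0 + \<dots> + L\<^sub>n) / (n + 1)\<close> is an invariant \<open>A\<close>-linear lift. One divides only by \<open>n + 1\<close>, the index
  of the stabiliser of a factor, and not by the order of the symmetric group: each \<open>L\<^sub>i\<close> is already
  invariant under the stabiliser of the factor \<open>i\<close>.

  The computations with iterated coproducts are carried out by evaluating multilinear maps: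
  \<open>sweedler\<close> and \<open>iterated_sweedler\<close> below stand for the sums written in Sweedler notation, and each
  Hopf algebra axiom becomes a rewriting rule for them.\<close>

section \<open>Module homomorphisms\<close>

lemma module_homI:
  assumes "\<And>x. x \<in> carrier M \<Longrightarrow> f x \<in> carrier N"
    and "\<And>x y. \<lbrakk>x \<in> carrier M; y \<in> carrier M\<rbrakk> \<Longrightarrow> f (x \<oplus>\<^bsub>M\<^esub> y) = f x \<oplus>\<^bsub>N\<^esub> f y"
    and "\<And>r x. \<lbrakk>r \<in> carrier R; x \<in> carrier M\<rbrakk> \<Longrightarrow> f (r \<odot>\<^bsub>M\<^esub> x) = r \<odot>\<^bsub>N\<^esub> f x"
  shows "f \<in> module_hom R M N"
  using assms by (auto simp: module_hom_def)

lemma module_hom_closed: "f \<in> module_hom R M N \<Longrightarrow> x \<in> carrier M \<Longrightarrow> f x \<in> carrier N"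
  by (auto simp: module_hom_def)

lemma module_hom_add:
  "f \<in> module_hom R M N \<Longrightarrow> x \<in> carrier M \<Longrightarrow> y \<in> carrier M \<Longrightarrow> f (x \<oplus>\<^bsub>M\<^esub> y) = f x \<oplus>\<^bsub>N\<^esub> f y"
  by (auto simp: module_hom_def)

lemma module_hom_smult:
  "f \<in> module_hom R M N \<Longrightarrow> r \<in> carrier R \<Longrightarrow> x \<in> carrier M \<Longrightarrow> f (r \<odot>\<^bsub>M\<^esub> x) = r \<odot>\<^bsub>N\<^esub> f x"
  by (auto simp: module_hom_def)

lemma module_hom_compose:
  "f \<in> module_hom R M N \<Longrightarrow> g \<in> module_hom R N P \<Longrightarrow> (\<lambda>x. g (f x)) \<in> module_hom R M P"
  by (auto simp: module_hom_def)

lemma module_hom_ident: "(\<lambda>x. x) \<in> module_hom R M M"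
  by (auto simp: module_hom_def)

lemma module_hom_zero:
  assumes "abelian_group M" "abelian_group N" "f \<in> module_hom R M N"
  shows "f \<zero>\<^bsub>M\<^esub> = \<zero>\<^bsub>N\<^esub>"
proof -
  interpret M: abelian_group M by fact
  interpret N: abelian_group N by fact
  have c: "f \<zero>\<^bsub>M\<^esub> \<in> carrier N" using module_hom_closed[OF assms(3)] by simp
  have "f \<zero>\<^bsub>M\<^esub> \<oplus>\<^bsub>N\<^esub> f \<zero>\<^bsub>M\<^esub> = f \<zero>\<^bsub>M\<^esub> \<oplus>\<^bsub>N\<^esub> \<zero>\<^bsub>N\<^esub>"
    using module_hom_add[OF assms(3), of "\<zero>\<^bsub>M\<^esub>" "\<zero>\<^bsub>M\<^esub>"] c by simp
  then show ?thesis using c N.add.l_cancel_one' by (metis N.r_zero)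
qed

lemma module_hom_uminus:
  assumes "abelian_group M" "abelian_group N" "f \<in> module_hom R M N" "x \<in> carrier M"
  shows "f (\<ominus>\<^bsub>M\<^esub> x) = \<ominus>\<^bsub>N\<^esub> f x"
proof -
  interpret M: abelian_group M by fact
  interpret N: abelian_group N by fact
  have "f (\<ominus>\<^bsub>M\<^esub> x) \<oplus>\<^bsub>N\<^esub> f x = \<zero>\<^bsub>N\<^esub>"
    using module_hom_add[OF assms(3), of "\<ominus>\<^bsub>M\<^esub> x" x] assms(4) module_hom_zero[OF assms(1-3)]
    by (simp add: M.l_neg)
  then show ?thesis
    using module_hom_closed[OF assms(3)] assms(4) by (intro N.minus_equality[symmetric]) auto
qed

lemma module_hom_finsum:
  assumes "abelian_group M" "abelian_group N" "f \<in> module_hom R M N" "u \<in> I \<rightarrow> carrier M"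
  shows "f (\<Oplus>\<^bsub>M\<^esub>i\<in>I. u i) = (\<Oplus>\<^bsub>N\<^esub>i\<in>I. f (u i))"
proof -
  interpret M: abelian_group M by fact
  interpret N: abelian_group N by fact
  show ?thesis using assms(4)
  proof (induction I rule: infinite_finite_induct)
    case (insert i I)
    then have *: "u i \<in> carrier M" "u \<in> I \<rightarrow> carrier M" by auto
    then have "(\<lambda>i. f (u i)) \<in> I \<rightarrow> carrier N" "f (u i) \<in> carrier N"
      using module_hom_closed[OF assms(3)] by auto
    then show ?case using insert * by (simp add: module_hom_add[OF assms(3)])
  qed (use module_hom_zero[OF assms(1-3)] in auto)
qed

lemma module_hom_cong:
  assumes "abelian_group M" "f \<in> module_hom R M N" "\<And>x. x \<in> carrier M \<Longrightarrow> g x = f x"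
    and "\<And>r x. r \<in> carrier R \<Longrightarrow> x \<in> carrier M \<Longrightarrow> r \<odot>\<^bsub>M\<^esub> x \<in> carrier M"
  shows "g \<in> module_hom R M N"
  using assms by (auto simp: module_hom_def abelian_monoid.a_closed[OF abelian_group.axioms(1)])

lemma module_homs_add:
  assumes "module R N" "f \<in> module_hom R M N" "g \<in> module_hom R M N"
  shows "(\<lambda>x. f x \<oplus>\<^bsub>N\<^esub> g x) \<in> module_hom R M N"
proof -
  interpret N: module R N by fact
  show ?thesis
    using assms(2,3) by (auto simp: module_hom_def N.smult_r_distr N.M.add.m_ac)
qed

lemma module_homs_uminus:
  assumes "module R N" "f \<in> module_hom R M N"
  shows "(\<lambda>x. \<ominus>\<^bsub>N\<^esub> f x) \<in> module_hom R M N"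
proof -
  interpret N: module R N by fact
  show ?thesis
    using assms(2) by (auto simp: module_hom_def N.smult_r_minus N.minus_add)
qed

lemma module_homs_smult:
  assumes "module R N" "f \<in> module_hom R M N" "c \<in> carrier R"
  shows "(\<lambda>x. c \<odot>\<^bsub>N\<^esub> f x) \<in> module_hom R M N"
proof -
  interpret N: module R N by fact
  show ?thesis
    using assms(2,3)
    by (auto simp: module_hom_def N.smult_r_distr N.smult_assoc1[symmetric] N.R.m_comm)
qed

lemma module_homs_zero:
  assumes "module R N"
  shows "(\<lambda>x. \<zero>\<^bsub>N\<^esub>) \<in> module_hom R M N"
proof -
  interpret N: module R N by fact
  show ?thesis by (auto simp: module_hom_def)
qed

lemma module_homs_finsum:
  assumes "module R N" "\<And>i. i \<in> I \<Longrightarrow> f i \<in> module_hom R M N"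
  shows "(\<lambda>x. \<Oplus>\<^bsub>N\<^esub>i\<in>I. f i x) \<in> module_hom R M N"
proof -
  interpret N: module R N by fact
  have c: "f i x \<in> carrier N" if "i \<in> I" "x \<in> carrier M" for i x
    using assms(2) that module_hom_closed by fast
  show ?thesis
  proof (cases "finite I")
    case True
    show ?thesis
    proof (rule module_homI)
      fix x y assume xy: "x \<in> carrier M" "y \<in> carrier M"
      have "(\<Oplus>\<^bsub>N\<^esub>i\<in>I. f i (x \<oplus>\<^bsub>M\<^esub> y)) = (\<Oplus>\<^bsub>N\<^esub>i\<in>I. f i x \<oplus>\<^bsub>N\<^esub> f i y)"
        using xy c by (intro N.M.finsum_cong') (auto simp: module_hom_add[OF assms(2)])
      then show "(\<Oplus>\<^bsub>N\<^esub>i\<in>I. f i (x \<oplus>\<^bsub>M\<^esub> y)) = (\<Oplus>\<^bsub>N\<^esub>i\<in>I. f i x) \<oplus>\<^bsub>N\<^esub> (\<Oplus>\<^bsub>N\<^esub>i\<in>I. f i y)"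
        using xy c by (simp add: N.M.finsum_addf Pi_def)
    next
      fix r x assume rx: "r \<in> carrier R" "x \<in> carrier M"
      have "(\<Oplus>\<^bsub>N\<^esub>i\<in>I. f i (r \<odot>\<^bsub>M\<^esub> x)) = (\<Oplus>\<^bsub>N\<^esub>i\<in>I. r \<odot>\<^bsub>N\<^esub> f i x)"
        using rx c by (intro N.M.finsum_cong') (auto simp: module_hom_smult[OF assms(2)])
      then show "(\<Oplus>\<^bsub>N\<^esub>i\<in>I. f i (r \<odot>\<^bsub>M\<^esub> x)) = r \<odot>\<^bsub>N\<^esub> (\<Oplus>\<^bsub>N\<^esub>i\<in>I. f i x)"
        using rx c True by (simp add: N.finsum_smult_ldistr Pi_def)
    qed (use c in auto)
  qed (simp add: module_homs_zero[OF assms(1)])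
qed

lemma module_hom_kernel_submodule:
  assumes "module R M" "module R N" "f \<in> module_hom R M N"
  shows "submodule {x \<in> carrier M. f x = \<zero>\<^bsub>N\<^esub>} R M"
proof -
  interpret M: module R M by fact
  interpret N: module R N by fact
  note ag = M.M.abelian_group_axioms N.M.abelian_group_axioms
  show ?thesis
    by (rule M.submoduleI)
      (auto simp: module_hom_zero[OF ag assms(3)] module_hom_uminus[OF ag assms(3)]
        module_hom_add[OF assms(3)] module_hom_smult[OF assms(3)])
qed

section \<open>Free modules\<close>

lemma free_module_simps [simp]:
  "\<zero>\<^bsub>free_module R X\<^esub> = (\<lambda>x. \<zero>\<^bsub>R\<^esub>)"
  "f \<oplus>\<^bsub>free_module R X\<^esub> g = (\<lambda>x. f x \<oplus>\<^bsub>R\<^esub> g x)"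
  "r \<odot>\<^bsub>free_module R X\<^esub> f = (\<lambda>x. r \<otimes>\<^bsub>R\<^esub> f x)"
  by (auto simp: free_module_def)

lemma free_module_carrier:
  "f \<in> carrier (free_module R X) \<longleftrightarrow>
    (\<forall>x. f x \<in> carrier R) \<and> finite {x. f x \<noteq> \<zero>\<^bsub>R\<^esub>} \<and> {x. f x \<noteq> \<zero>\<^bsub>R\<^esub>} \<subseteq> X"
  by (auto simp: free_module_def)

lemma free_module_module:
  fixes R (structure)
  assumes "cring R"
  shows "module R (free_module R X)"
proof -
  interpret cring R by fact
  let ?F = "free_module R X"
  have add: "f \<oplus>\<^bsub>?F\<^esub> g \<in> carrier ?F" if "f \<in> carrier ?F" "g \<in> carrier ?F" for f g
  proof -
    have "{x. f x \<oplus> g x \<noteq> \<zero>} \<subseteq> {x. f x \<noteq> \<zero>} \<union> {x. g x \<noteq> \<zero>}"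
      using that by (auto simp: free_module_carrier)
    then show ?thesis using that unfolding free_module_carrier
      by (auto intro: finite_subset)
  qed
  have smult: "r \<odot>\<^bsub>?F\<^esub> f \<in> carrier ?F" if "r \<in> carrier R" "f \<in> carrier ?F" for f r
  proof -
    have "{x. r \<otimes> f x \<noteq> \<zero>} \<subseteq> {x. f x \<noteq> \<zero>}" using that by auto
    then show ?thesis using that unfolding free_module_carrier
      by (auto intro: finite_subset)
  qed
  have uminus: "\<exists>g \<in> carrier ?F. g \<oplus>\<^bsub>?F\<^esub> f = \<zero>\<^bsub>?F\<^esub>" if "f \<in> carrier ?F" for f
    using that by (intro bexI[of _ "\<lambda>x. \<ominus> f x"]) (auto simp: free_module_carrier l_neg)
  have zero: "\<zero>\<^bsub>?F\<^esub> \<in> carrier ?F" by (simp add: free_module_carrier)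
  have c: "f x \<in> carrier R" if "f \<in> carrier ?F" for f x
    using that by (auto simp: free_module_carrier)
  show ?thesis
    using add smult uminus zero
    by (intro moduleI abelian_groupI) (auto simp: c a_ac l_distr r_distr m_assoc assms)
qed

lemma basis_vector_carrier:
  fixes R (structure)
  assumes "cring R" "x \<in> X"
  shows "basis_vector R x \<in> carrier (free_module R X)"
proof -
  interpret cring R by fact
  have "{y. basis_vector R x y \<noteq> \<zero>} \<subseteq> {x}" by (auto simp: basis_vector_def)
  then show ?thesis using assms(2)
    by (auto simp: free_module_carrier intro: finite_subset) (auto simp: basis_vector_def)
qed

text \<open>Extensions of different arguments can be added only after their supports are enlarged to a common
  finite set.\<close>

lemma linear_extension_superset:
  assumes "module R V" "f \<in> carrier (free_module R X)" "\<phi> \<in> S \<rightarrow> carrier V" "finite S"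
    and "{x. f x \<noteq> \<zero>\<^bsub>R\<^esub>} \<subseteq> S"
  shows "linear_extension R V \<phi> f = (\<Oplus>\<^bsub>V\<^esub>x\<in>S. f x \<odot>\<^bsub>V\<^esub> \<phi> x)"
proof -
  interpret module R V by fact
  show ?thesis unfolding linear_extension_def
    using assms by (intro M.add.finprod_mono_neutral_cong_left)
      (auto simp: free_module_carrier Pi_def)
qed

lemma linear_extension_hom:
  fixes R (structure)
  assumes "module R V" "\<phi> \<in> X \<rightarrow> carrier V"
  shows "linear_extension R V \<phi> \<in> module_hom R (free_module R X) V"
proof -
  interpret module R V by fact
  let ?F = "free_module R X"
  interpret F: module R ?F by (rule free_module_module) (rule R.cring_axioms)
  have c: "f x \<in> carrier R" if "f \<in> carrier ?F" for f x
    using that by (auto simp: free_module_carrier)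
  show ?thesis
  proof (rule module_homI)
    fix f assume f: "f \<in> carrier ?F"
    show "linear_extension R V \<phi> f \<in> carrier V"
      unfolding linear_extension_def
      using f assms(2) by (intro M.finsum_closed) (auto simp: free_module_carrier)
  next
    fix f g assume fg: "f \<in> carrier ?F" "g \<in> carrier ?F"
    let ?S = "{x. f x \<noteq> \<zero>} \<union> {x. g x \<noteq> \<zero>}"
    have S: "finite ?S" "?S \<subseteq> X" using fg by (auto simp: free_module_carrier)
    have \<phi>: "\<phi> \<in> ?S \<rightarrow> carrier V" using S assms(2) by auto
    note e = linear_extension_superset[OF assms(1) _ \<phi> S(1)]
    have "linear_extension R V \<phi> (f \<oplus>\<^bsub>?F\<^esub> g) = (\<Oplus>\<^bsub>V\<^esub>x\<in>?S. (f \<oplus>\<^bsub>?F\<^esub> g) x \<odot>\<^bsub>V\<^esub> \<phi> x)"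
      by (rule e[OF F.M.a_closed[OF fg]]) (use fg in auto)
    also have "\<dots> = (\<Oplus>\<^bsub>V\<^esub>x\<in>?S. f x \<odot>\<^bsub>V\<^esub> \<phi> x \<oplus>\<^bsub>V\<^esub> g x \<odot>\<^bsub>V\<^esub> \<phi> x)"
      using \<phi> c fg by (intro M.finsum_cong') (auto simp: smult_l_distr Pi_def)
    also have "\<dots> = (\<Oplus>\<^bsub>V\<^esub>x\<in>?S. f x \<odot>\<^bsub>V\<^esub> \<phi> x) \<oplus>\<^bsub>V\<^esub> (\<Oplus>\<^bsub>V\<^esub>x\<in>?S. g x \<odot>\<^bsub>V\<^esub> \<phi> x)"
      using \<phi> c fg by (intro M.finsum_addf) (auto simp: Pi_def)
    also have "\<dots> = linear_extension R V \<phi> f \<oplus>\<^bsub>V\<^esub> linear_extension R V \<phi> g"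
      by (subst (1 2) e) (use fg in auto)
    finally show "linear_extension R V \<phi> (f \<oplus>\<^bsub>?F\<^esub> g) =
      linear_extension R V \<phi> f \<oplus>\<^bsub>V\<^esub> linear_extension R V \<phi> g" .
  next
    fix r f assume r: "r \<in> carrier R" and f: "f \<in> carrier ?F"
    let ?S = "{x. f x \<noteq> \<zero>}"
    have S: "finite ?S" "?S \<subseteq> X" using f by (auto simp: free_module_carrier)
    have \<phi>: "\<phi> \<in> ?S \<rightarrow> carrier V" using S assms(2) by auto
    note e = linear_extension_superset[OF assms(1) _ \<phi> S(1)]
    have "linear_extension R V \<phi> (r \<odot>\<^bsub>?F\<^esub> f) = (\<Oplus>\<^bsub>V\<^esub>x\<in>?S. (r \<odot>\<^bsub>?F\<^esub> f) x \<odot>\<^bsub>V\<^esub> \<phi> x)"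
      by (rule e[OF F.smult_closed[OF r f]]) (use r in auto)
    also have "\<dots> = (\<Oplus>\<^bsub>V\<^esub>x\<in>?S. r \<odot>\<^bsub>V\<^esub> (f x \<odot>\<^bsub>V\<^esub> \<phi> x))"
      using \<phi> c f r by (intro M.finsum_cong') (auto simp: smult_assoc1 Pi_def)
    also have "\<dots> = r \<odot>\<^bsub>V\<^esub> linear_extension R V \<phi> f"
      unfolding linear_extension_def
      using S \<phi> r c f by (intro finsum_smult_ldistr[symmetric]) (auto simp: Pi_def)
    finally show "linear_extension R V \<phi> (r \<odot>\<^bsub>?F\<^esub> f) = r \<odot>\<^bsub>V\<^esub> linear_extension R V \<phi> f" .
  qed
qed

lemma linear_extension_basis_vector:
  assumes "module R V" "\<phi> x \<in> carrier V"
  shows "linear_extension R V \<phi> (basis_vector R x) = \<phi> x"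
proof -
  interpret module R V by fact
  have "linear_extension R V \<phi> (basis_vector R x) = (\<Oplus>\<^bsub>V\<^esub>y\<in>{x}. basis_vector R x y \<odot>\<^bsub>V\<^esub> \<phi> y)"
    using assms(2) basis_vector_carrier[OF R.cring_axioms, of x "{x}"]
    by (intro linear_extension_superset[OF assms(1)]) (auto simp: basis_vector_def)
  then show ?thesis using assms(2) by (simp add: basis_vector_def)
qed

lemma linear_extension_compose:
  assumes "module R V" "module R W" "L \<in> module_hom R V W" "\<phi> \<in> X \<rightarrow> carrier V"
    and "f \<in> carrier (free_module R X)"
  shows "L (linear_extension R V \<phi> f) = linear_extension R W (\<lambda>x. L (\<phi> x)) f"
proof -
  interpret V: module R V by fact
  interpret W: module R W by fact
  have c: "f x \<in> carrier R" for x using assms(5) by (auto simp: free_module_carrier)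
  have \<phi>: "\<phi> x \<in> carrier V" if "f x \<noteq> \<zero>\<^bsub>R\<^esub>" for x
    using assms(4,5) that by (auto simp: free_module_carrier)
  have L: "L v \<in> carrier W" if "v \<in> carrier V" for v
    using assms(3) that by (rule module_hom_closed)
  have "L (linear_extension R V \<phi> f) = (\<Oplus>\<^bsub>W\<^esub>x\<in>{x. f x \<noteq> \<zero>\<^bsub>R\<^esub>}. L (f x \<odot>\<^bsub>V\<^esub> \<phi> x))"
    unfolding linear_extension_def using c \<phi>
    by (intro module_hom_finsum[OF _ _ assms(3)] V.M.abelian_group_axioms W.M.abelian_group_axioms)
      auto
  also have "\<dots> = linear_extension R W (\<lambda>x. L (\<phi> x)) f"
    unfolding linear_extension_def
    using c \<phi> L by (intro W.M.finsum_cong') (auto simp: module_hom_smult[OF assms(3)])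
  finally show ?thesis .
qed

lemma linear_extension_parameter_hom:
  assumes "module R V" "\<And>x. x \<in> X \<Longrightarrow> (\<lambda>p. \<phi> p x) \<in> module_hom R U V"
    and "f \<in> carrier (free_module R X)"
  shows "(\<lambda>p. linear_extension R V (\<phi> p) f) \<in> module_hom R U V"
  unfolding linear_extension_def
  using assms by (intro module_homs_finsum module_homs_smult) (auto simp: free_module_carrier)

lemma linear_extension_cong:
  fixes R (structure)
  assumes "module R V" "\<And>x. x \<in> X \<Longrightarrow> \<phi> x = \<psi> x" "\<psi> \<in> X \<rightarrow> carrier V"
    and "f \<in> carrier (free_module R X)"
  shows "linear_extension R V \<phi> f = linear_extension R V \<psi> f"
proof -
  interpret module R V by fact
  have "\<And>x. f x \<noteq> \<zero> \<Longrightarrow> x \<in> X" using assms(4) by (auto simp: free_module_carrier)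
  then show ?thesis unfolding linear_extension_def
    using assms by (intro M.finsum_cong') (auto simp: free_module_carrier Pi_def)
qed

text \<open>The proof removes one point of the support at a time.\<close>

lemma free_module_hom_ext:
  fixes R (structure)
  assumes R: "cring R" and V: "abelian_group V"
    and h: "h \<in> module_hom R (free_module R X) V" "h' \<in> module_hom R (free_module R X) V"
    and eq: "\<And>x. x \<in> X \<Longrightarrow> h (basis_vector R x) = h' (basis_vector R x)"
    and f: "f \<in> carrier (free_module R X)"
  shows "h f = h' f"
proof -
  interpret cring R by fact
  let ?F = "free_module R X"
  interpret F: module R ?F by (rule free_module_module) fact
  have ag: "abelian_group ?F" by (rule F.M.abelian_group_axioms)
  have "h f = h' f" if "finite S" "{x. f x \<noteq> \<zero>} \<subseteq> S" "f \<in> carrier ?F" for S f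
    using that
  proof (induction S arbitrary: f)
    case empty
    then have "f = \<zero>\<^bsub>?F\<^esub>" by auto
    then show ?case using module_hom_zero[OF ag V h(1)] module_hom_zero[OF ag V h(2)] by metis
  next
    case (insert s S)
    show ?case
    proof (cases "f s = \<zero>")
      case True
      then have "{x. f x \<noteq> \<zero>} \<subseteq> S" using insert.prems(1) by blast
      then show ?thesis using insert by blast
    next
      case False
      define g where "g = f(s := \<zero>)"
      have fc: "\<And>x. f x \<in> carrier R" using insert.prems by (simp add: free_module_carrier)
      have s: "s \<in> X" using insert.prems False by (auto simp: free_module_carrier)
      have sub: "{x. g x \<noteq> \<zero>} \<subseteq> {x. f x \<noteq> \<zero>}" by (auto simp: g_def)
      have g: "g \<in> carrier ?F"
        using insert.prems(2) sub finite_subset[OF sub] fc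
        unfolding free_module_carrier by (auto simp: g_def)
      have "{x. g x \<noteq> \<zero>} \<subseteq> S" using insert.prems by (auto simp: g_def)
      then have IH: "h g = h' g" using insert.IH g by blast
      have e: "basis_vector R s \<in> carrier ?F" using s by (rule basis_vector_carrier[OF R])
      then have e': "f s \<odot>\<^bsub>?F\<^esub> basis_vector R s \<in> carrier ?F"
        using fc by (intro F.smult_closed) auto
      have dec: "f = g \<oplus>\<^bsub>?F\<^esub> f s \<odot>\<^bsub>?F\<^esub> basis_vector R s"
        using fc by (auto simp: g_def basis_vector_def)
      have "h f = h g \<oplus>\<^bsub>V\<^esub> f s \<odot>\<^bsub>V\<^esub> h (basis_vector R s)"
        by (subst dec) (simp only: module_hom_add[OF h(1) g e'] module_hom_smult[OF h(1) fc e])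
      also have "\<dots> = h' g \<oplus>\<^bsub>V\<^esub> f s \<odot>\<^bsub>V\<^esub> h' (basis_vector R s)"
        by (simp only: IH eq[OF s])
      also have "\<dots> = h' f"
        by (subst (2) dec) (simp only: module_hom_add[OF h(2) g e'] module_hom_smult[OF h(2) fc e])
      finally show ?thesis .
    qed
  qed
  then show ?thesis using f by (auto simp: free_module_carrier)
qed

section \<open>Generators and relations\<close>

lemma submodule_abelian_subgroup:
  assumes "module R M" "submodule H R M"
  shows "abelian_subgroup H M"
proof -
  interpret M: module R M by fact
  show ?thesis
    using assms(2) by (intro abelian_subgroupI3 M.M.abelian_group_axioms additive_subgroup.intro)
      (rule submodule.axioms(1))
qed

text \<open>Scalar multiplication of cosets is defined as a union over representatives; all of its members
  coincide.\<close>

lemma quotient_module_smult: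
  assumes "module R M" "submodule H R M" "r \<in> carrier R" "x \<in> carrier M"
  shows "r \<odot>\<^bsub>quotient_module M H\<^esub> (H +>\<^bsub>M\<^esub> x) = H +>\<^bsub>M\<^esub> (r \<odot>\<^bsub>M\<^esub> x)"
proof -
  interpret M: module R M by fact
  interpret H: submodule H R M by fact
  interpret A: abelian_subgroup H M by (rule submodule_abelian_subgroup[OF assms(1,2)])
  have "H +>\<^bsub>M\<^esub> (r \<odot>\<^bsub>M\<^esub> y) = H +>\<^bsub>M\<^esub> (r \<odot>\<^bsub>M\<^esub> x)"
    if y: "y \<in> H +>\<^bsub>M\<^esub> x" for y
  proof -
    obtain k where k: "k \<in> H" "y = k \<oplus>\<^bsub>M\<^esub> x"
      using y unfolding a_r_coset_def' by blast
    have kc: "k \<in> carrier M" using k by (rule_tac A.a_Hcarr)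
    have "r \<odot>\<^bsub>M\<^esub> y = r \<odot>\<^bsub>M\<^esub> k \<oplus>\<^bsub>M\<^esub> r \<odot>\<^bsub>M\<^esub> x"
      using k kc assms by (simp add: M.smult_r_distr)
    then have "r \<odot>\<^bsub>M\<^esub> y \<in> H +>\<^bsub>M\<^esub> (r \<odot>\<^bsub>M\<^esub> x)"
      using H.smult_closed[OF assms(3) k(1)] unfolding a_r_coset_def' by auto
    then show ?thesis using assms
      by (intro A.a_repr_independence'[symmetric] M.smult_closed) auto
  qed
  moreover have "x \<in> H +>\<^bsub>M\<^esub> x" using assms by (intro A.a_rcos_self)
  ultimately have "(\<Union>y\<in>H +>\<^bsub>M\<^esub> x. H +>\<^bsub>M\<^esub> (r \<odot>\<^bsub>M\<^esub> y)) = H +>\<^bsub>M\<^esub> (r \<odot>\<^bsub>M\<^esub> x)"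
    by (intro UN_constant_eq) blast+
  then show ?thesis by (simp add: quotient_module_def)
qed

lemma quotient_module_carrier:
  "carrier (quotient_module M H) = (\<lambda>x. H +>\<^bsub>M\<^esub> x) ` carrier M"
  by (auto simp: quotient_module_def A_RCOSETS_def')

lemma quotient_module_add:
  assumes "module R M" "submodule H R M" "x \<in> carrier M" "y \<in> carrier M"
  shows "(H +>\<^bsub>M\<^esub> x) \<oplus>\<^bsub>quotient_module M H\<^esub> (H +>\<^bsub>M\<^esub> y) = H +>\<^bsub>M\<^esub> (x \<oplus>\<^bsub>M\<^esub> y)"
proof -
  interpret A: abelian_subgroup H M by (rule submodule_abelian_subgroup[OF assms(1,2)])
  show ?thesis using A.a_rcos_sum assms by (simp add: quotient_module_def)
qed

lemma quotient_module_zero: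
  assumes "module R M" "submodule H R M"
  shows "\<zero>\<^bsub>quotient_module M H\<^esub> = H +>\<^bsub>M\<^esub> \<zero>\<^bsub>M\<^esub>"
proof -
  interpret A: abelian_subgroup H M by (rule submodule_abelian_subgroup[OF assms])
  show ?thesis using A.a_coset_add_zero A.a_subset by (simp add: quotient_module_def)
qed

lemma quotient_module_module:
  assumes "module R M" "submodule H R M"
  shows "module R (quotient_module M H)"
proof -
  interpret M: module R M by fact
  note simps = quotient_module_carrier quotient_module_zero[OF assms]
    quotient_module_add[OF assms] quotient_module_smult[OF assms]
  have inv: "\<exists>y \<in> carrier M. H +>\<^bsub>M\<^esub> (x \<oplus>\<^bsub>M\<^esub> y) = H +>\<^bsub>M\<^esub> \<zero>\<^bsub>M\<^esub>" if "x \<in> carrier M" for x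
    using that by (intro bexI[of _ "\<ominus>\<^bsub>M\<^esub> x"]) (auto simp: M.M.r_neg)
  show ?thesis
    by (intro moduleI abelian_groupI)
      (auto simp: simps M.M.a_ac M.smult_l_distr M.smult_r_distr M.smult_assoc1 M.R.cring_axioms inv)
qed

lemma coset_hom:
  assumes "module R M" "submodule H R M"
  shows "(\<lambda>x. H +>\<^bsub>M\<^esub> x) \<in> module_hom R M (quotient_module M H)"
  by (auto intro!: module_homI
      simp: quotient_module_carrier quotient_module_add[OF assms] quotient_module_smult[OF assms])

lemma relation_submodule_submodule:
  assumes "cring R" "rels \<subseteq> carrier (free_module R X)"
  shows "submodule (relation_submodule R X rels) R (free_module R X)"
    and "rels \<subseteq> relation_submodule R X rels"
proof -
  let ?F = "free_module R X"
  interpret F: module R ?F by (rule free_module_module) fact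
  have 1: "carrier ?F \<in> {H. submodule H R ?F \<and> rels \<subseteq> H}"
    using F.carrier_is_submodule assms(2) by auto
  show "submodule (relation_submodule R X rels) R ?F"
    unfolding relation_submodule_def using 1
    by (intro F.submoduleI)
      (auto simp del: free_module_simps dest: F.submoduleE
        subgroup.one_closed[OF submodule.axioms(1)] submodule.smult_closed
        intro: F.submoduleE(5))
  show "rels \<subseteq> relation_submodule R X rels"
    by (auto simp: relation_submodule_def)
qed

lemma relation_submodule_least:
  "submodule H R (free_module R X) \<Longrightarrow> rels \<subseteq> H \<Longrightarrow> relation_submodule R X rels \<subseteq> H"
  by (auto simp: relation_submodule_def)

text \<open>A presented module is an explicit set of cosets. This locale extracts from that construction its
  universal property: \<open>induced_map_hom\<close> and \<open>induced_map_generator\<close> give existence of linear maps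
  out of it, \<open>hom_ext\<close> gives uniqueness, and \<open>coset_eqI\<close> says that the relations hold.\<close>

locale presentation = cring R for R :: "('r, 'z) ring_scheme" (structure) +
  fixes X :: "'x set" and rels :: "('x \<Rightarrow> 'r) set"
  assumes rels: "rels \<subseteq> carrier (free_module R X)"
begin

abbreviation "F \<equiv> free_module R X"
abbreviation "Q \<equiv> presented_module R X rels"
abbreviation "H \<equiv> relation_submodule R X rels"

text \<open>The coset representative chosen by \<open>induced_map\<close>. It depends on the coset alone, which is why the
  rules \<open>induced_map_compose\<close>, \<open>induced_map_parameter_hom\<close> and \<open>induced_map_cong\<close> hold for every
  \<open>\<phi>\<close>, whether or not its linear extension kills the relations.\<close>

definition representative :: "('x \<Rightarrow> 'r) set \<Rightarrow> 'x \<Rightarrow> 'r"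
  where "representative t = (SOME f. f \<in> t)"

lemma F_module: "module R F"
  by (rule free_module_module) (rule cring_axioms)

lemma H_submodule: "submodule H R F"
  by (rule relation_submodule_submodule[OF cring_axioms rels])

lemma Q_module: "module R Q"
  unfolding presented_module_def by (rule quotient_module_module[OF F_module H_submodule])

lemma coset_hom_Q: "(\<lambda>f. H +>\<^bsub>F\<^esub> f) \<in> module_hom R F Q"
  unfolding presented_module_def by (rule coset_hom[OF F_module H_submodule])

lemma Q_carrier: "carrier Q = (\<lambda>f. H +>\<^bsub>F\<^esub> f) ` carrier F"
  unfolding presented_module_def by (rule quotient_module_carrier)

lemma representative:
  assumes "t \<in> carrier Q"
  shows "representative t \<in> carrier F" "t = H +>\<^bsub>F\<^esub> representative t"
proof -
  interpret A: abelian_subgroup H F by (rule submodule_abelian_subgroup[OF F_module H_submodule])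
  obtain f where f: "f \<in> carrier F" "t = H +>\<^bsub>F\<^esub> f" using assms Q_carrier by auto
  have "f \<in> t" using f A.a_rcos_self by simp
  then have r: "representative t \<in> H +>\<^bsub>F\<^esub> f"
    unfolding representative_def using f(2) by (metis someI_ex)
  then show "representative t \<in> carrier F" using A.a_elemrcos_carrier f(1) by blast
  show "t = H +>\<^bsub>F\<^esub> representative t"
    using A.a_repr_independence'[OF r f(1)] f(2) by simp
qed

lemma coset_eqI:
  assumes "f \<ominus>\<^bsub>F\<^esub> g \<in> rels" "f \<in> carrier F" "g \<in> carrier F"
  shows "H +>\<^bsub>F\<^esub> f = H +>\<^bsub>F\<^esub> g"
proof -
  interpret A: abelian_subgroup H F by (rule submodule_abelian_subgroup[OF F_module H_submodule])
  have "f \<ominus>\<^bsub>F\<^esub> g \<in> H" using assms(1) relation_submodule_submodule(2)[OF cring_axioms rels] by auto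
  then have "f \<in> H +>\<^bsub>F\<^esub> g"
    using A.a_rcos_module[OF assms(3,2)] by (simp add: a_minus_def del: free_module_simps)
  then show ?thesis using A.a_repr_independence'[of f g] assms(3) by simp
qed

lemma induced_map_representative:
  "induced_map R V \<phi> t = linear_extension R V \<phi> (representative t)"
  by (simp add: induced_map_def representative_def)

lemma generator_closed: "x \<in> X \<Longrightarrow> generator R X rels x \<in> carrier Q"
  unfolding generator_def Q_carrier by (intro imageI basis_vector_carrier cring_axioms)

lemma hom_ext:
  assumes "abelian_group V" "h \<in> module_hom R Q V" "h' \<in> module_hom R Q V"
    and "\<And>x. x \<in> X \<Longrightarrow> h (generator R X rels x) = h' (generator R X rels x)"
    and "t \<in> carrier Q"
  shows "h t = h' t"
proof -
  have "h (H +>\<^bsub>F\<^esub> representative t) = h' (H +>\<^bsub>F\<^esub> representative t)"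
    using assms(4)
    by (intro free_module_hom_ext[OF cring_axioms assms(1) module_hom_compose[OF coset_hom_Q assms(2)]
          module_hom_compose[OF coset_hom_Q assms(3)] _ representative(1)[OF assms(5)]])
      (simp add: generator_def)
  then show ?thesis using representative(2)[OF assms(5)] by simp
qed

text \<open>If the linear extension of \<open>\<phi>\<close> kills the relations then it kills the submodule that they
  generate, so its value on a coset does not depend on the representative.\<close>

lemma induced_map_coset:
  assumes V: "module R V" and \<phi>: "\<phi> \<in> X \<rightarrow> carrier V"
    and kill: "\<And>r. r \<in> rels \<Longrightarrow> linear_extension R V \<phi> r = \<zero>\<^bsub>V\<^esub>"
    and f: "f \<in> carrier F"
  shows "induced_map R V \<phi> (H +>\<^bsub>F\<^esub> f) = linear_extension R V \<phi> f"
proof -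
  interpret V: module R V by fact
  interpret F: module R F by (rule F_module)
  let ?L = "linear_extension R V \<phi>"
  have L: "?L \<in> module_hom R F V" by (rule linear_extension_hom[OF V \<phi>])
  have sub: "H \<subseteq> {x \<in> carrier F. ?L x = \<zero>\<^bsub>V\<^esub>}"
    using kill rels by (intro relation_submodule_least module_hom_kernel_submodule[OF F_module V L])
        auto
  let ?t = "H +>\<^bsub>F\<^esub> f"
  have t: "?t \<in> carrier Q" using f Q_carrier by auto
  interpret A: abelian_subgroup H F by (rule submodule_abelian_subgroup[OF F_module H_submodule])
  have "representative ?t \<in> ?t"
    unfolding representative_def using A.a_rcos_self[OF f] by (rule someI[of "\<lambda>g. g \<in> ?t"])
  then obtain k where k: "k \<in> H" "representative ?t = k \<oplus>\<^bsub>F\<^esub> f"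
    unfolding a_r_coset_def' by auto
  have "?L (representative ?t) = ?L k \<oplus>\<^bsub>V\<^esub> ?L f"
    unfolding k(2) using k(1) sub f by (intro module_hom_add[OF L]) auto
  also have "\<dots> = ?L f" using k(1) sub module_hom_closed[OF L f] by auto
  finally show ?thesis by (simp add: induced_map_representative)
qed

lemma induced_map_hom:
  assumes V: "module R V" and \<phi>: "\<phi> \<in> X \<rightarrow> carrier V"
    and kill: "\<And>r. r \<in> rels \<Longrightarrow> linear_extension R V \<phi> r = \<zero>\<^bsub>V\<^esub>"
  shows "induced_map R V \<phi> \<in> module_hom R Q V"
proof -
  interpret F: module R F by (rule F_module)
  note L = linear_extension_hom[OF V \<phi>]
  note c = induced_map_coset[OF assms]
  note hom = coset_hom_Q
  show ?thesis
  proof (rule module_homI)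
    fix s t assume s: "s \<in> carrier Q" and t: "t \<in> carrier Q"
    obtain f g where fg: "f \<in> carrier F" "s = H +>\<^bsub>F\<^esub> f" "g \<in> carrier F" "t = H +>\<^bsub>F\<^esub> g"
      using s t Q_carrier by auto
    show "induced_map R V \<phi> (s \<oplus>\<^bsub>Q\<^esub> t) = induced_map R V \<phi> s \<oplus>\<^bsub>V\<^esub> induced_map R V \<phi> t"
      using fg F.M.a_closed[OF fg(1,3)]
      by (simp add: module_hom_add[OF hom, symmetric] c module_hom_add[OF L] del: free_module_simps)
  next
    fix r t assume r: "r \<in> carrier R" and t: "t \<in> carrier Q"
    obtain f where f: "f \<in> carrier F" "t = H +>\<^bsub>F\<^esub> f" using t Q_carrier by auto
    show "induced_map R V \<phi> (r \<odot>\<^bsub>Q\<^esub> t) = r \<odot>\<^bsub>V\<^esub> induced_map R V \<phi> t"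
      using f r F.smult_closed[OF r f(1)]
      by (simp add: module_hom_smult[OF hom, symmetric] c module_hom_smult[OF L] del: free_module_simps)
  qed (use L Q_carrier in \<open>auto simp: c module_hom_closed\<close>)
qed

lemma induced_map_generator:
  assumes V: "module R V" and \<phi>: "\<phi> \<in> X \<rightarrow> carrier V"
    and kill: "\<And>r. r \<in> rels \<Longrightarrow> linear_extension R V \<phi> r = \<zero>\<^bsub>V\<^esub>"
    and x: "x \<in> X"
  shows "induced_map R V \<phi> (generator R X rels x) = \<phi> x"
  unfolding generator_def
  using induced_map_coset[OF V \<phi> kill basis_vector_carrier[OF cring_axioms x]] x \<phi>
  by (simp add: linear_extension_basis_vector[OF V] Pi_def)

lemma induced_map_compose:
  assumes "module R V" "module R W" "L \<in> module_hom R V W" "\<phi> \<in> X \<rightarrow> carrier V" "t \<in> carrier Q"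
  shows "L (induced_map R V \<phi> t) = induced_map R W (\<lambda>x. L (\<phi> x)) t"
  unfolding induced_map_representative
  by (rule linear_extension_compose[OF assms(1-4) representative(1)[OF assms(5)]])

lemma induced_map_closed:
  assumes "module R V" "\<phi> \<in> X \<rightarrow> carrier V" "t \<in> carrier Q"
  shows "induced_map R V \<phi> t \<in> carrier V"
  unfolding induced_map_representative
  by (rule module_hom_closed[OF linear_extension_hom[OF assms(1,2)] representative(1)[OF assms(3)]])

lemma induced_map_parameter_hom:
  assumes "module R V" "\<And>x. x \<in> X \<Longrightarrow> (\<lambda>p. \<phi> p x) \<in> module_hom R U V" "t \<in> carrier Q"
  shows "(\<lambda>p. induced_map R V (\<phi> p) t) \<in> module_hom R U V"
  unfolding induced_map_representative
  by (rule linear_extension_parameter_hom[OF assms(1,2) representative(1)[OF assms(3)]])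

lemma induced_map_cong:
  assumes "module R V" "\<And>x. x \<in> X \<Longrightarrow> \<phi> x = \<psi> x" "\<psi> \<in> X \<rightarrow> carrier V" "t \<in> carrier Q"
  shows "induced_map R V \<phi> t = induced_map R V \<psi> t"
  unfolding induced_map_representative
  by (rule linear_extension_cong[OF assms(1-3) representative(1)[OF assms(4)]])

end

section \<open>Tensor powers\<close>

text \<open>The slots of a tuple are varied by list update, as in the relations that define tensor powers.\<close>

definition multilinear ::
  "('k, 'z) ring_scheme \<Rightarrow> ('k, 'a, 'x) module_scheme \<Rightarrow> nat \<Rightarrow> ('k, 'v, 'y) module_scheme \<Rightarrow>
   ('a list \<Rightarrow> 'v) \<Rightarrow> bool"
  where "multilinear K A m V \<phi> \<longleftrightarrow> \<phi> \<in> tuples A m \<rightarrow> carrier V \<and>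
    (\<forall>xs\<in>tuples A m. \<forall>i<m. (\<lambda>x. \<phi> (xs[i := x])) \<in> module_hom K A V)"

lemma multilinearI:
  assumes "\<And>xs. xs \<in> tuples A m \<Longrightarrow> \<phi> xs \<in> carrier V"
    and "\<And>xs i. xs \<in> tuples A m \<Longrightarrow> i < m \<Longrightarrow> (\<lambda>x. \<phi> (xs[i := x])) \<in> module_hom K A V"
  shows "multilinear K A m V \<phi>"
  using assms by (auto simp: multilinear_def)

lemma multilinear_closed: "multilinear K A m V \<phi> \<Longrightarrow> xs \<in> tuples A m \<Longrightarrow> \<phi> xs \<in> carrier V"
  by (auto simp: multilinear_def)

lemma multilinear_funcset: "multilinear K A m V \<phi> \<Longrightarrow> \<phi> \<in> tuples A m \<rightarrow> carrier V"
  by (auto simp: multilinear_def)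

lemma multilinear_slot:
  "multilinear K A m V \<phi> \<Longrightarrow> xs \<in> tuples A m \<Longrightarrow> i < m \<Longrightarrow>
    (\<lambda>x. \<phi> (xs[i := x])) \<in> module_hom K A V"
  by (auto simp: multilinear_def)

lemma multilinear_compose:
  assumes "multilinear K A m V \<phi>" "L \<in> module_hom K V W"
  shows "multilinear K A m W (\<lambda>xs. L (\<phi> xs))"
  using module_hom_closed[OF assms(2)] module_hom_compose[OF multilinear_slot[OF assms(1)] assms(2)]
  by (intro multilinearI) (auto intro: multilinear_closed[OF assms(1)])

lemma tuples_update: "xs \<in> tuples A m \<Longrightarrow> x \<in> carrier A \<Longrightarrow> xs[i := x] \<in> tuples A m"
  using set_update_subset_insert[of xs i x] by (auto simp: tuples_def)

lemma tuples_nth: "xs \<in> tuples A m \<Longrightarrow> i < m \<Longrightarrow> xs ! i \<in> carrier A"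
  by (auto simp: tuples_def)

lemma tuples_length: "xs \<in> tuples A m \<Longrightarrow> length xs = m"
  by (auto simp: tuples_def)

lemma tuples_Cons: "x # xs \<in> tuples A (Suc m) \<longleftrightarrow> x \<in> carrier A \<and> xs \<in> tuples A m"
  by (auto simp: tuples_def)

lemma tuples_SucE:
  assumes "xs \<in> tuples A (Suc m)"
  obtains y ys where "xs = y # ys" "y \<in> carrier A" "ys \<in> tuples A m"
  using assms by (cases xs) (auto simp: tuples_def)

lemma tuples_pair: "[x, y] \<in> tuples A 2 \<longleftrightarrow> x \<in> carrier A \<and> y \<in> carrier A"
  by (auto simp: tuples_def)

lemma tuples_append: "xs \<in> tuples A m \<Longrightarrow> ys \<in> tuples A n \<Longrightarrow> xs @ ys \<in> tuples A (m + n)"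
  by (auto simp: tuples_def)

lemma multilinear_cong:
  assumes "multilinear K A m V \<phi>" "\<And>xs. xs \<in> tuples A m \<Longrightarrow> \<psi> xs = \<phi> xs"
    and "abelian_group A" "\<And>r x. r \<in> carrier K \<Longrightarrow> x \<in> carrier A \<Longrightarrow> r \<odot>\<^bsub>A\<^esub> x \<in> carrier A"
  shows "multilinear K A m V \<psi>"
proof (rule multilinearI)
  fix xs i assume xs: "xs \<in> tuples A m" "i < m"
  show "(\<lambda>x. \<psi> (xs[i := x])) \<in> module_hom K A V"
    by (rule module_hom_cong[OF assms(3) multilinear_slot[OF assms(1) xs]])
      (use assms tuples_update[OF xs(1)] in auto)
qed (use assms in \<open>auto dest: multilinear_closed\<close>)

context module
begin

lemma tensor_presentation: "presentation R (tuples M m) (multilinearity_relations R M m)"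
proof (intro presentation.intro presentation_axioms.intro R.cring_axioms)
  let ?F = "free_module R (tuples M m)"
  interpret F: module R ?F by (rule free_module_module) (rule R.cring_axioms)
  note e = basis_vector_carrier[OF R.cring_axioms]
  show "multilinearity_relations R M m \<subseteq> carrier ?F"
    by (auto simp: multilinearity_relations_def Let_def simp del: free_module_simps
        intro!: F.M.minus_closed F.M.a_closed F.smult_closed e tuples_update)
qed

lemma tensor_module: "module R (tensor_power R M m)"
  unfolding tensor_power_def by (rule presentation.Q_module[OF tensor_presentation])

lemma tensor_group: "abelian_group (tensor_power R M m)"
  by (rule module.axioms(2)[OF tensor_module])

lemma pure_tensor_generator:
  "xs \<in> tuples M m \<Longrightarrow>
    pure_tensor R M xs = generator R (tuples M m) (multilinearity_relations R M m) xs"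
  by (simp add: pure_tensor_def tuples_length)

lemma pure_tensor_closed: "xs \<in> tuples M m \<Longrightarrow> pure_tensor R M xs \<in> carrier (tensor_power R M m)"
  using presentation.generator_closed[OF tensor_presentation]
  by (simp add: pure_tensor_generator tensor_power_def)

text \<open>Multilinear maps kill the defining relations of the tensor power, so that the universal property of
  presented modules becomes that of tensor powers.\<close>

lemma linear_extension_multilinear:
  assumes V: "module R V" and \<phi>: "multilinear R M m V \<phi>" and r: "r \<in> multilinearity_relations R M m"
  shows "linear_extension R V \<phi> r = \<zero>\<^bsub>V\<^esub>"
proof -
  let ?F = "free_module R (tuples M m)"
  interpret F: module R ?F by (rule free_module_module) (rule R.cring_axioms)
  interpret V: module R V by fact
  note ag = F.M.abelian_group_axioms V.M.abelian_group_axioms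
  note L = linear_extension_hom[OF V multilinear_funcset[OF \<phi>]]
  note e = basis_vector_carrier[OF R.cring_axioms, of _ "tuples M m"]
  have le: "linear_extension R V \<phi> (basis_vector R xs) = \<phi> xs" if "xs \<in> tuples M m" for xs
    using multilinear_closed[OF \<phi> that] by (rule linear_extension_basis_vector[OF V])
  note simps = a_minus_def module_hom_add[OF L] module_hom_smult[OF L] module_hom_uminus[OF ag L]
    le e tuples_update multilinear_closed[OF \<phi>]
  show ?thesis using r unfolding multilinearity_relations_def Let_def
  proof (elim UnE CollectE exE conjE)
    fix xs i x y
    assume r: "r = basis_vector R (xs[i := x \<oplus>\<^bsub>M\<^esub> y]) \<ominus>\<^bsub>?F\<^esub>
        (basis_vector R (xs[i := x]) \<oplus>\<^bsub>?F\<^esub> basis_vector R (xs[i := y]))"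
      and xs: "xs \<in> tuples M m" "i < m" and xy: "x \<in> carrier M" "y \<in> carrier M"
    show ?thesis using xs xy module_hom_add[OF multilinear_slot[OF \<phi> xs] xy] unfolding r
      by (simp add: simps V.M.r_neg del: free_module_simps)
  next
    fix xs i c x
    assume r: "r = basis_vector R (xs[i := c \<odot>\<^bsub>M\<^esub> x]) \<ominus>\<^bsub>?F\<^esub>
        (c \<odot>\<^bsub>?F\<^esub> basis_vector R (xs[i := x]))"
      and xs: "xs \<in> tuples M m" "i < m" and cx: "c \<in> carrier R" "x \<in> carrier M"
    show ?thesis using xs cx module_hom_smult[OF multilinear_slot[OF \<phi> xs] cx] unfolding r
      by (simp add: simps V.M.r_neg del: free_module_simps)
  qed
qed

lemma tensor_map_hom:
  assumes "module R V" "multilinear R M m V \<phi>"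
  shows "induced_map R V \<phi> \<in> module_hom R (tensor_power R M m) V"
  unfolding tensor_power_def
  by (rule presentation.induced_map_hom[OF tensor_presentation])
    (use assms linear_extension_multilinear multilinear_funcset[OF assms(2)] in auto)

lemma tensor_map_pure:
  assumes "module R V" "multilinear R M m V \<phi>" "xs \<in> tuples M m"
  shows "induced_map R V \<phi> (pure_tensor R M xs) = \<phi> xs"
  unfolding pure_tensor_generator[OF assms(3)]
  by (rule presentation.induced_map_generator[OF tensor_presentation])
    (use assms linear_extension_multilinear multilinear_funcset[OF assms(2)] in auto)

lemma tensor_hom_ext:
  assumes "abelian_group V" "h \<in> module_hom R (tensor_power R M m) V"
    and "h' \<in> module_hom R (tensor_power R M m) V"
    and "\<And>xs. xs \<in> tuples M m \<Longrightarrow> h (pure_tensor R M xs) = h' (pure_tensor R M xs)"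
    and "t \<in> carrier (tensor_power R M m)"
  shows "h t = h' t"
  by (rule presentation.hom_ext[OF tensor_presentation, folded tensor_power_def, OF assms(1-3) _
      assms(5)])
    (use assms(4) in \<open>simp add: pure_tensor_generator[symmetric]\<close>)

lemma tensor_map_compose:
  assumes "module R V" "module R W" "L \<in> module_hom R V W" "\<And>xs. xs \<in> tuples M m \<Longrightarrow> \<phi> xs \<in> carrier V"
    and "t \<in> carrier (tensor_power R M m)"
  shows "L (induced_map R V \<phi> t) = induced_map R W (\<lambda>x. L (\<phi> x)) t"
  by (rule presentation.induced_map_compose[OF tensor_presentation, folded tensor_power_def,
      OF assms(1-3) _ assms(5)])
    (use assms in auto)

lemma tensor_map_closed:
  assumes "module R V" "\<And>xs. xs \<in> tuples M m \<Longrightarrow> \<phi> xs \<in> carrier V" "t \<in> carrier (tensor_power R M m)"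
  shows "induced_map R V \<phi> t \<in> carrier V"
  by (rule presentation.induced_map_closed[OF tensor_presentation, folded tensor_power_def,
      OF assms(1) _ assms(3)])
    (use assms in auto)

lemma tensor_map_parameter_hom:
  assumes "module R V" "\<And>xs. xs \<in> tuples M m \<Longrightarrow> (\<lambda>p. \<phi> p xs) \<in> module_hom R U V"
    and "t \<in> carrier (tensor_power R M m)"
  shows "(\<lambda>p. induced_map R V (\<phi> p) t) \<in> module_hom R U V"
  by (rule presentation.induced_map_parameter_hom[OF tensor_presentation, folded tensor_power_def,
      OF assms])

lemma tensor_map_cong:
  assumes "module R V" "\<And>xs. xs \<in> tuples M m \<Longrightarrow> \<phi> xs = \<psi> xs"
    and "\<And>xs. xs \<in> tuples M m \<Longrightarrow> \<psi> xs \<in> carrier V" "t \<in> carrier (tensor_power R M m)"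
  shows "induced_map R V \<phi> t = induced_map R V \<psi> t"
  by (rule presentation.induced_map_cong[OF tensor_presentation, folded tensor_power_def,
      OF assms(1,2) _ assms(4)])
    (use assms in auto)

lemma pure_tensor_multilinear: "multilinear R M m (tensor_power R M m) (pure_tensor R M)"
proof (rule multilinearI)
  let ?X = "tuples M m" and ?T = "tensor_power R M m"
  let ?F = "free_module R ?X" and ?H = "relation_submodule R ?X (multilinearity_relations R M m)"
  interpret P: presentation R ?X "multilinearity_relations R M m" by (rule tensor_presentation)
  interpret F: module R ?F by (rule P.F_module)
  have TQ: "?T = P.Q" by (simp add: tensor_power_def)
  define q where "q = (\<lambda>f. ?H +>\<^bsub>?F\<^esub> f)"
  have q: "q \<in> module_hom R ?F ?T"
    unfolding q_def TQ by (rule P.coset_hom_Q)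
  note diff = P.coset_eqI[folded q_def]
  note e = basis_vector_carrier[OF R.cring_axioms, of _ ?X]
  have p: "pure_tensor R M xs = q (basis_vector R xs)" if "xs \<in> ?X" for xs
    using that by (simp add: pure_tensor_generator generator_def q_def)
  fix xs assume xs: "xs \<in> ?X"
  then show "pure_tensor R M xs \<in> carrier ?T" by (rule pure_tensor_closed)
  fix i assume i: "i < m"
  show "(\<lambda>x. pure_tensor R M (xs[i := x])) \<in> module_hom R M ?T"
  proof (rule module_homI)
    fix x y assume xy: "x \<in> carrier M" "y \<in> carrier M"
    have "q (basis_vector R (xs[i := x \<oplus>\<^bsub>M\<^esub> y])) =
        q (basis_vector R (xs[i := x]) \<oplus>\<^bsub>?F\<^esub> basis_vector R (xs[i := y]))"
      using xs i xy
      by (intro diff e F.M.a_closed tuples_update)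
        (auto simp: multilinearity_relations_def Let_def simp del: free_module_simps)
    then show "pure_tensor R M (xs[i := x \<oplus>\<^bsub>M\<^esub> y]) =
        pure_tensor R M (xs[i := x]) \<oplus>\<^bsub>?T\<^esub> pure_tensor R M (xs[i := y])"
      using xs xy by (simp add: p tuples_update module_hom_add[OF q] e del: free_module_simps)
  next
    fix c x assume cx: "c \<in> carrier R" "x \<in> carrier M"
    have "q (basis_vector R (xs[i := c \<odot>\<^bsub>M\<^esub> x])) = q (c \<odot>\<^bsub>?F\<^esub> basis_vector R (xs[i := x]))"
      using xs i cx
      by (intro diff e F.smult_closed tuples_update)
        (auto simp: multilinearity_relations_def Let_def simp del: free_module_simps)
    then show "pure_tensor R M (xs[i := c \<odot>\<^bsub>M\<^esub> x]) = c \<odot>\<^bsub>?T\<^esub> pure_tensor R M (xs[i := x])"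
      using xs cx by (simp add: p tuples_update module_hom_smult[OF q] e del: free_module_simps)
  qed (intro pure_tensor_closed tuples_update xs)
qed

lemma pure_tensor_compose_multilinear:
  "multilinear R M m V (\<lambda>xs. L (pure_tensor R M xs))" if "L \<in> module_hom R (tensor_power R M m) V"
  by (rule multilinear_compose[OF pure_tensor_multilinear that])

text \<open>Both sides are linear in \<open>s\<close>, and for pure \<open>s\<close> they agree by \<open>tensor_map_pure\<close>. In the
  calculus below this exchanges the order of two Sweedler summations.\<close>

lemma tensor_map_swap:
  assumes V: "module R V"
    and \<phi>: "\<And>ys. ys \<in> tuples M n \<Longrightarrow> multilinear R M m V (\<lambda>xs. \<phi> xs ys)"
    and s: "s \<in> carrier (tensor_power R M m)" and t: "t \<in> carrier (tensor_power R M n)"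
  shows "induced_map R V (\<lambda>xs. induced_map R V (\<phi> xs) t) s =
    induced_map R V (\<lambda>ys. induced_map R V (\<lambda>xs. \<phi> xs ys) s) t"
proof -
  interpret V: module R V by fact
  have slot: "multilinear R M m V (\<lambda>xs. induced_map R V (\<phi> xs) t)"
  proof (rule multilinearI)
    fix xs i assume xs: "xs \<in> tuples M m" "i < m"
    show "(\<lambda>x. induced_map R V (\<phi> (xs[i := x])) t) \<in> module_hom R M V"
      by (rule tensor_map_parameter_hom[OF V _ t]) (rule multilinear_slot[OF \<phi> xs])
  qed (use multilinear_closed[OF \<phi>] in \<open>auto intro: tensor_map_closed[OF V _ t]\<close>)
  show ?thesis
  proof (rule tensor_hom_ext[OF V.M.abelian_group_axioms tensor_map_hom[OF V slot] _ _ s])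
    show "(\<lambda>s. induced_map R V (\<lambda>ys. induced_map R V (\<lambda>xs. \<phi> xs ys) s) t)
      \<in> module_hom R (tensor_power R M m) V"
      by (rule tensor_map_parameter_hom[OF V _ t]) (rule tensor_map_hom[OF V \<phi>])
  next
    fix xs assume xs: "xs \<in> tuples M m"
    show "induced_map R V (\<lambda>xs. induced_map R V (\<phi> xs) t) (pure_tensor R M xs) =
      induced_map R V (\<lambda>ys. induced_map R V (\<lambda>xs. \<phi> xs ys) (pure_tensor R M xs)) t"
      unfolding tensor_map_pure[OF V slot xs]
      using multilinear_closed[OF \<phi> xs]
      by (intro tensor_map_cong[OF V _ _ t]) (auto simp: tensor_map_pure[OF V \<phi> xs])
  qed
qed

end

section \<open>Calculus with the comultiplication\<close>

lemma tuples_map2: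
  assumes "ring A" "xs \<in> tuples A m" "ys \<in> tuples A m"
  shows "map2 (monoid.mult A) xs ys \<in> tuples A m"
proof -
  interpret ring A by fact
  show ?thesis using assms(2,3) by (fastforce simp: tuples_def set_zip)
qed

lemma map2_update_right:
  "i < length xs \<Longrightarrow> length xs = length ys \<Longrightarrow>
    map2 f xs (ys[i := y]) = (map2 f xs ys)[i := f (xs ! i) y]"
  by (intro nth_equalityI) (auto simp: nth_list_update)

lemma map2_update_left:
  "i < length xs \<Longrightarrow> length xs = length ys \<Longrightarrow>
    map2 f (xs[i := x]) ys = (map2 f xs ys)[i := f x (ys ! i)]"
  by (intro nth_equalityI) (auto simp: nth_list_update)

text \<open>Rules that recognise a function of one variable as a homomorphism. They discharge the linearity
  conditions that accompany every manipulation of a Sweedler sum.\<close>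

named_theorems hom_intros

context hopf_algebra
begin

abbreviation "Hom \<equiv> module_hom K"
abbreviation "T \<equiv> tensor_power K A"

lemma A_module: "module K A" by (rule module_axioms)

lemma comult_closed: "a \<in> carrier A \<Longrightarrow> \<Delta> a \<in> carrier (T 2)"
  by (rule module_hom_closed[OF comult_linear])

lemma antipode_closed [simp]: "a \<in> carrier A \<Longrightarrow> S a \<in> carrier A"
  by (rule module_hom_closed[OF antipode_linear])

lemma counit_closed [simp]: "a \<in> carrier A \<Longrightarrow> \<epsilon> a \<in> carrier K"
  using module_hom_closed[OF counit_linear] by (simp add: regular_module_def with_action_def)

lemma hom_mult_right [hom_intros]:
  assumes "f \<in> Hom U A" "b \<in> carrier A"
  shows "(\<lambda>x. b \<otimes>\<^bsub>A\<^esub> f x) \<in> Hom U A"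
  using assms by (auto simp: module_hom_def A.r_distr smult_mult_right)

lemma hom_mult_left [hom_intros]:
  assumes "f \<in> Hom U A" "b \<in> carrier A"
  shows "(\<lambda>x. f x \<otimes>\<^bsub>A\<^esub> b) \<in> Hom U A"
  using assms by (auto simp: module_hom_def A.l_distr smult_mult_left)

lemma hom_antipode [hom_intros]: "f \<in> Hom U A \<Longrightarrow> (\<lambda>x. S (f x)) \<in> Hom U A"
  by (rule module_hom_compose[OF _ antipode_linear])

lemma hom_counit_smult [hom_intros]:
  assumes "f \<in> Hom U A" "module K V" "v \<in> carrier V"
  shows "(\<lambda>x. \<epsilon> (f x) \<odot>\<^bsub>V\<^esub> v) \<in> Hom U V"
proof -
  interpret V: module K V by fact
  show ?thesis using assms(1,3) counit_linear
    by (auto simp: module_hom_def regular_module_def with_action_def V.smult_l_distr V.smult_assoc1)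
qed

lemmas [hom_intros] = module_hom_ident module_homs_smult

definition bilinear :: "('k, 'v, 'y) module_scheme \<Rightarrow> ('a \<Rightarrow> 'a \<Rightarrow> 'v) \<Rightarrow> bool"
  where "bilinear V \<phi> \<longleftrightarrow>
    (\<forall>x\<in>carrier A. \<phi> x \<in> Hom A V \<and> (\<lambda>y. \<phi> y x) \<in> Hom A V)"

lemma bilinearI [hom_intros]:
  assumes "\<And>x. x \<in> carrier A \<Longrightarrow> (\<lambda>y. \<phi> x y) \<in> Hom A V"
    and "\<And>y. y \<in> carrier A \<Longrightarrow> (\<lambda>x. \<phi> x y) \<in> Hom A V"
  shows "bilinear V \<phi>"
  using assms by (auto simp: bilinear_def)

lemma bilinear_closed:
  "bilinear V \<phi> \<Longrightarrow> x \<in> carrier A \<Longrightarrow> y \<in> carrier A \<Longrightarrow> \<phi> x y \<in> carrier V"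
  by (auto simp: bilinear_def intro: module_hom_closed)

lemma multilinear_pair:
  assumes "bilinear V \<phi>"
  shows "multilinear K A 2 V (\<lambda>xs. \<phi> (xs ! 0) (xs ! 1))"
proof (rule multilinearI)
  fix xs i assume xs: "xs \<in> tuples A 2" and i: "i < (2::nat)"
  have n: "length xs = 2" "xs ! 0 \<in> carrier A" "xs ! 1 \<in> carrier A"
    using xs by (auto simp: tuples_nth tuples_length)
  from i consider "i = 0" | "i = 1" by linarith
  then show "(\<lambda>x. \<phi> (xs[i := x] ! 0) (xs[i := x] ! 1)) \<in> Hom A V"
    using assms n by cases (auto simp: bilinear_def)
qed (rule bilinear_closed[OF assms], auto intro: tuples_nth)

text \<open>\<open>sweedler V \<phi> a\<close> is \<open>\<Sum> \<phi> a\<^sup>(\<^sup>1\<^sup>) a\<^sup>(\<^sup>2\<^sup>)\<close>. It is meaningful for bilinear \<open>\<phi>\<close>.\<close>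

definition sweedler :: "('k, 'v, 'y) module_scheme \<Rightarrow> ('a \<Rightarrow> 'a \<Rightarrow> 'v) \<Rightarrow> 'a \<Rightarrow> 'v"
  where "sweedler V \<phi> a = induced_map K V (\<lambda>xs. \<phi> (xs ! 0) (xs ! 1)) (\<Delta> a)"

lemma sweedler_closed:
  assumes "module K V" "a \<in> carrier A"
    and "\<And>x y. \<lbrakk>x \<in> carrier A; y \<in> carrier A\<rbrakk> \<Longrightarrow> \<phi> x y \<in> carrier V"
  shows "sweedler V \<phi> a \<in> carrier V"
  unfolding sweedler_def
  using assms by (intro tensor_map_closed[OF _ _ comult_closed]) (auto simp: tuples_nth)

lemma sweedler_cong:
  assumes "module K V" "a \<in> carrier A"
    and "\<And>x y. \<lbrakk>x \<in> carrier A; y \<in> carrier A\<rbrakk> \<Longrightarrow> \<phi> x y = \<psi> x y"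
    and "\<And>x y. \<lbrakk>x \<in> carrier A; y \<in> carrier A\<rbrakk> \<Longrightarrow> \<psi> x y \<in> carrier V"
  shows "sweedler V \<phi> a = sweedler V \<psi> a"
  unfolding sweedler_def
  using assms by (intro tensor_map_cong[OF _ _ _ comult_closed]) (auto simp: tuples_nth)

lemma sweedler_hom [hom_intros]:
  assumes "f \<in> Hom U A" "module K V" "bilinear V \<phi>"
  shows "(\<lambda>x. sweedler V \<phi> (f x)) \<in> Hom U V"
proof -
  have "sweedler V \<phi> \<in> Hom A V"
    unfolding sweedler_def
    by (rule module_hom_compose[OF comult_linear tensor_map_hom[OF assms(2) multilinear_pair[OF
        assms(3)]]])
  then show ?thesis by (rule module_hom_compose[OF assms(1)])
qed

lemma sweedler_parameter_hom [hom_intros]: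
  assumes "module K V" "a \<in> carrier A"
    and "\<And>x y. \<lbrakk>x \<in> carrier A; y \<in> carrier A\<rbrakk> \<Longrightarrow> (\<lambda>p. \<phi> p x y) \<in> Hom U V"
  shows "(\<lambda>p. sweedler V (\<phi> p) a) \<in> Hom U V"
  unfolding sweedler_def
  using assms by (intro tensor_map_parameter_hom[OF _ _ comult_closed]) (auto simp: tuples_nth)

lemma sweedler_compose:
  assumes "module K V" "module K W" "L \<in> Hom V W" "a \<in> carrier A"
    and "\<And>x y. \<lbrakk>x \<in> carrier A; y \<in> carrier A\<rbrakk> \<Longrightarrow> \<phi> x y \<in> carrier V"
  shows "L (sweedler V \<phi> a) = sweedler W (\<lambda>x y. L (\<phi> x y)) a"
  unfolding sweedler_def
  using assms by (intro tensor_map_compose[OF _ _ _ _ comult_closed]) (auto simp: tuples_nth)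

lemma sweedler_swap:
  assumes V: "module K V" and a: "a \<in> carrier A" and b: "b \<in> carrier A"
    and \<phi>: "\<And>u v. \<lbrakk>u \<in> carrier A; v \<in> carrier A\<rbrakk> \<Longrightarrow> bilinear V (\<lambda>x y. \<phi> x y u v)"
  shows "sweedler V (\<lambda>x y. sweedler V (\<phi> x y) b) a =
    sweedler V (\<lambda>u v. sweedler V (\<lambda>x y. \<phi> x y u v) a) b"
  unfolding sweedler_def
  using a b by (intro tensor_map_swap[OF V _ comult_closed comult_closed] multilinear_pair \<phi>)
    (auto simp: tuples_nth)

lemma split_pair:
  assumes "ys \<in> tuples A 2"
  shows "ys = [ys ! 0, ys ! 1]"
  using assms by (intro nth_equalityI) (auto simp: tuples_def nth_Cons' less_2_cases_iff)

lemma sweedler_list: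
  assumes "module K V" "a \<in> carrier A" "\<And>ys. ys \<in> tuples A 2 \<Longrightarrow> \<phi> ys \<in> carrier V"
  shows "induced_map K V \<phi> (\<Delta> a) = sweedler V (\<lambda>x y. \<phi> [x, y]) a"
  unfolding sweedler_def
  using assms split_pair
  by (intro tensor_map_cong[OF _ _ _ comult_closed]) (auto simp: tuples_pair tuples_nth)

lemma tuples_splice:
  assumes "xs \<in> tuples A m" "ys \<in> tuples A 2" "i < m"
  shows "take i xs @ ys @ drop (Suc i) xs \<in> tuples A (Suc m)"
  using assms by (auto simp: tuples_def dest: in_set_takeD in_set_dropD)

lemma comult_at_closed:
  assumes "t \<in> carrier (T m)" "i < m"
  shows "comult_at K A \<Delta> m i t \<in> carrier (T (Suc m))"
  unfolding comult_at_def Let_def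
  using assms by (intro tensor_map_closed[OF tensor_module] pure_tensor_closed tuples_splice)
    (auto intro: comult_closed tuples_nth)

text \<open>Evaluating a multilinear map eliminates \<open>comult_at\<close> in favour of a Sweedler sum in one slot.\<close>

lemma tensor_map_comult_at:
  assumes V: "module K V" and \<phi>: "multilinear K A (Suc m) V \<phi>" and t: "t \<in> carrier (T m)" and i: "i < m"
  shows "induced_map K V \<phi> (comult_at K A \<Delta> m i t) =
    induced_map K V (\<lambda>xs. sweedler V (\<lambda>u v. \<phi> (take i xs @ [u, v] @ drop (Suc i) xs)) (xs ! i)) t"
proof -
  note L = tensor_map_hom[OF V \<phi>]
  have c: "xs ! i \<in> carrier A" if "xs \<in> tuples A m" for xs using that i by (rule tuples_nth)
  have in1: "induced_map K (T (Suc m)) (\<lambda>ys. pure_tensor K A (take i xs @ ys @ drop (Suc i) xs)) (\<Delta>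
      (xs ! i))
      \<in> carrier (T (Suc m))" if xs: "xs \<in> tuples A m" for xs
    using i xs by (intro tensor_map_closed[OF tensor_module _ comult_closed] pure_tensor_closed
        tuples_splice c)
  have "induced_map K V \<phi> (comult_at K A \<Delta> m i t) =
    induced_map K V (\<lambda>xs. induced_map K V \<phi> (induced_map K (T (Suc m))
      (\<lambda>ys. pure_tensor K A (take i xs @ ys @ drop (Suc i) xs)) (\<Delta> (xs ! i)))) t"
    unfolding comult_at_def Let_def by (rule tensor_map_compose[OF tensor_module V L in1 t])
  also have "\<dots> = induced_map K V
      (\<lambda>xs. sweedler V (\<lambda>u v. \<phi> (take i xs @ [u, v] @ drop (Suc i) xs)) (xs ! i)) t"
  proof (rule tensor_map_cong[OF V _ _ t])
    fix xs assume xs: "xs \<in> tuples A m"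
    show "sweedler V (\<lambda>u v. \<phi> (take i xs @ [u, v] @ drop (Suc i) xs)) (xs ! i) \<in> carrier V"
      by (intro sweedler_closed V c xs multilinear_closed[OF \<phi>] tuples_splice i)
        (auto simp: tuples_pair)
    have "induced_map K V \<phi> (induced_map K (T (Suc m))
        (\<lambda>ys. pure_tensor K A (take i xs @ ys @ drop (Suc i) xs)) (\<Delta> (xs ! i))) =
      induced_map K V (\<lambda>ys. induced_map K V \<phi>
        (pure_tensor K A (take i xs @ ys @ drop (Suc i) xs))) (\<Delta> (xs ! i))"
      using i xs by (intro tensor_map_compose[OF tensor_module V L _ comult_closed]
          pure_tensor_closed tuples_splice c)
    also have "\<dots> = induced_map K V (\<lambda>ys. \<phi> (take i xs @ ys @ drop (Suc i) xs)) (\<Delta> (xs ! i))"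
      using i xs by (intro tensor_map_cong[OF V _ _ comult_closed] tensor_map_pure[OF V \<phi>]
          multilinear_closed[OF \<phi>] tuples_splice c)
    also have "\<dots> = sweedler V (\<lambda>u v. \<phi> (take i xs @ [u, v] @ drop (Suc i) xs)) (xs ! i)"
      using i xs by (intro sweedler_list V c multilinear_closed[OF \<phi>] tuples_splice)
    finally show "induced_map K V \<phi> (induced_map K (T (Suc m))
        (\<lambda>ys. pure_tensor K A (take i xs @ ys @ drop (Suc i) xs)) (\<Delta> (xs ! i))) =
      sweedler V (\<lambda>u v. \<phi> (take i xs @ [u, v] @ drop (Suc i) xs)) (xs ! i)" .
  qed
  finally show ?thesis .
qed

lemma multilinear_triple:
  assumes 1: "\<And>x y. \<lbrakk>x \<in> carrier A; y \<in> carrier A\<rbrakk> \<Longrightarrow> (\<lambda>z. \<phi> z x y) \<in> Hom A V"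
    and 2: "\<And>x y. \<lbrakk>x \<in> carrier A; y \<in> carrier A\<rbrakk> \<Longrightarrow> (\<lambda>z. \<phi> x z y) \<in> Hom A V"
    and 3: "\<And>x y. \<lbrakk>x \<in> carrier A; y \<in> carrier A\<rbrakk> \<Longrightarrow> (\<lambda>z. \<phi> x y z) \<in> Hom A V"
  shows "multilinear K A (Suc 2) V (\<lambda>xs. \<phi> (xs ! 0) (xs ! 1) (xs ! 2))"
proof (rule multilinearI)
  fix xs i assume xs: "xs \<in> tuples A (Suc 2)" and i: "i < Suc 2"
  have n: "length xs = 3" "xs ! 0 \<in> carrier A" "xs ! Suc 0 \<in> carrier A" "xs ! 2 \<in> carrier A"
    using xs tuples_nth[OF xs] by (auto simp: tuples_length)
  from i consider "i = 0" | "i = 1" | "i = 2" by linarith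
  then show "(\<lambda>x. \<phi> (xs[i := x] ! 0) (xs[i := x] ! 1) (xs[i := x] ! 2)) \<in> Hom A V"
    using n 1 2 3 by cases auto
next
  fix xs assume "xs \<in> tuples A (Suc 2)"
  then show "\<phi> (xs ! 0) (xs ! 1) (xs ! 2) \<in> carrier V"
    by (intro module_hom_closed[OF 3]) (auto intro: tuples_nth)
qed

text \<open>The coassociativity axiom, evaluated under the linear map that a trilinear \<open>\<phi>\<close> induces on the
  third tensor power.\<close>

lemma sweedler_coassoc:
  assumes V: "module K V" and a: "a \<in> carrier A"
    and 1: "\<And>x y. \<lbrakk>x \<in> carrier A; y \<in> carrier A\<rbrakk> \<Longrightarrow> (\<lambda>z. \<phi> z x y) \<in> Hom A V"
    and 2: "\<And>x y. \<lbrakk>x \<in> carrier A; y \<in> carrier A\<rbrakk> \<Longrightarrow> (\<lambda>z. \<phi> x z y) \<in> Hom A V"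
    and 3: "\<And>x y. \<lbrakk>x \<in> carrier A; y \<in> carrier A\<rbrakk> \<Longrightarrow> (\<lambda>z. \<phi> x y z) \<in> Hom A V"
  shows "sweedler V (\<lambda>x z. sweedler V (\<lambda>u v. \<phi> u v z) x) a =
    sweedler V (\<lambda>x y. sweedler V (\<lambda>u v. \<phi> x u v) y) a"
proof -
  have m: "multilinear K A (Suc 2) V (\<lambda>xs. \<phi> (xs ! 0) (xs ! 1) (xs ! 2))"
    by (rule multilinear_triple[of \<phi>]) (rule 1 2 3, assumption+)+
  have c: "\<phi> x y z \<in> carrier V" if "x \<in> carrier A" "y \<in> carrier A" "z \<in> carrier A" for x y z
    using module_hom_closed[OF 3] that by blast
  note e = tensor_map_comult_at[OF V m comult_closed[OF a]]
  have "sweedler V (\<lambda>x z. sweedler V (\<lambda>u v. \<phi> u v z) x) a =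
    induced_map K V (\<lambda>xs. \<phi> (xs ! 0) (xs ! 1) (xs ! 2)) (comult_at K A \<Delta> 2 0 (\<Delta> a))"
    by (subst e, simp, subst sweedler_list[OF V a])
      (auto intro!: sweedler_cong[OF V] sweedler_closed[OF V] c a tuples_nth simp: tuples_length
          nth_append)
  also have "\<dots> = induced_map K V (\<lambda>xs. \<phi> (xs ! 0) (xs ! 1) (xs ! 2)) (comult_at K A \<Delta> 2 1 (\<Delta> a))"
    by (simp only: coassociative[OF a])
  also have "\<dots> = sweedler V (\<lambda>x y. sweedler V (\<lambda>u v. \<phi> x u v) y) a"
    by (subst e, simp, subst sweedler_list[OF V a])
      (auto intro!: sweedler_cong[OF V] sweedler_closed[OF V] c a tuples_nth simp: tuples_length
          nth_append)
  finally show ?thesis .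
qed

lemma sweedler_counit_left:
  assumes V: "module K V" and a: "a \<in> carrier A" and \<psi>: "\<psi> \<in> Hom A V"
  shows "sweedler V (\<lambda>x y. \<epsilon> x \<odot>\<^bsub>V\<^esub> \<psi> y) a = \<psi> a"
proof -
  have "\<psi> a = \<psi> (sweedler A (\<lambda>x y. \<epsilon> x \<odot>\<^bsub>A\<^esub> y) a)"
    using counit_left[OF a] by (simp add: sweedler_def)
  also have "\<dots> = sweedler V (\<lambda>x y. \<psi> (\<epsilon> x \<odot>\<^bsub>A\<^esub> y)) a"
    by (rule sweedler_compose[OF A_module V \<psi> a]) simp
  also have "\<dots> = sweedler V (\<lambda>x y. \<epsilon> x \<odot>\<^bsub>V\<^esub> \<psi> y) a"
    using module_hom_closed[OF \<psi>] module.smult_closed[OF V]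
    by (intro sweedler_cong[OF V a]) (auto simp: module_hom_smult[OF \<psi>])
  finally show ?thesis by simp
qed

lemma sweedler_counit_right:
  assumes V: "module K V" and a: "a \<in> carrier A" and \<psi>: "\<psi> \<in> Hom A V"
  shows "sweedler V (\<lambda>x y. \<epsilon> y \<odot>\<^bsub>V\<^esub> \<psi> x) a = \<psi> a"
proof -
  have "\<psi> a = \<psi> (sweedler A (\<lambda>x y. \<epsilon> y \<odot>\<^bsub>A\<^esub> x) a)"
    using counit_right[OF a] by (simp add: sweedler_def)
  also have "\<dots> = sweedler V (\<lambda>x y. \<psi> (\<epsilon> y \<odot>\<^bsub>A\<^esub> x)) a"
    by (rule sweedler_compose[OF A_module V \<psi> a]) simp
  also have "\<dots> = sweedler V (\<lambda>x y. \<epsilon> y \<odot>\<^bsub>V\<^esub> \<psi> x) a"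
    using module_hom_closed[OF \<psi>] module.smult_closed[OF V]
    by (intro sweedler_cong[OF V a]) (auto simp: module_hom_smult[OF \<psi>])
  finally show ?thesis by simp
qed

lemma sweedler_antipode_left:
  assumes V: "module K V" and a: "a \<in> carrier A" and \<psi>: "\<psi> \<in> Hom A V"
  shows "sweedler V (\<lambda>x y. \<psi> (S x \<otimes>\<^bsub>A\<^esub> y)) a = \<epsilon> a \<odot>\<^bsub>V\<^esub> \<psi> \<one>\<^bsub>A\<^esub>"
proof -
  have "sweedler V (\<lambda>x y. \<psi> (S x \<otimes>\<^bsub>A\<^esub> y)) a = \<psi> (sweedler A (\<lambda>x y. S x \<otimes>\<^bsub>A\<^esub> y) a)"
    by (rule sweedler_compose[OF A_module V \<psi> a, symmetric]) simp
  also have "\<dots> = \<epsilon> a \<odot>\<^bsub>V\<^esub> \<psi> \<one>\<^bsub>A\<^esub>"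
    using antipode_left[OF a] a by (simp add: sweedler_def module_hom_smult[OF \<psi>])
  finally show ?thesis .
qed

lemma sweedler_antipode_right:
  assumes V: "module K V" and a: "a \<in> carrier A" and \<psi>: "\<psi> \<in> Hom A V"
  shows "sweedler V (\<lambda>x y. \<psi> (x \<otimes>\<^bsub>A\<^esub> S y)) a = \<epsilon> a \<odot>\<^bsub>V\<^esub> \<psi> \<one>\<^bsub>A\<^esub>"
proof -
  have "sweedler V (\<lambda>x y. \<psi> (x \<otimes>\<^bsub>A\<^esub> S y)) a = \<psi> (sweedler A (\<lambda>x y. x \<otimes>\<^bsub>A\<^esub> S y) a)"
    by (rule sweedler_compose[OF A_module V \<psi> a, symmetric]) simp
  also have "\<dots> = \<epsilon> a \<odot>\<^bsub>V\<^esub> \<psi> \<one>\<^bsub>A\<^esub>"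
    using antipode_right[OF a] a by (simp add: sweedler_def module_hom_smult[OF \<psi>])
  finally show ?thesis .
qed

lemma sweedler_one:
  assumes "module K V" "bilinear V \<phi>"
  shows "sweedler V \<phi> \<one>\<^bsub>A\<^esub> = \<phi> \<one>\<^bsub>A\<^esub> \<one>\<^bsub>A\<^esub>"
  unfolding sweedler_def comult_one
  using tensor_map_pure[OF assms(1) multilinear_pair[OF assms(2)], of "[\<one>\<^bsub>A\<^esub>, \<one>\<^bsub>A\<^esub>]"]
  by (simp add: tuples_pair)

lemma sweedler_cocommutative:
  assumes "cocommutative K A \<Delta>" and V: "module K V" and \<phi>: "bilinear V \<phi>" and a: "a \<in> carrier A"
  shows "sweedler V (\<lambda>x y. \<phi> y x) a = sweedler V \<phi> a"
proof -
  note m = multilinear_pair[OF \<phi>]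
  have "sweedler V \<phi> a = induced_map K V (\<lambda>xs. \<phi> (xs ! 0) (xs ! 1))
      (induced_map K (T 2) (\<lambda>xs. pure_tensor K A [xs ! 1, xs ! 0]) (\<Delta> a))"
    using assms(1) a by (simp add: sweedler_def cocommutative_def)
  also have "\<dots> = induced_map K V (\<lambda>xs. induced_map K V (\<lambda>xs. \<phi> (xs ! 0) (xs ! 1))
      (pure_tensor K A [xs ! 1, xs ! 0])) (\<Delta> a)"
    by (rule tensor_map_compose[OF tensor_module V tensor_map_hom[OF V m] _ comult_closed[OF a]])
      (auto intro!: pure_tensor_closed simp: tuples_pair tuples_nth)
  also have "\<dots> = sweedler V (\<lambda>x y. \<phi> y x) a"
    unfolding sweedler_def using \<phi>
    by (intro tensor_map_cong[OF V _ _ comult_closed[OF a]])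
      (auto simp: tensor_map_pure[OF V m, unfolded One_nat_def] tuples_pair tuples_nth intro!:
          bilinear_closed[OF \<phi>])
  finally show ?thesis by simp
qed

lemma map2_multilinear_right:
  assumes \<phi>: "multilinear K A m V \<phi>" and xs: "xs \<in> tuples A m"
  shows "multilinear K A m V (\<lambda>ys. \<phi> (map2 (monoid.mult A) xs ys))"
proof (rule multilinearI)
  fix ys i assume ys: "ys \<in> tuples A m" and i: "i < m"
  have "(\<lambda>y. \<phi> ((map2 (monoid.mult A) xs ys)[i := xs ! i \<otimes>\<^bsub>A\<^esub> y])) \<in> Hom A V"
    using xs ys i
    by (intro module_hom_compose[OF hom_mult_right[OF module_hom_ident] multilinear_slot[OF \<phi>]]
        tuples_map2 A.ring_axioms) (auto intro: tuples_nth)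
  then show "(\<lambda>y. \<phi> (map2 (monoid.mult A) xs (ys[i := y]))) \<in> Hom A V"
    using xs ys i by (simp add: map2_update_right tuples_length)
qed (intro multilinear_closed[OF \<phi>] tuples_map2 A.ring_axioms xs)

lemma map2_multilinear_left:
  assumes \<phi>: "multilinear K A m V \<phi>" and ys: "ys \<in> tuples A m"
  shows "multilinear K A m V (\<lambda>xs. \<phi> (map2 (monoid.mult A) xs ys))"
proof (rule multilinearI)
  fix xs i assume xs: "xs \<in> tuples A m" and i: "i < m"
  have "(\<lambda>x. \<phi> ((map2 (monoid.mult A) xs ys)[i := x \<otimes>\<^bsub>A\<^esub> ys ! i])) \<in> Hom A V"
    using xs ys i
    by (intro module_hom_compose[OF hom_mult_left[OF module_hom_ident] multilinear_slot[OF \<phi>]]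
        tuples_map2 A.ring_axioms) (auto intro: tuples_nth)
  then show "(\<lambda>x. \<phi> (map2 (monoid.mult A) (xs[i := x]) ys)) \<in> Hom A V"
    using xs ys i by (simp add: map2_update_left tuples_length)
qed (intro multilinear_closed[OF \<phi>] tuples_map2 A.ring_axioms ys)

lemma tensor_mult_closed:
  assumes "s \<in> carrier (T m)" "t \<in> carrier (T m)"
  shows "tensor_mult K A m s t \<in> carrier (T m)"
  unfolding tensor_mult_def Let_def
  using assms by (intro tensor_map_closed[OF tensor_module] pure_tensor_closed tuples_map2
      A.ring_axioms)

text \<open>The product of a tensor power is only used after evaluation, where it becomes a double sum.\<close>

lemma tensor_map_mult:
  assumes V: "module K V" and \<phi>: "multilinear K A m V \<phi>"
    and s: "s \<in> carrier (T m)" and t: "t \<in> carrier (T m)"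
  shows "induced_map K V \<phi> (tensor_mult K A m s t) =
    induced_map K V (\<lambda>xs. induced_map K V (\<lambda>ys. \<phi> (map2 (monoid.mult A) xs ys)) t) s"
proof -
  note L = tensor_map_hom[OF V \<phi>]
  have c: "induced_map K (T m) (\<lambda>ys. pure_tensor K A (map2 (monoid.mult A) xs ys)) t \<in> carrier (T m)"
    if "xs \<in> tuples A m" for xs
    using that by (intro tensor_map_closed[OF tensor_module _ t] pure_tensor_closed tuples_map2
        A.ring_axioms)
  have "induced_map K V \<phi> (tensor_mult K A m s t) = induced_map K V (\<lambda>xs. induced_map K V \<phi>
      (induced_map K (T m) (\<lambda>ys. pure_tensor K A (map2 (monoid.mult A) xs ys)) t)) s"
    unfolding tensor_mult_def Let_def by (rule tensor_map_compose[OF tensor_module V L c s])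
  also have "\<dots> = induced_map K V (\<lambda>xs. induced_map K V (\<lambda>ys. \<phi> (map2 (monoid.mult A) xs ys)) t) s"
  proof (rule tensor_map_cong[OF V _ _ s])
    fix xs assume xs: "xs \<in> tuples A m"
    note mem = tuples_map2[OF A.ring_axioms xs]
    show "induced_map K V (\<lambda>ys. \<phi> (map2 (monoid.mult A) xs ys)) t \<in> carrier V"
      by (intro tensor_map_closed[OF V _ t] multilinear_closed[OF \<phi>] mem)
    have "induced_map K V \<phi> (induced_map K (T m) (\<lambda>ys. pure_tensor K A (map2 (monoid.mult A) xs ys))
        t) =
      induced_map K V (\<lambda>ys. induced_map K V \<phi> (pure_tensor K A (map2 (monoid.mult A) xs ys))) t"
      by (intro tensor_map_compose[OF tensor_module V L _ t] pure_tensor_closed mem)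
    also have "\<dots> = induced_map K V (\<lambda>ys. \<phi> (map2 (monoid.mult A) xs ys)) t"
      by (intro tensor_map_cong[OF V _ _ t] tensor_map_pure[OF V \<phi>] multilinear_closed[OF \<phi>] mem)
    finally show "induced_map K V \<phi> (induced_map K (T m) (\<lambda>ys. pure_tensor K A (map2 (monoid.mult A)
        xs ys)) t) =
      induced_map K V (\<lambda>ys. \<phi> (map2 (monoid.mult A) xs ys)) t" .
  qed
  finally show ?thesis .
qed

lemma sweedler_mult:
  assumes V: "module K V" and \<phi>: "bilinear V \<phi>" and a: "a \<in> carrier A" and b: "b \<in> carrier A"
  shows "sweedler V \<phi> (a \<otimes>\<^bsub>A\<^esub> b) =
    sweedler V (\<lambda>x y. sweedler V (\<lambda>u v. \<phi> (x \<otimes>\<^bsub>A\<^esub> u) (y \<otimes>\<^bsub>A\<^esub> v)) b) a"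
proof -
  have "sweedler V \<phi> (a \<otimes>\<^bsub>A\<^esub> b) = induced_map K V (\<lambda>xs. induced_map K V (\<lambda>ys.
      \<phi> (map2 (monoid.mult A) xs ys ! 0) (map2 (monoid.mult A) xs ys ! 1)) (\<Delta> b)) (\<Delta> a)"
    using tensor_map_mult[OF V multilinear_pair[OF \<phi>] comult_closed[OF a] comult_closed[OF b]]
    by (simp add: sweedler_def comult_mult[OF a b])
  also have "\<dots> = sweedler V (\<lambda>x y. sweedler V (\<lambda>u v. \<phi> (x \<otimes>\<^bsub>A\<^esub> u) (y \<otimes>\<^bsub>A\<^esub> v)) b) a"
    unfolding sweedler_def using a b \<phi>
    by (intro tensor_map_cong[OF V _ _ comult_closed[OF a]] tensor_map_cong[OF V _ _
        comult_closed[OF b]]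
        tensor_map_closed[OF V _ comult_closed[OF b]])
      (auto simp: tuples_length tuples_nth comult_closed intro!: bilinear_closed[OF \<phi>])
  finally show ?thesis .
qed

text \<open>Both \<open>(a, b) \<mapsto> S (a b)\<close> and \<open>(a, b) \<mapsto> S b S a\<close> are
  convolution inverses of the multiplication. The sum
  \<open>S b\<^sub>1 S a\<^sub>1 a\<^sub>2 b\<^sub>2 S (a\<^sub>3 b\<^sub>3)\<close> evaluates to either of them.\<close>

lemma antipode_mult:
  assumes a: "a \<in> carrier A" and b: "b \<in> carrier A"
  shows "S (a \<otimes>\<^bsub>A\<^esub> b) = S b \<otimes>\<^bsub>A\<^esub> S a"
proof -
  note A = A_module
  note closed = sweedler_closed[OF A]
  define \<tau> where "\<tau> a1 a2 a3 b1 b2 b3 =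
    S b1 \<otimes>\<^bsub>A\<^esub> ((S a1 \<otimes>\<^bsub>A\<^esub> a2) \<otimes>\<^bsub>A\<^esub> (b2 \<otimes>\<^bsub>A\<^esub> S (a3 \<otimes>\<^bsub>A\<^esub> b3)))" for a1 a2 a3 b1 b2 b3
  have \<tau>_closed: "\<tau> a1 a2 a3 b1 b2 b3 \<in> carrier A"
    if "a1 \<in> carrier A" "a2 \<in> carrier A" "a3 \<in> carrier A" "b1 \<in> carrier A" "b2 \<in> carrier A"
      "b3 \<in> carrier A" for a1 a2 a3 b1 b2 b3
    using that by (simp add: \<tau>_def)
  have \<tau>_hom: "(\<lambda>x. \<tau> x x2 x3 x4 x5 x6) \<in> Hom A A"
      "(\<lambda>x. \<tau> x2 x x3 x4 x5 x6) \<in> Hom A A" "(\<lambda>x. \<tau> x2 x3 x x4 x5 x6) \<in> Hom A A"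
      "(\<lambda>x. \<tau> x2 x3 x4 x x5 x6) \<in> Hom A A" "(\<lambda>x. \<tau> x2 x3 x4 x5 x x6) \<in> Hom A A"
      "(\<lambda>x. \<tau> x2 x3 x4 x5 x6 x) \<in> Hom A A"
    if "x2 \<in> carrier A" "x3 \<in> carrier A" "x4 \<in> carrier A" "x5 \<in> carrier A" "x6 \<in> carrier A"
    for x2 x3 x4 x5 x6
    unfolding \<tau>_def using that by (intro hom_intros; simp)+
  let ?sw = "sweedler A"
  \<comment> \<open>Insert the counits \<open>\<epsilon> a\<^sub>2\<close> and \<open>\<epsilon> b\<^sub>2\<close>, and write \<open>\<epsilon> (a\<^sub>2 b\<^sub>2)\<close> as the antipode sum of the product.\<close>
  have "S b \<otimes>\<^bsub>A\<^esub> S a =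
      ?sw (\<lambda>a1 a2. ?sw (\<lambda>b1 b2. \<epsilon> b2 \<odot>\<^bsub>A\<^esub> (\<epsilon> a2 \<odot>\<^bsub>A\<^esub> (S b1 \<otimes>\<^bsub>A\<^esub> S a1))) b) a"
  proof -
    have "?sw (\<lambda>a1 a2. ?sw (\<lambda>b1 b2. \<epsilon> b2 \<odot>\<^bsub>A\<^esub> (\<epsilon> a2 \<odot>\<^bsub>A\<^esub> (S b1 \<otimes>\<^bsub>A\<^esub> S a1))) b) a =
        ?sw (\<lambda>a1 a2. \<epsilon> a2 \<odot>\<^bsub>A\<^esub> (S b \<otimes>\<^bsub>A\<^esub> S a1)) a"
      using a b by (intro sweedler_cong A sweedler_counit_right hom_intros) simp_all
    also have "\<dots> = S b \<otimes>\<^bsub>A\<^esub> S a"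
      using a b by (intro sweedler_counit_right A hom_intros) simp_all
    finally show ?thesis by simp
  qed
  also have "\<dots> = ?sw (\<lambda>a1 a2. ?sw (\<lambda>b1 b2.
      ?sw (\<lambda>u u'. ?sw (\<lambda>v v'. \<tau> a1 u u' b1 v v') b2) a2) b) a"
  proof (intro sweedler_cong A a b)
    fix a1 a2 b1 b2
    assume c: "a1 \<in> carrier A" "a2 \<in> carrier A" "b1 \<in> carrier A" "b2 \<in> carrier A"
    let ?L = "\<lambda>z. S b1 \<otimes>\<^bsub>A\<^esub> (S a1 \<otimes>\<^bsub>A\<^esub> z)"
    have L: "?L \<in> Hom A A" using c by (intro hom_intros) simp_all
    have "\<epsilon> b2 \<odot>\<^bsub>A\<^esub> (\<epsilon> a2 \<odot>\<^bsub>A\<^esub> (S b1 \<otimes>\<^bsub>A\<^esub> S a1)) = ?L (\<epsilon> (a2 \<otimes>\<^bsub>A\<^esub> b2) \<odot>\<^bsub>A\<^esub> \<one>\<^bsub>A\<^esub>)"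
      using c by (simp add: counit_mult smult_mult_right smult_assoc1[symmetric] K.m_comm)
    also have "\<dots> = ?L (?sw (\<lambda>x y. x \<otimes>\<^bsub>A\<^esub> S y) (a2 \<otimes>\<^bsub>A\<^esub> b2))"
      using c by (subst sweedler_antipode_right[OF A _ module_hom_ident]) simp_all
    also have "\<dots> = ?L (?sw (\<lambda>u u'. ?sw (\<lambda>v v'. (u \<otimes>\<^bsub>A\<^esub> v) \<otimes>\<^bsub>A\<^esub> S (u' \<otimes>\<^bsub>A\<^esub> v')) b2) a2)"
      using c by (subst sweedler_mult[OF A]) (auto intro!: hom_intros)
    also have "\<dots> = ?sw (\<lambda>u u'. ?L (?sw (\<lambda>v v'. (u \<otimes>\<^bsub>A\<^esub> v) \<otimes>\<^bsub>A\<^esub> S (u' \<otimes>\<^bsub>A\<^esub> v')) b2)) a2"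
      using c by (intro sweedler_compose[OF A A L] closed) simp_all
    also have "\<dots> = ?sw (\<lambda>u u'. ?sw (\<lambda>v v'. \<tau> a1 u u' b1 v v') b2) a2"
    proof (rule sweedler_cong[OF A])
      fix u u' assume u: "u \<in> carrier A" "u' \<in> carrier A"
      have "?L (?sw (\<lambda>v v'. (u \<otimes>\<^bsub>A\<^esub> v) \<otimes>\<^bsub>A\<^esub> S (u' \<otimes>\<^bsub>A\<^esub> v')) b2) =
          ?sw (\<lambda>v v'. ?L ((u \<otimes>\<^bsub>A\<^esub> v) \<otimes>\<^bsub>A\<^esub> S (u' \<otimes>\<^bsub>A\<^esub> v'))) b2"
        using c u by (intro sweedler_compose[OF A A L]) simp_all
      also have "\<dots> = ?sw (\<lambda>v v'. \<tau> a1 u u' b1 v v') b2"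
        using c u by (intro sweedler_cong[OF A]) (simp_all add: \<tau>_def A.m_assoc)
      finally show "?L (?sw (\<lambda>v v'. (u \<otimes>\<^bsub>A\<^esub> v) \<otimes>\<^bsub>A\<^esub> S (u' \<otimes>\<^bsub>A\<^esub> v')) b2) =
          ?sw (\<lambda>v v'. \<tau> a1 u u' b1 v v') b2" .
    qed (use c in \<open>auto intro!: closed \<tau>_closed\<close>)
    finally show "\<epsilon> b2 \<odot>\<^bsub>A\<^esub> (\<epsilon> a2 \<odot>\<^bsub>A\<^esub> (S b1 \<otimes>\<^bsub>A\<^esub> S a1)) =
        ?sw (\<lambda>u u'. ?sw (\<lambda>v v'. \<tau> a1 u u' b1 v v') b2) a2" .
  qed (use a b in \<open>auto intro!: closed \<tau>_closed\<close>)
  \<comment> \<open>Regroup so that the first two entries of \<open>a\<close> come from one coproduct, and likewise for \<open>b\<close>.\<close>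
  also have "\<dots> = ?sw (\<lambda>a1 a2. ?sw (\<lambda>u u'. ?sw (\<lambda>b1 b2.
      ?sw (\<lambda>v v'. \<tau> a1 u u' b1 v v') b2) b) a2) a"
    using a b by (intro sweedler_cong[OF A] sweedler_swap closed \<tau>_closed hom_intros \<tau>_hom A)
  also have "\<dots> = ?sw (\<lambda>x u'. ?sw (\<lambda>a1 u. ?sw (\<lambda>b1 b2.
      ?sw (\<lambda>v v'. \<tau> a1 u u' b1 v v') b2) b) x) a"
    using a b by (intro sweedler_coassoc[symmetric] A hom_intros \<tau>_hom)
  also have "\<dots> = ?sw (\<lambda>x u'. ?sw (\<lambda>a1 u. ?sw (\<lambda>y v'.
      ?sw (\<lambda>b1 v. \<tau> a1 u u' b1 v v') y) b) x) a"
    using a b by (intro sweedler_cong[OF A] sweedler_coassoc[symmetric] closed \<tau>_closed \<tau>_hom A)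
  also have "\<dots> = ?sw (\<lambda>x u'. ?sw (\<lambda>y v'. ?sw (\<lambda>a1 u.
      ?sw (\<lambda>b1 v. \<tau> a1 u u' b1 v v') y) x) b) a"
    using a b by (intro sweedler_cong[OF A] sweedler_swap closed \<tau>_closed hom_intros \<tau>_hom A)
  \<comment> \<open>Now \<open>S a\<^sub>1 a\<^sub>2\<close> collapses, and after it \<open>S b\<^sub>1 b\<^sub>2\<close>.\<close>
  also have "\<dots> = ?sw (\<lambda>x u'. ?sw (\<lambda>y v'. \<epsilon> x \<odot>\<^bsub>A\<^esub> (\<epsilon> y \<odot>\<^bsub>A\<^esub> S (u' \<otimes>\<^bsub>A\<^esub> v'))) b) a"
  proof (intro sweedler_cong A a b)
    fix x u' y v'
    assume c: "x \<in> carrier A" "u' \<in> carrier A" "y \<in> carrier A" "v' \<in> carrier A"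
    have "?sw (\<lambda>a1 u. ?sw (\<lambda>b1 v. \<tau> a1 u u' b1 v v') y) x =
        ?sw (\<lambda>b1 v. ?sw (\<lambda>a1 u. \<tau> a1 u u' b1 v v') x) y"
      using c by (intro sweedler_swap A hom_intros \<tau>_hom)
    also have "\<dots> = ?sw (\<lambda>b1 v. \<epsilon> x \<odot>\<^bsub>A\<^esub> (S b1 \<otimes>\<^bsub>A\<^esub> v \<otimes>\<^bsub>A\<^esub> S (u' \<otimes>\<^bsub>A\<^esub> v'))) y"
    proof (rule sweedler_cong[OF A])
      fix b1 v assume d: "b1 \<in> carrier A" "v \<in> carrier A"
      let ?\<psi> = "\<lambda>z. S b1 \<otimes>\<^bsub>A\<^esub> (z \<otimes>\<^bsub>A\<^esub> (v \<otimes>\<^bsub>A\<^esub> S (u' \<otimes>\<^bsub>A\<^esub> v')))"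
      have "?\<psi> \<in> Hom A A" using c d by (intro hom_intros) simp_all
      from sweedler_antipode_left[OF A c(1) this]
      show "?sw (\<lambda>a1 u. \<tau> a1 u u' b1 v v') x =
          \<epsilon> x \<odot>\<^bsub>A\<^esub> (S b1 \<otimes>\<^bsub>A\<^esub> v \<otimes>\<^bsub>A\<^esub> S (u' \<otimes>\<^bsub>A\<^esub> v'))"
        using c d by (simp add: \<tau>_def A.m_assoc)
    qed (use c in simp_all)
    also have "\<dots> = \<epsilon> y \<odot>\<^bsub>A\<^esub> (\<epsilon> x \<odot>\<^bsub>A\<^esub> (\<one>\<^bsub>A\<^esub> \<otimes>\<^bsub>A\<^esub> S (u' \<otimes>\<^bsub>A\<^esub> v')))"
      using c by (intro sweedler_antipode_left A hom_intros) simp_all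
    also have "\<dots> = \<epsilon> x \<odot>\<^bsub>A\<^esub> (\<epsilon> y \<odot>\<^bsub>A\<^esub> S (u' \<otimes>\<^bsub>A\<^esub> v'))"
      using c by (simp add: smult_assoc1[symmetric] K.m_comm)
    finally show "?sw (\<lambda>a1 u. ?sw (\<lambda>b1 v. \<tau> a1 u u' b1 v v') y) x =
        \<epsilon> x \<odot>\<^bsub>A\<^esub> (\<epsilon> y \<odot>\<^bsub>A\<^esub> S (u' \<otimes>\<^bsub>A\<^esub> v'))" .
  qed (use a b in \<open>auto intro!: closed\<close>)
  also have "\<dots> = ?sw (\<lambda>x u'. \<epsilon> x \<odot>\<^bsub>A\<^esub> S (u' \<otimes>\<^bsub>A\<^esub> b)) a"
  proof (rule sweedler_cong[OF A a])
    fix x u' assume c: "x \<in> carrier A" "u' \<in> carrier A"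
    have "?sw (\<lambda>y v'. \<epsilon> x \<odot>\<^bsub>A\<^esub> (\<epsilon> y \<odot>\<^bsub>A\<^esub> S (u' \<otimes>\<^bsub>A\<^esub> v'))) b =
        ?sw (\<lambda>y v'. \<epsilon> y \<odot>\<^bsub>A\<^esub> (\<epsilon> x \<odot>\<^bsub>A\<^esub> S (u' \<otimes>\<^bsub>A\<^esub> v'))) b"
      using b c by (intro sweedler_cong A) (simp_all add: smult_assoc1[symmetric] K.m_comm)
    also have "\<dots> = \<epsilon> x \<odot>\<^bsub>A\<^esub> S (u' \<otimes>\<^bsub>A\<^esub> b)"
      using b c by (intro sweedler_counit_left A hom_intros) simp_all
    finally show "?sw (\<lambda>y v'. \<epsilon> x \<odot>\<^bsub>A\<^esub> (\<epsilon> y \<odot>\<^bsub>A\<^esub> S (u' \<otimes>\<^bsub>A\<^esub> v'))) b =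
        \<epsilon> x \<odot>\<^bsub>A\<^esub> S (u' \<otimes>\<^bsub>A\<^esub> b)" .
  qed (use b in simp)
  also have "\<dots> = S (a \<otimes>\<^bsub>A\<^esub> b)"
    using a b by (intro sweedler_counit_left A hom_intros) simp_all
  finally show ?thesis by simp
qed

end

section \<open>The iterated comultiplication\<close>

text \<open>Lists are taken apart at the head from here on, to match the recursion of \<open>iterated_comult\<close>. The
  nonempty carrier provides the head of a tuple when only its tail is given.\<close>

lemma multilinear_Suc:
  "multilinear K A (Suc m) V \<phi> \<longleftrightarrow>
    (\<forall>ys\<in>tuples A m. (\<lambda>x. \<phi> (x # ys)) \<in> module_hom K A V) \<and>
    (\<forall>x\<in>carrier A. multilinear K A m V (\<lambda>ys. \<phi> (x # ys)))"
  (is "?l \<longleftrightarrow> ?r") if ne: "carrier A \<noteq> {}"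
proof
  assume l: ?l
  obtain a where a: "a \<in> carrier A" using ne by auto
  have "(\<lambda>x. \<phi> (x # ys)) \<in> module_hom K A V" if "ys \<in> tuples A m" for ys
    using multilinear_slot[OF l, of "a # ys" 0] a that by (simp add: tuples_Cons)
  moreover have "multilinear K A m V (\<lambda>ys. \<phi> (x # ys))" if x: "x \<in> carrier A" for x
  proof (rule multilinearI)
    fix ys i assume "ys \<in> tuples A m" "i < m"
    then show "(\<lambda>y. \<phi> (x # ys[i := y])) \<in> module_hom K A V"
      using multilinear_slot[OF l, of "x # ys" "Suc i"] x by (simp add: tuples_Cons)
  qed (use x in \<open>auto intro: multilinear_closed[OF l] simp: tuples_Cons\<close>)
  ultimately show ?r by blast
next
  assume r: ?r
  show ?l
  proof (rule multilinearI)
    fix xs i assume xs: "xs \<in> tuples A (Suc m)" and i: "i < Suc m"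
    obtain y ys where y: "xs = y # ys" "y \<in> carrier A" "ys \<in> tuples A m"
      using xs by (rule tuples_SucE)
    show "(\<lambda>x. \<phi> (xs[i := x])) \<in> module_hom K A V"
    proof (cases i)
      case (Suc j)
      then have "multilinear K A m V (\<lambda>ys. \<phi> (y # ys))" "j < m" using r y i by auto
      from multilinear_slot[OF this(1) y(3) this(2)] show ?thesis using y Suc by simp
    qed (use r y in auto)
  next
    fix xs assume xs: "xs \<in> tuples A (Suc m)"
    then obtain y ys where y: "xs = y # ys" "y \<in> carrier A" "ys \<in> tuples A m"
      by (rule tuples_SucE)
    then show "\<phi> xs \<in> carrier V" using r by (auto intro: multilinear_closed)
  qed
qed

definition swap_entries :: "nat \<Rightarrow> nat \<Rightarrow> 'a list \<Rightarrow> 'a list"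
  where "swap_entries i j xs = xs[i := xs ! j, j := xs ! i]"

context hopf_algebra
begin

lemma iterated_comult_closed:
  "b \<in> carrier A \<Longrightarrow> iterated_comult K A \<Delta> n b \<in> carrier (T (Suc n))"
  by (induction n)
    (auto intro!: pure_tensor_closed comult_at_closed simp: tuples_def)

text \<open>\<open>iterated_sweedler n V \<phi> b\<close> is \<open>\<Sum> \<phi> [b\<^sup>(\<^sup>1\<^sup>), \<dots>, b\<^sup>(\<^sup>n\<^sup>+\<^sup>1\<^sup>)]\<close>, with \<open>n + 1\<close> entries.\<close>

definition iterated_sweedler ::
  "nat \<Rightarrow> ('k, 'v, 'y) module_scheme \<Rightarrow> ('a list \<Rightarrow> 'v) \<Rightarrow> 'a \<Rightarrow> 'v"
  where "iterated_sweedler n V \<phi> b = induced_map K V \<phi> (iterated_comult K A \<Delta> n b)"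

abbreviation "multi \<equiv> multilinear K A"

lemma carrier_nonempty: "carrier A \<noteq> {}" by blast

lemmas multi_Suc = multilinear_Suc[OF carrier_nonempty]

lemma multi_Cons_head:
  "multi (Suc m) V \<phi> \<Longrightarrow> ys \<in> tuples A m \<Longrightarrow> (\<lambda>x. \<phi> (x # ys)) \<in> Hom A V"
  by (simp add: multi_Suc)

lemma multi_Cons_tail: "multi (Suc m) V \<phi> \<Longrightarrow> x \<in> carrier A \<Longrightarrow> multi m V (\<lambda>ys. \<phi> (x # ys))"
  by (simp add: multi_Suc)

lemma iterated_sweedler_closed:
  assumes "module K V" "b \<in> carrier A" "\<And>xs. xs \<in> tuples A (Suc n) \<Longrightarrow> \<phi> xs \<in> carrier V"
  shows "iterated_sweedler n V \<phi> b \<in> carrier V"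
  unfolding iterated_sweedler_def
  by (rule tensor_map_closed[OF assms(1,3) iterated_comult_closed[OF assms(2)]])

lemma iterated_sweedler_cong:
  assumes "module K V" "b \<in> carrier A" "\<And>xs. xs \<in> tuples A (Suc n) \<Longrightarrow> \<phi> xs = \<psi> xs"
    and "\<And>xs. xs \<in> tuples A (Suc n) \<Longrightarrow> \<psi> xs \<in> carrier V"
  shows "iterated_sweedler n V \<phi> b = iterated_sweedler n V \<psi> b"
  unfolding iterated_sweedler_def
  by (rule tensor_map_cong[OF assms(1,3,4) iterated_comult_closed[OF assms(2)]])

lemma iterated_sweedler_compose:
  assumes "module K V" "module K W" "L \<in> Hom V W" "b \<in> carrier A"
    and "\<And>xs. xs \<in> tuples A (Suc n) \<Longrightarrow> \<phi> xs \<in> carrier V"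
  shows "L (iterated_sweedler n V \<phi> b) = iterated_sweedler n W (\<lambda>xs. L (\<phi> xs)) b"
  unfolding iterated_sweedler_def
  by (rule tensor_map_compose[OF assms(1-3,5) iterated_comult_closed[OF assms(4)]])

lemma iterated_sweedler_parameter_hom:
  assumes "module K V" "b \<in> carrier A"
    and "\<And>xs. xs \<in> tuples A (Suc n) \<Longrightarrow> (\<lambda>p. \<phi> p xs) \<in> Hom U V"
  shows "(\<lambda>p. iterated_sweedler n V (\<phi> p) b) \<in> Hom U V"
  unfolding iterated_sweedler_def
  by (rule tensor_map_parameter_hom[OF assms(1,3) iterated_comult_closed[OF assms(2)]])

lemma iterated_sweedler_swap:
  assumes V: "module K V" and a: "a \<in> carrier A" and b: "b \<in> carrier A"
    and \<phi>: "\<And>ys. ys \<in> tuples A (Suc n) \<Longrightarrow> multi (Suc m) V (\<lambda>xs. \<phi> xs ys)"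
  shows "iterated_sweedler m V (\<lambda>xs. iterated_sweedler n V (\<phi> xs) b) a =
    iterated_sweedler n V (\<lambda>ys. iterated_sweedler m V (\<lambda>xs. \<phi> xs ys) a) b"
  unfolding iterated_sweedler_def
  by (rule tensor_map_swap[OF V \<phi> iterated_comult_closed[OF a] iterated_comult_closed[OF b]])

lemma iterated_sweedler_sweedler_swap:
  assumes V: "module K V" and a: "a \<in> carrier A" and b: "b \<in> carrier A"
    and \<phi>: "\<And>u v. \<lbrakk>u \<in> carrier A; v \<in> carrier A\<rbrakk> \<Longrightarrow> multi (Suc m) V (\<lambda>xs. \<phi> xs u v)"
  shows "iterated_sweedler m V (\<lambda>xs. sweedler V (\<phi> xs) b) a =
    sweedler V (\<lambda>u v. iterated_sweedler m V (\<lambda>xs. \<phi> xs u v) a) b"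
  unfolding iterated_sweedler_def sweedler_def
  by (rule tensor_map_swap[OF V \<phi> iterated_comult_closed[OF a] comult_closed[OF b]])
    (auto simp: tuples_nth)

lemma iterated_sweedler_0:
  assumes "module K V" "multi 1 V \<phi>" "b \<in> carrier A"
  shows "iterated_sweedler 0 V \<phi> b = \<phi> [b]"
  unfolding iterated_sweedler_def
  using tensor_map_pure[OF assms(1,2), of "[b]"] assms(3) by (simp add: tuples_def)

lemma iterated_sweedler_Suc:
  assumes V: "module K V" and \<phi>: "multi (Suc (Suc n)) V \<phi>" and b: "b \<in> carrier A"
  shows "iterated_sweedler (Suc n) V \<phi> b =
    iterated_sweedler n V (\<lambda>xs. sweedler V (\<lambda>u v. \<phi> (u # v # tl xs)) (hd xs)) b"
proof -
  have "iterated_sweedler (Suc n) V \<phi> b = iterated_sweedler n V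
      (\<lambda>xs. sweedler V (\<lambda>u v. \<phi> (take 0 xs @ [u, v] @ drop (Suc 0) xs)) (xs ! 0)) b"
    unfolding iterated_sweedler_def iterated_comult.simps
    by (rule tensor_map_comult_at[OF V \<phi> iterated_comult_closed[OF b]]) simp
  also have "\<dots> = iterated_sweedler n V (\<lambda>xs. sweedler V (\<lambda>u v. \<phi> (u # v # tl xs)) (hd xs)) b"
    by (rule iterated_sweedler_cong[OF V b])
      (auto elim!: tuples_SucE intro!: sweedler_closed[OF V] multilinear_closed[OF \<phi>]
        simp: tuples_Cons)
  finally show ?thesis .
qed

lemma multi_bilinear:
  assumes \<phi>: "multi (Suc (Suc n)) V \<phi>" and xs: "xs \<in> tuples A n"
  shows "bilinear V (\<lambda>u v. \<phi> (u # v # xs))"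
  using multi_Cons_head[OF multi_Cons_tail[OF \<phi>] xs] multi_Cons_head[OF \<phi>, of "_ # xs"] xs
  by (intro bilinearI) (auto simp: tuples_Cons)

lemma multi_split_head:
  assumes V: "module K V" and \<phi>: "multi (Suc (Suc n)) V \<phi>"
  shows "multi (Suc n) V (\<lambda>xs. sweedler V (\<lambda>u v. \<phi> (u # v # tl xs)) (hd xs))"
  unfolding multi_Suc list.sel
proof (intro conjI ballI)
  fix ys assume ys: "ys \<in> tuples A n"
  show "(\<lambda>x. sweedler V (\<lambda>u v. \<phi> (u # v # ys)) x) \<in> Hom A V"
    by (intro hom_intros V multi_bilinear[OF \<phi> ys])
next
  fix x assume x: "x \<in> carrier A"
  show "multi n V (\<lambda>ys. sweedler V (\<lambda>u v. \<phi> (u # v # ys)) x)"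
  proof (rule multilinearI)
    fix ys i assume ys: "ys \<in> tuples A n" "i < n"
    show "(\<lambda>y. sweedler V (\<lambda>u v. \<phi> (u # v # ys[i := y])) x) \<in> Hom A V"
      using multilinear_slot[OF multi_Cons_tail[OF multi_Cons_tail[OF \<phi>]] ys]
      by (intro sweedler_parameter_hom V x) auto
  qed (use multilinear_closed[OF \<phi>] in \<open>auto intro!: sweedler_closed[OF V x] simp: tuples_Cons\<close>)
qed

lemma iterated_sweedler_hom:
  assumes V: "module K V" and \<phi>: "multi (Suc n) V \<phi>"
  shows "iterated_sweedler n V \<phi> \<in> Hom A V"
  using \<phi>
proof (induction n arbitrary: \<phi>)
  case 0
  have "(\<lambda>b. \<phi> [b]) \<in> Hom A V" using multi_Cons_head[OF 0, of "[]"] by (simp add: tuples_def)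
  then show ?case
    by (rule module_hom_cong[rotated])
      (use 0 V in \<open>auto intro: iterated_sweedler_0 A.is_abelian_group\<close>)
next
  case (Suc n)
  show ?case
    by (rule module_hom_cong[OF _ Suc.IH[OF multi_split_head[OF V Suc.prems]]])
      (use Suc.prems V in \<open>auto intro: iterated_sweedler_Suc A.is_abelian_group\<close>)
qed

text \<open>By coassociativity the iterated comultiplication, which is defined by splitting the first tensor
  factor again and again, may also be computed by splitting \<open>b\<close> once and then iterating on the
  second factor. This is the form used for inductions over lists.\<close>

lemma iterated_sweedler_split:
  assumes V: "module K V" and \<phi>: "multi (Suc (Suc n)) V \<phi>" and b: "b \<in> carrier A"
  shows "iterated_sweedler (Suc n) V \<phi> b =
    sweedler V (\<lambda>u v. iterated_sweedler n V (\<lambda>xs. \<phi> (u # xs)) v) b"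
  using \<phi> b
proof (induction n arbitrary: \<phi> b)
  case 0
  have c: "\<phi> [u, v] \<in> carrier V" if "u \<in> carrier A" "v \<in> carrier A" for u v
    using that by (intro multilinear_closed[OF 0(1)]) (auto simp: tuples_def)
  have "iterated_sweedler (Suc 0) V \<phi> b = sweedler V (\<lambda>u v. \<phi> [u, v]) b"
    using 0 multi_split_head[OF V 0(1)] by (simp add: iterated_sweedler_Suc[OF V]
        iterated_sweedler_0[OF V])
  also have "\<dots> = sweedler V (\<lambda>u v. iterated_sweedler 0 V (\<lambda>xs. \<phi> (u # xs)) v) b"
    using multi_Cons_tail[OF 0(1)] c
    by (intro sweedler_cong[OF V 0(2)]) (auto simp: iterated_sweedler_0[OF V] intro!:
        iterated_sweedler_closed[OF V])
  finally show ?case .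
next
  case (Suc n)
  note \<phi> = Suc.prems(1) and b = Suc.prems(2)
  let ?I = "iterated_sweedler n V"
  have m2: "multi (Suc n) V (\<lambda>xs. \<phi> (u # v # xs))" if "u \<in> carrier A" "v \<in> carrier A" for u v
    by (intro multi_Cons_tail[OF multi_Cons_tail[OF \<phi>]] that)
  have bil: "bilinear V (\<lambda>u v. \<phi> (u # v # xs))" if "xs \<in> tuples A (Suc n)" for xs
    by (rule multi_bilinear[OF \<phi> that])
  have c: "\<phi> (u # v # xs) \<in> carrier V" if "u \<in> carrier A" "v \<in> carrier A" "xs \<in> tuples A (Suc n)"
      for u v xs
    using that by (intro multilinear_closed[OF \<phi>]) (auto simp: tuples_Cons)
  have "iterated_sweedler (Suc (Suc n)) V \<phi> b =
      iterated_sweedler (Suc n) V (\<lambda>xs. sweedler V (\<lambda>u v. \<phi> (u # v # tl xs)) (hd xs)) b"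
    by (rule iterated_sweedler_Suc[OF V \<phi> b])
  also have "\<dots> = sweedler V (\<lambda>x y. ?I (\<lambda>xs. sweedler V (\<lambda>u v. \<phi> (u # v # xs)) x) y) b"
    by (subst Suc.IH[OF multi_split_head[OF V \<phi>] b]) simp
  also have "\<dots> = sweedler V (\<lambda>x y. sweedler V (\<lambda>u v. ?I (\<lambda>xs. \<phi> (u # v # xs)) y) x) b"
    using c by (intro sweedler_cong[OF V b] iterated_sweedler_sweedler_swap[OF V] m2
        sweedler_closed[OF V] iterated_sweedler_closed[OF V])
  also have "\<dots> = sweedler V (\<lambda>u z. sweedler V (\<lambda>v y. ?I (\<lambda>xs. \<phi> (u # v # xs)) y) z) b"
    using bil by (intro sweedler_coassoc V b iterated_sweedler_hom[OF V m2]
        iterated_sweedler_parameter_hom[OF V]) (auto simp: bilinear_def)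
  also have "\<dots> = sweedler V (\<lambda>u z. iterated_sweedler (Suc n) V (\<lambda>xs. \<phi> (u # xs)) z) b"
    using multilinear_closed[OF \<phi>]
    by (intro sweedler_cong[OF V b] Suc.IH[symmetric] multi_Cons_tail[OF \<phi>]
        iterated_sweedler_closed[OF V])
      (auto simp: tuples_Cons)
  finally show ?case .
qed

lemma iterated_sweedler_one:
  assumes V: "module K V" and \<phi>: "multi (Suc n) V \<phi>"
  shows "iterated_sweedler n V \<phi> \<one>\<^bsub>A\<^esub> = \<phi> (replicate (Suc n) \<one>\<^bsub>A\<^esub>)"
  using \<phi>
proof (induction n arbitrary: \<phi>)
  case 0
  then show ?case by (simp add: iterated_sweedler_0[OF V])
next
  case (Suc n)
  have ones: "replicate (Suc n) \<one>\<^bsub>A\<^esub> \<in> tuples A (Suc n)" by (auto simp: tuples_def)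
  have "bilinear V (\<lambda>u v. iterated_sweedler n V (\<lambda>xs. \<phi> (u # xs)) v)"
    using multi_Cons_head[OF Suc.prems] multi_Cons_tail[OF Suc.prems]
    by (intro bilinearI iterated_sweedler_hom[OF V] iterated_sweedler_parameter_hom[OF V])
  then show ?case
    using Suc.IH[OF multi_Cons_tail[OF Suc.prems A.one_closed]]
    by (simp add: iterated_sweedler_split[OF V Suc.prems] sweedler_one[OF V])
qed

text \<open>After splitting off the first entry on both sides the
  induction hypothesis applies to the remaining ones, and the two inner sums change places.\<close>

lemma iterated_sweedler_mult:
  assumes V: "module K V" and \<phi>: "multi (Suc n) V \<phi>" and a: "a \<in> carrier A" and b: "b \<in> carrier A"
  shows "iterated_sweedler n V \<phi> (a \<otimes>\<^bsub>A\<^esub> b) =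
    iterated_sweedler n V (\<lambda>xs. iterated_sweedler n V (\<lambda>ys. \<phi> (map2 (monoid.mult A) xs ys)) b) a"
proof -
  have outer: "multi (Suc n) V (\<lambda>xs. iterated_sweedler n V (\<lambda>ys. \<phi> (map2 (monoid.mult A) xs ys)) b)"
    if \<phi>: "multi (Suc n) V \<phi>" and b: "b \<in> carrier A" for n \<phi> b
  proof (rule multilinearI)
    fix xs i assume "xs \<in> tuples A (Suc n)" "i < Suc n"
    then show "(\<lambda>x. iterated_sweedler n V (\<lambda>ys. \<phi> (map2 (monoid.mult A) (xs[i := x]) ys)) b) \<in> Hom A V"
      by (intro iterated_sweedler_parameter_hom[OF V b] multilinear_slot[OF map2_multilinear_left[OF
          \<phi>]])
  qed (intro iterated_sweedler_closed[OF V b] multilinear_closed[OF \<phi>] tuples_map2 A.ring_axioms)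
  show ?thesis using \<phi> a b
  proof (induction n arbitrary: \<phi> a b)
    case 0
    have "multi (Suc 0) V (\<lambda>ys. \<phi> (map2 (monoid.mult A) [a] ys))"
      using 0 by (intro map2_multilinear_right) (auto simp: tuples_def)
    then show ?case
      using 0 outer[OF 0(1,3)] by (simp add: iterated_sweedler_0[OF V])
  next
    case (Suc n)
    note \<phi> = Suc.prems(1) and a = Suc.prems(2) and b = Suc.prems(3)
    let ?I = "iterated_sweedler n V" and ?m = "map2 (monoid.mult A)"
    have bil: "bilinear V (\<lambda>u v. ?I (\<lambda>xs. \<phi> (u # xs)) v)"
      using multi_Cons_head[OF \<phi>] multi_Cons_tail[OF \<phi>]
      by (intro bilinearI iterated_sweedler_hom[OF V] iterated_sweedler_parameter_hom[OF V])
    have mem: "?m xs ys \<in> tuples A (Suc n)" if "xs \<in> tuples A (Suc n)" "ys \<in> tuples A (Suc n)" for xs ys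
      by (intro tuples_map2 A.ring_axioms that)
    have c: "\<phi> (x \<otimes>\<^bsub>A\<^esub> u # ?m xs ys) \<in> carrier V" if "x \<in> carrier A" "u \<in> carrier A"
      "xs \<in> tuples A (Suc n)" "ys \<in> tuples A (Suc n)" for x u xs ys
      using that mem by (intro multilinear_closed[OF \<phi>]) (auto simp: tuples_Cons)
    have "iterated_sweedler (Suc n) V \<phi> (a \<otimes>\<^bsub>A\<^esub> b) = sweedler V (\<lambda>x y. sweedler V (\<lambda>u v.
        ?I (\<lambda>xs. \<phi> (x \<otimes>\<^bsub>A\<^esub> u # xs)) (y \<otimes>\<^bsub>A\<^esub> v)) b) a"
      using a b by (simp add: iterated_sweedler_split[OF V \<phi>] sweedler_mult[OF V bil])
    also have "\<dots> = sweedler V (\<lambda>x y. sweedler V (\<lambda>u v.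
        ?I (\<lambda>xs. ?I (\<lambda>ys. \<phi> (x \<otimes>\<^bsub>A\<^esub> u # ?m xs ys)) v) y) b) a"
      using a b c by (intro sweedler_cong[OF V] Suc.IH multi_Cons_tail[OF \<phi>] A.m_closed
          sweedler_closed[OF V] iterated_sweedler_closed[OF V])
    also have "\<dots> = sweedler V (\<lambda>x y. ?I (\<lambda>xs. sweedler V (\<lambda>u v.
        ?I (\<lambda>ys. \<phi> (x \<otimes>\<^bsub>A\<^esub> u # ?m xs ys)) v) b) y) a"
      using a b c by (intro sweedler_cong[OF V] iterated_sweedler_sweedler_swap[OF V, symmetric]
          outer multi_Cons_tail[OF \<phi>] A.m_closed sweedler_closed[OF V] iterated_sweedler_closed[OF V])
    also have "\<dots> = sweedler V (\<lambda>x y. ?I (\<lambda>xs. iterated_sweedler (Suc n) V (\<lambda>ys. \<phi> (?m (x # xs) ys))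
        b) y) a"
    proof (intro sweedler_cong[OF V a] iterated_sweedler_cong[OF V])
      fix x y xs assume x: "x \<in> carrier A" "y \<in> carrier A" and xs: "xs \<in> tuples A (Suc n)"
      have xxs: "x # xs \<in> tuples A (Suc (Suc n))" using x xs by (simp add: tuples_Cons)
      show "sweedler V (\<lambda>u v. ?I (\<lambda>ys. \<phi> (x \<otimes>\<^bsub>A\<^esub> u # ?m xs ys)) v) b =
          iterated_sweedler (Suc n) V (\<lambda>ys. \<phi> (?m (x # xs) ys)) b"
        by (simp add: iterated_sweedler_split[OF V map2_multilinear_right[OF \<phi> xxs] b])
      show "iterated_sweedler (Suc n) V (\<lambda>ys. \<phi> (?m (x # xs) ys)) b \<in> carrier V"
        by (intro iterated_sweedler_closed[OF V b] multilinear_closed[OF \<phi>] tuples_map2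
            A.ring_axioms xxs)
    qed (auto intro!: iterated_sweedler_closed[OF V] b multilinear_closed[OF \<phi>] tuples_map2
        A.ring_axioms simp: tuples_Cons simp del: zip.simps list.map)
    also have "\<dots> = iterated_sweedler (Suc n) V (\<lambda>xs. iterated_sweedler (Suc n) V (\<lambda>ys. \<phi> (?m xs ys))
        b) a"
      by (rule iterated_sweedler_split[OF V outer[OF \<phi> b] a, symmetric])
    finally show ?case .
  qed
qed

lemma length_swap_entries [simp]: "length (swap_entries i j xs) = length xs"
  by (simp add: swap_entries_def)

lemma swap_entries_nth:
  "i < length xs \<Longrightarrow> j < length xs \<Longrightarrow> k < length xs \<Longrightarrow>
    swap_entries i j xs ! k = xs ! (Transposition.transpose i j k)"
  by (auto simp: swap_entries_def nth_list_update Transposition.transpose_def)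

lemma swap_entries_tuple:
  "xs \<in> tuples A m \<Longrightarrow> i < m \<Longrightarrow> j < m \<Longrightarrow> swap_entries i j xs \<in> tuples A m"
  unfolding swap_entries_def by (intro tuples_update tuples_nth)

end

lemma permute_tuple_length [simp]: "length (permute_tuple p xs) = length xs"
  by (simp add: permute_tuple_def)

lemma permute_tuple_nth: "j < length xs \<Longrightarrow> permute_tuple p xs ! j = xs ! (p (Suc j) - 1)"
  by (simp add: permute_tuple_def)

lemma permutes_position:
  assumes "p permutes {1..m}" "j < m"
  shows "p (Suc j) - 1 < m" "Suc (p (Suc j) - 1) = p (Suc j)"
  using permutes_in_image[OF assms(1), of "Suc j"] assms(2) by auto

text \<open>Permutations act on the positions \<open>1, \<dots>, m\<close> while list entries are counted from \<open>0\<close>, hence the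
  shifts by one. Entry \<open>j\<close> of the permuted list comes from entry \<open>p (j + 1) - 1\<close>.\<close>

lemma permute_tuple_update:
  assumes p: "p permutes {1..length xs}" and j: "j < length xs"
  shows "permute_tuple p (xs[p (Suc j) - 1 := x]) = (permute_tuple p xs)[j := x]"
proof (rule nth_equalityI)
  fix k assume "k < length (permute_tuple p (xs[p (Suc j) - 1 := x]))"
  then have k: "k < length xs" by simp
  have "p (Suc k) - 1 = p (Suc j) - 1 \<longleftrightarrow> k = j"
    using permutes_position(2)[OF p k] permutes_position(2)[OF p j] permutes_inj[OF p]
    by (metis injD nat.inject)
  then show "permute_tuple p (xs[p (Suc j) - 1 := x]) ! k = (permute_tuple p xs)[j := x] ! k"
    using k j permutes_position(1)[OF p k] permutes_position(1)[OF p j]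
    by (auto simp: permute_tuple_nth nth_list_update)
qed simp

lemma permutes_position_surj:
  assumes p: "p permutes {1..m}" and i: "i < m"
  obtains j where "j < m" "p (Suc j) - 1 = i"
proof -
  have "Suc i \<in> p ` {1..m}" using permutes_image[OF p] i by simp
  then obtain k where "k \<in> {1..m}" "p k = Suc i" by auto
  then show ?thesis using that[of "k - 1"] by auto
qed

lemma permute_tuple_tuple:
  assumes "p permutes {1..m}" "xs \<in> tuples A m"
  shows "permute_tuple p xs \<in> tuples A m"
  using assms permutes_position(1)[OF assms(1)]
  by (auto simp: tuples_def permute_tuple_def)

lemma permute_tuple_map2:
  assumes "p permutes {1..length xs}" "length ys = length xs"
  shows "permute_tuple p (map2 f xs ys) = map2 f (permute_tuple p xs) (permute_tuple p ys)"
  using assms permutes_position(1)[OF assms(1)]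
  by (intro nth_equalityI) (auto simp: permute_tuple_nth)

lemma permute_tuple_id: "permute_tuple id xs = xs"
  by (intro nth_equalityI) (auto simp: permute_tuple_nth)

lemma permute_tuple_transpose:
  assumes "i < length xs" "j < length xs"
  shows "permute_tuple (Transposition.transpose (Suc i) (Suc j)) xs = swap_entries i j xs"
  using assms
  by (intro nth_equalityI)
    (auto simp: permute_tuple_nth swap_entries_def nth_list_update Transposition.transpose_def)

context hopf_algebra
begin

lemma permute_multilinear:
  assumes \<phi>: "multi m V \<phi>" and p: "p permutes {1..m}"
  shows "multi m V (\<lambda>xs. \<phi> (permute_tuple p xs))"
proof (rule multilinearI)
  fix xs i assume xs: "xs \<in> tuples A m" and i: "i < m"
  obtain j where j: "j < m" "p (Suc j) - 1 = i" using permutes_position_surj[OF p i] .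
  have "(\<lambda>x. \<phi> ((permute_tuple p xs)[j := x])) \<in> Hom A V"
    by (rule multilinear_slot[OF \<phi> permute_tuple_tuple[OF p xs] j(1)])
  then show "(\<lambda>x. \<phi> (permute_tuple p (xs[i := x]))) \<in> Hom A V"
    using permute_tuple_update[of p xs j] p j xs by (simp add: tuples_length)
qed (intro multilinear_closed[OF \<phi>] permute_tuple_tuple[OF p])

lemma swap_multilinear:
  assumes "multi m V \<phi>" "i < m" "j < m"
  shows "multi m V (\<lambda>xs. \<phi> (swap_entries i j xs))"
proof (rule multilinear_cong[OF permute_multilinear[OF assms(1), of "Transposition.transpose (Suc i)
    (Suc j)"]])
  show "Transposition.transpose (Suc i) (Suc j) permutes {1..m}"
    using assms by (intro permutes_swap_id) auto
qed (use assms A.is_abelian_group in \<open>auto simp: permute_tuple_transpose tuples_length\<close>)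

text \<open>Swaps that fix the first entry reduce to a shorter coproduct by \<open>iterated_sweedler_split\<close>. The
  swap of the first two entries is cocommutativity at the step that \<open>iterated_comult\<close> performs last.
  The remaining swaps are conjugates of these.\<close>

lemma iterated_sweedler_swap_entries:
  assumes cc: "cocommutative K A \<Delta>" and V: "module K V"
    and \<phi>: "multi (Suc n) V \<phi>" and b: "b \<in> carrier A" and ij: "i < j" "j \<le> n"
  shows "iterated_sweedler n V (\<lambda>xs. \<phi> (swap_entries i j xs)) b = iterated_sweedler n V \<phi> b"
  using \<phi> b ij
proof (induction n arbitrary: \<phi> b i j)
  case 0
  then show ?case by simp
next
  case (Suc n)
  have tail: "iterated_sweedler (Suc n) V (\<lambda>xs. \<phi> (swap_entries (Suc i) (Suc j) xs)) b =
      iterated_sweedler (Suc n) V \<phi> b"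
    if \<phi>: "multi (Suc (Suc n)) V \<phi>" and ij: "i < j" "j \<le> n" for \<phi> i j
  proof -
    have m: "multi (Suc (Suc n)) V (\<lambda>xs. \<phi> (swap_entries (Suc i) (Suc j) xs))"
      using ij by (intro swap_multilinear[OF \<phi>]) auto
    have "iterated_sweedler (Suc n) V (\<lambda>xs. \<phi> (swap_entries (Suc i) (Suc j) xs)) b =
        sweedler V (\<lambda>u v. iterated_sweedler n V (\<lambda>xs. \<phi> (u # swap_entries i j xs)) v) b"
      by (subst iterated_sweedler_split[OF V m Suc.prems(2)]) (simp add: swap_entries_def)
    also have "\<dots> = sweedler V (\<lambda>u v. iterated_sweedler n V (\<lambda>xs. \<phi> (u # xs)) v) b"
      using multilinear_closed[OF \<phi>]
      by (intro sweedler_cong[OF V Suc.prems(2)] Suc.IH multi_Cons_tail[OF \<phi>] ij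
          iterated_sweedler_closed[OF V]) (auto simp: tuples_Cons)
    also have "\<dots> = iterated_sweedler (Suc n) V \<phi> b"
      by (rule iterated_sweedler_split[OF V \<phi> Suc.prems(2), symmetric])
    finally show ?thesis .
  qed
  have first: "iterated_sweedler (Suc n) V (\<lambda>xs. \<phi> (swap_entries 0 1 xs)) b =
      iterated_sweedler (Suc n) V \<phi> b" if \<phi>: "multi (Suc (Suc n)) V \<phi>" for \<phi>
  proof -
    have m: "multi (Suc (Suc n)) V (\<lambda>xs. \<phi> (swap_entries 0 1 xs))"
      by (intro swap_multilinear[OF \<phi>]) auto
    have "iterated_sweedler (Suc n) V (\<lambda>xs. \<phi> (swap_entries 0 1 xs)) b =
        iterated_sweedler n V (\<lambda>xs. sweedler V (\<lambda>u v. \<phi> (v # u # tl xs)) (hd xs)) b"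
      by (subst iterated_sweedler_Suc[OF V m Suc.prems(2)]) (simp add: swap_entries_def)
    also have "\<dots> = iterated_sweedler n V (\<lambda>xs. sweedler V (\<lambda>u v. \<phi> (u # v # tl xs)) (hd xs)) b"
      using multilinear_closed[OF multi_split_head[OF V \<phi>]]
      by (intro iterated_sweedler_cong[OF V Suc.prems(2)])
        (auto elim!: tuples_SucE intro!: sweedler_cocommutative[OF cc V] multi_bilinear[OF \<phi>])
    also have "\<dots> = iterated_sweedler (Suc n) V \<phi> b"
      by (rule iterated_sweedler_Suc[OF V \<phi> Suc.prems(2), symmetric])
    finally show ?thesis .
  qed
  show ?case
  proof (cases i)
    case (Suc k)
    then show ?thesis using tail[OF \<open>multi (Suc (Suc n)) V \<phi>\<close>, of k "j - 1"] Suc.prems by simp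
  next
    case 0
    note \<phi> = \<open>multi (Suc (Suc n)) V \<phi>\<close>
    show ?thesis
    proof (cases "j = 1")
      case True
      then show ?thesis using first[OF \<phi>] 0 by simp
    next
      case False
      \<comment> \<open>\<open>(0 j)\<close> is the conjugate of \<open>(0 1)\<close> by \<open>(1 j)\<close>.\<close>
      let ?t = "swap_entries 1 j" and ?f = "swap_entries 0 1 :: 'a list \<Rightarrow> 'a list"
      have j: "1 < j" "j < Suc (Suc n)" using False 0 Suc.prems by auto
      have m1: "multi (Suc (Suc n)) V (\<lambda>xs. \<phi> (?t xs))"
        by (rule swap_multilinear[OF \<phi>]) (use j in auto)
      have m2: "multi (Suc (Suc n)) V (\<lambda>xs. \<phi> (?t (?f xs)))"
        by (rule swap_multilinear[OF m1]) (use j in auto)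
      have "iterated_sweedler (Suc n) V (\<lambda>xs. \<phi> (swap_entries i j xs)) b =
          iterated_sweedler (Suc n) V (\<lambda>xs. \<phi> (?t (?f (?t xs)))) b"
      proof (rule iterated_sweedler_cong[OF V Suc.prems(2)])
        fix xs assume xs: "xs \<in> tuples A (Suc (Suc n))"
        have "swap_entries i j xs = ?t (?f (?t xs))"
          using j 0 tuples_length[OF xs]
          by (intro nth_equalityI) (auto simp: swap_entries_nth Transposition.transpose_def)
        then show "\<phi> (swap_entries i j xs) = \<phi> (?t (?f (?t xs)))" by simp
        show "\<phi> (?t (?f (?t xs))) \<in> carrier V"
          using j by (intro multilinear_closed[OF \<phi>] swap_entries_tuple xs) auto
      qed
      also have "\<dots> = iterated_sweedler (Suc n) V (\<lambda>xs. \<phi> (?t (?f xs))) b"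
        using tail[OF m2, of 0 "j - 1"] j by simp
      also have "\<dots> = iterated_sweedler (Suc n) V (\<lambda>xs. \<phi> (?t xs)) b"
        by (rule first[OF m1])
      also have "\<dots> = iterated_sweedler (Suc n) V \<phi> b"
        using tail[OF \<phi>, of 0 "j - 1"] j by simp
      finally show ?thesis .
    qed
  qed
qed

lemma iterated_sweedler_permute:
  assumes cc: "cocommutative K A \<Delta>" and V: "module K V"
    and p: "p permutes {1..Suc n}" and \<phi>: "multi (Suc n) V \<phi>" and b: "b \<in> carrier A"
  shows "iterated_sweedler n V (\<lambda>xs. \<phi> (permute_tuple p xs)) b = iterated_sweedler n V \<phi> b"
proof -
  have "p permutes {1..Suc n} \<and> (\<forall>\<phi>. multi (Suc n) V \<phi> \<longrightarrow>
      iterated_sweedler n V (\<lambda>xs. \<phi> (permute_tuple p xs)) b = iterated_sweedler n V \<phi> b)"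
    using p finite_atLeastAtMost
  proof (induction p rule: permutes_induct)
    case id
    show ?case unfolding permute_tuple_id using permutes_id by blast
  next
    case (swap x y p)
    let ?t = "Transposition.transpose x y"
    have t: "?t permutes {1..Suc n}" using swap by (intro permutes_swap_id) auto
    have tp: "?t \<circ> p permutes {1..Suc n}" using swap t by (intro permutes_compose) auto
    have "iterated_sweedler n V (\<lambda>xs. \<phi> (permute_tuple (?t \<circ> p) xs)) b = iterated_sweedler n V \<phi> b"
      if \<phi>: "multi (Suc n) V \<phi>" for \<phi>
    proof -
      define i j where "i = min (x - 1) (y - 1)" and "j = max (x - 1) (y - 1)"
      have ij: "i < j" "j \<le> n" and tij: "?t = Transposition.transpose (Suc i) (Suc j)"
        using swap by (auto simp: i_def j_def min_def max_def transpose_commute)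
      have m: "multi (Suc n) V (\<lambda>xs. \<phi> (permute_tuple p xs))"
        using \<phi> swap by (intro permute_multilinear) auto
      have "iterated_sweedler n V (\<lambda>xs. \<phi> (permute_tuple (?t \<circ> p) xs)) b =
          iterated_sweedler n V (\<lambda>xs. \<phi> (permute_tuple p (swap_entries i j xs))) b"
      proof (rule iterated_sweedler_cong[OF V b])
        fix xs assume xs: "xs \<in> tuples A (Suc n)"
        then show "\<phi> (permute_tuple (?t \<circ> p) xs) = \<phi> (permute_tuple p (swap_entries i j xs))"
          using t swap ij by (subst permute_tuple_comp)
            (auto simp: tuples_length tij permute_tuple_transpose)
        show "\<phi> (permute_tuple p (swap_entries i j xs)) \<in> carrier V"
          using ij by (intro multilinear_closed[OF m] swap_entries_tuple xs) auto
      qed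
      also have "\<dots> = iterated_sweedler n V \<phi> b"
        using iterated_sweedler_swap_entries[OF cc V m b ij] swap \<phi> by simp
      finally show ?thesis .
    qed
    then show ?case using tp by blast
  qed
  then show ?thesis using \<phi> by blast
qed

end

section \<open>The action and the signed permutations on tensor powers\<close>

context hopf_algebra
begin

text \<open>The scalar multiplication of \<open>T_tilde\<close>.\<close>

definition act :: "nat \<Rightarrow> 'a \<Rightarrow> ('a list \<Rightarrow> 'k) set \<Rightarrow> ('a list \<Rightarrow> 'k) set"
  where "act n b t = tensor_mult K A (Suc n) (iterated_comult K A \<Delta> n b) t"

abbreviation "pure \<equiv> pure_tensor K A"

lemma act_closed: "b \<in> carrier A \<Longrightarrow> t \<in> carrier (T (Suc n)) \<Longrightarrow> act n b t \<in> carrier (T (Suc n))"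
  unfolding act_def by (intro tensor_mult_closed iterated_comult_closed)

lemma act_iterated_sweedler:
  "act n b t = iterated_sweedler n (T (Suc n))
    (\<lambda>xs. induced_map K (T (Suc n)) (\<lambda>ys. pure (map2 (monoid.mult A) xs ys)) t) b"
  by (simp add: act_def tensor_mult_def iterated_sweedler_def Let_def)

lemma act_hom:
  assumes "b \<in> carrier A"
  shows "act n b \<in> Hom (T (Suc n)) (T (Suc n))"
  unfolding act_iterated_sweedler[abs_def]
  by (intro iterated_sweedler_parameter_hom tensor_module assms tensor_map_hom
      map2_multilinear_right[OF pure_tensor_multilinear])

lemma act_hom_left:
  assumes "t \<in> carrier (T (Suc n))"
  shows "(\<lambda>b. act n b t) \<in> Hom A (T (Suc n))"
  unfolding act_iterated_sweedler[abs_def]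
proof (intro iterated_sweedler_hom tensor_module multilinearI)
  fix xs assume "xs \<in> tuples A (Suc n)"
  then show "induced_map K (T (Suc n)) (\<lambda>ys. pure (map2 (monoid.mult A) xs ys)) t \<in> carrier (T (Suc n))"
    using assms by (intro tensor_map_closed[OF tensor_module] pure_tensor_closed tuples_map2
        A.ring_axioms)
next
  fix xs i assume "xs \<in> tuples A (Suc n)" "i < Suc n"
  then show "(\<lambda>x. induced_map K (T (Suc n)) (\<lambda>ys. pure (map2 (monoid.mult A) (xs[i := x]) ys)) t)
      \<in> Hom A (T (Suc n))"
    by (intro tensor_map_parameter_hom[OF tensor_module _ assms]
        multilinear_slot[OF map2_multilinear_left[OF pure_tensor_multilinear]])
qed

text \<open>Identities about the action are proved by evaluating linear maps, so this rule replaces the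
  definition of \<open>act\<close>.\<close>

lemma hom_act_pure:
  assumes V: "module K V" and L: "L \<in> Hom (T (Suc n)) V" and ys: "ys \<in> tuples A (Suc n)"
    and b: "b \<in> carrier A"
  shows "L (act n b (pure ys)) = iterated_sweedler n V (\<lambda>xs. L (pure (map2 (monoid.mult A) xs ys))) b"
proof -
  note mem = tuples_map2[OF A.ring_axioms _ ys]
  have "act n b (pure ys) = iterated_sweedler n (T (Suc n)) (\<lambda>xs. pure (map2 (monoid.mult A) xs ys)) b"
    unfolding act_iterated_sweedler
    using tensor_map_pure[OF tensor_module map2_multilinear_right[OF pure_tensor_multilinear] ys]
    by (intro iterated_sweedler_cong tensor_module b pure_tensor_closed mem) auto
  also have "L \<dots> = iterated_sweedler n V (\<lambda>xs. L (pure (map2 (monoid.mult A) xs ys))) b"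
    by (intro iterated_sweedler_compose[OF tensor_module V L b] pure_tensor_closed mem)
  finally show ?thesis .
qed

lemma multilinear_map2_hom:
  assumes L: "L \<in> Hom (T m) V" and ys: "ys \<in> tuples A m"
  shows "multi m V (\<lambda>xs. L (pure (map2 (monoid.mult A) xs ys)))"
  by (intro map2_multilinear_left[OF pure_tensor_compose_multilinear[OF L] ys])

lemma act_one:
  assumes t: "t \<in> carrier (T (Suc n))"
  shows "act n \<one>\<^bsub>A\<^esub> t = t"
proof (rule tensor_hom_ext[OF tensor_group act_hom[OF A.one_closed] module_hom_ident _ t])
  fix ys assume ys: "ys \<in> tuples A (Suc n)"
  have "map2 (monoid.mult A) (replicate (Suc n) \<one>\<^bsub>A\<^esub>) ys = ys"
    using ys by (intro nth_equalityI) (auto simp: tuples_length tuples_nth simp del: replicate_Suc)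
  then show "act n \<one>\<^bsub>A\<^esub> (pure ys) = pure ys"
    using hom_act_pure[OF tensor_module module_hom_ident ys A.one_closed]
      iterated_sweedler_one[OF tensor_module multilinear_map2_hom[OF module_hom_ident ys]]
    by (simp del: replicate_Suc)
qed

lemma act_mult:
  assumes a: "a \<in> carrier A" and b: "b \<in> carrier A" and t: "t \<in> carrier (T (Suc n))"
  shows "act n (a \<otimes>\<^bsub>A\<^esub> b) t = act n a (act n b t)"
proof (rule tensor_hom_ext[OF tensor_group act_hom[OF A.m_closed[OF a b]]
      module_hom_compose[OF act_hom[OF b] act_hom[OF a]] _ t])
  fix zs assume zs: "zs \<in> tuples A (Suc n)"
  let ?m = "map2 (monoid.mult A)" and ?I = "iterated_sweedler n (T (Suc n))"
  note V = tensor_module[of "Suc n"] and id = module_hom_ident[of K "T (Suc n)"]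
  note mem = tuples_map2[OF A.ring_axioms]
  have assoc: "?m (?m xs ys) zs = ?m xs (?m ys zs)" if "xs \<in> tuples A (Suc n)" "ys \<in> tuples A (Suc
      n)" for xs ys
    using that zs by (intro nth_equalityI) (auto simp: tuples_length tuples_nth A.m_assoc)
  have "act n (a \<otimes>\<^bsub>A\<^esub> b) (pure zs) = ?I (\<lambda>xs. ?I (\<lambda>ys. pure (?m (?m xs ys) zs)) b) a"
    using hom_act_pure[OF V id zs A.m_closed[OF a b]]
      iterated_sweedler_mult[OF V multilinear_map2_hom[OF id zs] a b] by simp
  also have "\<dots> = ?I (\<lambda>ys. ?I (\<lambda>xs. pure (?m (?m xs ys) zs)) a) b"
    by (intro iterated_sweedler_swap[OF V a b] map2_multilinear_left[OF multilinear_map2_hom[OF id zs]])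
  also have "\<dots> = ?I (\<lambda>ys. act n a (pure (?m ys zs))) b"
  proof (rule iterated_sweedler_cong[OF V b])
    fix ys assume ys: "ys \<in> tuples A (Suc n)"
    show "?I (\<lambda>xs. pure (?m (?m xs ys) zs)) a = act n a (pure (?m ys zs))"
      unfolding hom_act_pure[OF V id mem[OF ys zs] a]
      using ys zs by (intro iterated_sweedler_cong[OF V a] pure_tensor_closed mem) (auto simp: assoc)
    show "act n a (pure (?m ys zs)) \<in> carrier (T (Suc n))"
      by (intro act_closed a pure_tensor_closed mem ys zs)
  qed
  also have "\<dots> = act n a (act n b (pure zs))"
    by (rule hom_act_pure[OF V act_hom[OF a] zs b, symmetric])
  finally show "act n (a \<otimes>\<^bsub>A\<^esub> b) (pure zs) = act n a (act n b (pure zs))" .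
qed

abbreviation "\<rho> \<equiv> signed_permutation_action K A"

lemma signed_permutation_multilinear:
  assumes "p permutes {1..Suc n}"
  shows "multi (Suc n) (T (Suc n)) (\<lambda>xs. if evenperm p then pure (permute_tuple p xs)
     else \<ominus>\<^bsub>T (Suc n)\<^esub> pure (permute_tuple p xs))"
proof -
  have "multi (Suc n) (T (Suc n)) (\<lambda>xs. pure (permute_tuple p xs))"
    by (rule permute_multilinear[OF pure_tensor_multilinear assms])
  then show ?thesis
    by (cases "evenperm p") (auto intro: multilinear_compose[OF _ module_homs_uminus[OF
        tensor_module module_hom_ident]])
qed

lemma signed_permutation_hom:
  "p permutes {1..Suc n} \<Longrightarrow> \<rho> n p \<in> Hom (T (Suc n)) (T (Suc n))"
  unfolding signed_permutation_action_def[abs_def] Let_def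
  by (intro tensor_map_hom tensor_module signed_permutation_multilinear)

lemma signed_permutation_pure:
  "p permutes {1..Suc n} \<Longrightarrow> xs \<in> tuples A (Suc n) \<Longrightarrow>
    \<rho> n p (pure xs) = (if evenperm p then pure (permute_tuple p xs)
     else \<ominus>\<^bsub>T (Suc n)\<^esub> pure (permute_tuple p xs))"
  unfolding signed_permutation_action_def Let_def
  by (subst tensor_map_pure[OF tensor_module signed_permutation_multilinear]) auto

lemma signed_permutation_id:
  assumes t: "t \<in> carrier (T (Suc n))"
  shows "\<rho> n id t = t"
  by (rule tensor_hom_ext[OF tensor_group signed_permutation_hom[OF permutes_id] module_hom_ident _ t])
    (simp add: signed_permutation_pure[OF permutes_id] permute_tuple_id del: id_apply)

text \<open>This is where cocommutativity enters: permuting the factors of \<open>b \<cdot> t\<close> permutes the factors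
  of \<open>t\<close> and of the iterated coproduct of \<open>b\<close>, and the latter is symmetric.\<close>

lemma act_signed_permutation:
  assumes cc: "cocommutative K A \<Delta>" and p: "p permutes {1..Suc n}"
    and b: "b \<in> carrier A" and t: "t \<in> carrier (T (Suc n))"
  shows "act n b (\<rho> n p t) = \<rho> n p (act n b t)"
proof (rule tensor_hom_ext[OF tensor_group module_hom_compose[OF signed_permutation_hom[OF p]
    act_hom[OF b]]
      module_hom_compose[OF act_hom[OF b] signed_permutation_hom[OF p]] _ t])
  fix ys assume ys: "ys \<in> tuples A (Suc n)"
  let ?m = "map2 (monoid.mult A)" and ?V = "T (Suc n)"
  let ?s = "\<lambda>x. if evenperm p then x else \<ominus>\<^bsub>?V\<^esub> x"
  note V = tensor_module[of "Suc n"] and id = module_hom_ident[of K "T (Suc n)"]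
  note mem = tuples_map2[OF A.ring_axioms]
  have s: "?s \<in> Hom ?V ?V"
    using id module_homs_uminus[OF V id] by (cases "evenperm p") auto
  note pys = permute_tuple_tuple[OF p ys]
  have "\<rho> n p (act n b (pure ys)) = iterated_sweedler n ?V (\<lambda>xs. \<rho> n p (pure (?m xs ys))) b"
    by (rule hom_act_pure[OF V signed_permutation_hom[OF p] ys b])
  also have "\<dots> = iterated_sweedler n ?V (\<lambda>xs. ?s (pure (?m (permute_tuple p xs) (permute_tuple p
      ys)))) b"
  proof (rule iterated_sweedler_cong[OF V b])
    fix xs assume xs: "xs \<in> tuples A (Suc n)"
    show "\<rho> n p (pure (?m xs ys)) = ?s (pure (?m (permute_tuple p xs) (permute_tuple p ys)))"
      using xs ys p mem[OF xs ys]
      by (simp add: signed_permutation_pure permute_tuple_map2 tuples_length)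
    show "?s (pure (?m (permute_tuple p xs) (permute_tuple p ys))) \<in> carrier ?V"
      by (intro module_hom_closed[OF s] pure_tensor_closed mem permute_tuple_tuple[OF p] xs ys)
  qed
  also have "\<dots> = iterated_sweedler n ?V (\<lambda>xs. ?s (pure (?m xs (permute_tuple p ys)))) b"
    by (rule iterated_sweedler_permute[OF cc V p multilinear_map2_hom[OF s pys] b])
  also have "\<dots> = ?s (act n b (pure (permute_tuple p ys)))"
    by (rule hom_act_pure[OF V s pys b, symmetric])
  also have "\<dots> = act n b (?s (pure (permute_tuple p ys)))"
    using module_hom_uminus[OF tensor_group tensor_group act_hom[OF b] pure_tensor_closed[OF pys]]
        by simp
  also have "\<dots> = act n b (\<rho> n p (pure ys))"
    using p ys by (simp add: signed_permutation_pure)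
  finally show "act n b (\<rho> n p (pure ys)) = \<rho> n p (act n b (pure ys))" by simp
qed

end

section \<open>Balanced tensor products\<close>

lemma with_action_simps [simp]:
  "carrier (with_action M f) = carrier M" "\<zero>\<^bsub>with_action M f\<^esub> = \<zero>\<^bsub>M\<^esub>"
  "x \<oplus>\<^bsub>with_action M f\<^esub> y = x \<oplus>\<^bsub>M\<^esub> y" "r \<odot>\<^bsub>with_action M f\<^esub> x = f r x"
  by (simp_all add: with_action_def)

lemma with_action_abelian_group:
  assumes "abelian_group M"
  shows "abelian_group (with_action M f)"
proof -
  interpret abelian_group M by fact
  have "\<exists>y\<in>carrier M. y \<oplus>\<^bsub>M\<^esub> x = \<zero>\<^bsub>M\<^esub>" if "x \<in> carrier M" for x
    using that by (intro bexI[of _ "\<ominus>\<^bsub>M\<^esub> x"]) (auto simp: l_neg)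
  then show ?thesis by (intro abelian_groupI) (auto simp: a_ac)
qed

text \<open>\<open>tensor_product\<close> is presented over the integers, so additive maps into an abelian group have to be
  seen as integer linear maps.\<close>

definition int_module :: "('m, 'z) ring_scheme \<Rightarrow> (int, 'm) module"
  where "int_module W = with_action W (\<lambda>k x. [k] \<cdot>\<^bsub>W\<^esub> x)"

lemma int_module_module:
  assumes "abelian_group W"
  shows "module \<Z> (int_module W)"
proof -
  interpret abelian_group W by fact
  show ?thesis
    unfolding int_module_def
    by (intro moduleI int_is_cring with_action_abelian_group assms)
      (auto simp: add.int_pow_mult add.int_pow_distrib add.int_pow_pow mult.commute)
qed

text \<open>The integers act on any module over them by repeated addition, so additivity is enough.\<close>

lemma additive_map_int_hom:
  assumes Q: "module \<Z> Q" and W: "abelian_group W"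
    and c: "\<And>x. x \<in> carrier Q \<Longrightarrow> f x \<in> carrier W"
    and add: "\<And>x y. x \<in> carrier Q \<Longrightarrow> y \<in> carrier Q \<Longrightarrow> f (x \<oplus>\<^bsub>Q\<^esub> y) = f x \<oplus>\<^bsub>W\<^esub> f y"
  shows "f \<in> module_hom \<Z> Q (int_module W)"
proof (rule module_homI)
  interpret Q: module \<Z> Q by fact
  interpret W: abelian_group W by fact
  fix k :: int and x assume x: "x \<in> carrier Q"
  have cl: "m \<odot>\<^bsub>Q\<^esub> x \<in> carrier Q" for m :: int using x by (intro Q.smult_closed) auto
  have one: "f ((m + 1) \<odot>\<^bsub>Q\<^esub> x) = f (m \<odot>\<^bsub>Q\<^esub> x) \<oplus>\<^bsub>W\<^esub> f x" for m :: int
  proof -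
    have "(m + 1) \<odot>\<^bsub>Q\<^esub> x = m \<odot>\<^bsub>Q\<^esub> x \<oplus>\<^bsub>Q\<^esub> 1 \<odot>\<^bsub>Q\<^esub> x"
      using Q.smult_l_distr[of m 1 x] x by simp
    then show ?thesis using Q.smult_one[OF x] add[OF cl x] by simp
  qed
  have zero: "f (0 \<odot>\<^bsub>Q\<^esub> x) = \<zero>\<^bsub>W\<^esub>"
  proof -
    have "f (0 \<odot>\<^bsub>Q\<^esub> x) \<oplus>\<^bsub>W\<^esub> f (0 \<odot>\<^bsub>Q\<^esub> x) = f (0 \<odot>\<^bsub>Q\<^esub> x)"
      using add[OF cl cl, of 0 0] Q.smult_l_null[OF x] x by simp
    then show ?thesis using c[OF cl] W.add.l_cancel_one' by metis
  qed
  have "f (k \<odot>\<^bsub>Q\<^esub> x) = [k] \<cdot>\<^bsub>W\<^esub> f x"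
  proof (induction k rule: int_induct[of _ 0])
    case base
    show ?case using zero int_pow_0[of "add_monoid W" "f x"] by (simp add: add_pow_def)
  next
    case (step1 i)
    then show ?case using one[of i] c[OF x] by (simp add: W.add.int_pow_mult)
  next
    case (step2 i)
    have "f (i \<odot>\<^bsub>Q\<^esub> x) = f ((i - 1) \<odot>\<^bsub>Q\<^esub> x) \<oplus>\<^bsub>W\<^esub> f x" using one[of "i - 1"] by simp
    moreover have "[i] \<cdot>\<^bsub>W\<^esub> f x = [(i - 1)] \<cdot>\<^bsub>W\<^esub> f x \<oplus>\<^bsub>W\<^esub> f x"
      using W.add.int_pow_mult[OF c[OF x], of "i - 1" 1] c[OF x] by simp
    ultimately show ?case using step2 c[OF x] c[OF cl] W.add.right_cancel
        by (metis W.add.int_pow_closed)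
  qed
  then show "f (k \<odot>\<^bsub>Q\<^esub> x) = k \<odot>\<^bsub>int_module W\<^esub> f x" by (simp add: int_module_def)
qed (auto simp: int_module_def c add)

text \<open>The universal property of \<open>M \<otimes>\<^sub>R N\<close>, obtained from that of the underlying presented abelian group.\<close>

locale balanced_tensor =
  fixes R :: "('r, 'z) ring_scheme" and M :: "('r, 'm, 'x) module_scheme"
    and N :: "('r, 'n, 'y) module_scheme"
  assumes M_group: "abelian_group M" and N_group: "abelian_group N"
    and M_smult: "\<lbrakk>r \<in> carrier R; m \<in> carrier M\<rbrakk> \<Longrightarrow> r \<odot>\<^bsub>M\<^esub> m \<in> carrier M"
    and N_smult: "\<lbrakk>r \<in> carrier R; v \<in> carrier N\<rbrakk> \<Longrightarrow> r \<odot>\<^bsub>N\<^esub> v \<in> carrier N"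
begin

sublocale M: abelian_group M by (rule M_group)
sublocale N: abelian_group N by (rule N_group)

abbreviation "X \<equiv> carrier M \<times> carrier N"
abbreviation "MN \<equiv> tensor_product R M N"

definition tensor :: "'m \<Rightarrow> 'n \<Rightarrow> ('m \<times> 'n \<Rightarrow> int) set"
  where "tensor m v = generator \<Z> X (balancing_relations R M N) (m, v)"

lemma presentation: "presentation \<Z> X (balancing_relations R M N)"
proof (intro presentation.intro presentation_axioms.intro int_is_cring)
  interpret F: module \<Z> "free_module \<Z> X" by (rule free_module_module) (rule int_is_cring)
  note e = basis_vector_carrier[OF int_is_cring]
  show "balancing_relations R M N \<subseteq> carrier (free_module \<Z> X)"
    by (auto simp: balancing_relations_def Let_def simp del: free_module_simps
        intro!: F.M.minus_closed F.M.a_closed e M_smult N_smult)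
qed

lemma MN_module: "module \<Z> MN"
  unfolding tensor_product_def by (rule presentation.Q_module[OF presentation])

lemma tensor_closed: "m \<in> carrier M \<Longrightarrow> v \<in> carrier N \<Longrightarrow> tensor m v \<in> carrier MN"
  unfolding tensor_def tensor_product_def by (intro presentation.generator_closed[OF presentation]) auto

lemma tensor_relations:
  shows tensor_add_left: "\<lbrakk>m \<in> carrier M; m' \<in> carrier M; v \<in> carrier N\<rbrakk> \<Longrightarrow>
      tensor (m \<oplus>\<^bsub>M\<^esub> m') v = tensor m v \<oplus>\<^bsub>MN\<^esub> tensor m' v"
    and tensor_add_right: "\<lbrakk>m \<in> carrier M; v \<in> carrier N; v' \<in> carrier N\<rbrakk> \<Longrightarrow>
      tensor m (v \<oplus>\<^bsub>N\<^esub> v') = tensor m v \<oplus>\<^bsub>MN\<^esub> tensor m v'"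
    and tensor_balanced: "\<lbrakk>r \<in> carrier R; m \<in> carrier M; v \<in> carrier N\<rbrakk> \<Longrightarrow>
      tensor (r \<odot>\<^bsub>M\<^esub> m) v = tensor m (r \<odot>\<^bsub>N\<^esub> v)"
proof -
  let ?F = "free_module \<Z> X" and ?rel = "balancing_relations R M N"
  let ?H = "relation_submodule \<Z> X ?rel"
  interpret P: presentation \<Z> X ?rel by (rule presentation)
  interpret F: module \<Z> ?F by (rule P.F_module)
  define q where "q = (\<lambda>f. ?H +>\<^bsub>?F\<^esub> f)"
  have MNQ: "MN = P.Q" by (simp add: tensor_product_def)
  have q: "q \<in> module_hom \<Z> ?F MN" unfolding q_def MNQ by (rule P.coset_hom_Q)
  note diff = P.coset_eqI[folded q_def]
  note e = basis_vector_carrier[OF int_is_cring, of _ X]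
  have p: "tensor m v = q (basis_vector \<Z> (m, v))" for m v
    by (simp add: tensor_def generator_def q_def)
  show "tensor (m \<oplus>\<^bsub>M\<^esub> m') v = tensor m v \<oplus>\<^bsub>MN\<^esub> tensor m' v"
    if "m \<in> carrier M" "m' \<in> carrier M" "v \<in> carrier N" for m m' v
    unfolding p using that
    by (subst module_hom_add[OF q, symmetric], (intro e; simp), (intro e; simp), intro diff e
        F.M.a_closed)
      (auto simp: balancing_relations_def Let_def simp del: free_module_simps)
  show "tensor m (v \<oplus>\<^bsub>N\<^esub> v') = tensor m v \<oplus>\<^bsub>MN\<^esub> tensor m v'"
    if "m \<in> carrier M" "v \<in> carrier N" "v' \<in> carrier N" for m v v'
    unfolding p using that
    by (subst module_hom_add[OF q, symmetric], (intro e; simp), (intro e; simp), intro diff e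
        F.M.a_closed)
      (auto simp: balancing_relations_def Let_def simp del: free_module_simps)
  show "tensor (r \<odot>\<^bsub>M\<^esub> m) v = tensor m (r \<odot>\<^bsub>N\<^esub> v)"
    if "r \<in> carrier R" "m \<in> carrier M" "v \<in> carrier N" for r m v
    unfolding p using that
    by (intro diff e)
      (auto simp: balancing_relations_def Let_def M_smult N_smult simp del: free_module_simps)
qed

lemma tensor_hom_ext:
  assumes "abelian_group V" "h \<in> module_hom \<Z> MN V" "h' \<in> module_hom \<Z> MN V"
    and "\<And>m v. m \<in> carrier M \<Longrightarrow> v \<in> carrier N \<Longrightarrow> h (tensor m v) = h' (tensor m v)"
    and "t \<in> carrier MN"
  shows "h t = h' t"
  by (rule presentation.hom_ext[OF presentation, folded tensor_product_def, OF assms(1-3) _ assms(5)])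
    (use assms(4) in \<open>auto simp: tensor_def\<close>)

lemma balanced_map:
  assumes V: "module \<Z> V"
    and c: "\<And>m v. \<lbrakk>m \<in> carrier M; v \<in> carrier N\<rbrakk> \<Longrightarrow> \<beta> m v \<in> carrier V"
    and l: "\<And>m m' v. \<lbrakk>m \<in> carrier M; m' \<in> carrier M; v \<in> carrier N\<rbrakk> \<Longrightarrow>
      \<beta> (m \<oplus>\<^bsub>M\<^esub> m') v = \<beta> m v \<oplus>\<^bsub>V\<^esub> \<beta> m' v"
    and r: "\<And>m v v'. \<lbrakk>m \<in> carrier M; v \<in> carrier N; v' \<in> carrier N\<rbrakk> \<Longrightarrow>
      \<beta> m (v \<oplus>\<^bsub>N\<^esub> v') = \<beta> m v \<oplus>\<^bsub>V\<^esub> \<beta> m v'"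
    and b: "\<And>s m v. \<lbrakk>s \<in> carrier R; m \<in> carrier M; v \<in> carrier N\<rbrakk> \<Longrightarrow>
      \<beta> (s \<odot>\<^bsub>M\<^esub> m) v = \<beta> m (s \<odot>\<^bsub>N\<^esub> v)"
  shows "induced_map \<Z> V (\<lambda>(m, v). \<beta> m v) \<in> module_hom \<Z> MN V"
    and "\<lbrakk>m \<in> carrier M; v \<in> carrier N\<rbrakk> \<Longrightarrow>
      induced_map \<Z> V (\<lambda>(m, v). \<beta> m v) (tensor m v) = \<beta> m v"
proof -
  let ?F = "free_module \<Z> X" and ?\<beta> = "\<lambda>(m, v). \<beta> m v"
  interpret F: module \<Z> ?F by (rule free_module_module) (rule int_is_cring)
  interpret V: module \<Z> V by fact
  have \<beta>: "?\<beta> \<in> X \<rightarrow> carrier V" using c by auto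
  note ag = F.M.abelian_group_axioms V.M.abelian_group_axioms
  note L = linear_extension_hom[OF V \<beta>]
  have le: "linear_extension \<Z> V ?\<beta> (basis_vector \<Z> (m, v)) = \<beta> m v"
    if "m \<in> carrier M" "v \<in> carrier N" for m v
    using linear_extension_basis_vector[OF V, of ?\<beta> "(m, v)"] c[OF that] by simp
  have e: "basis_vector \<Z> (m, v) \<in> carrier ?F" if "m \<in> carrier M" "v \<in> carrier N" for m v
    using that by (intro basis_vector_carrier int_is_cring) auto
  note simps = a_minus_def module_hom_add[OF L] module_hom_uminus[OF ag L] le e c l r b M_smult N_smult
    V.M.r_neg
  have kill: "linear_extension \<Z> V ?\<beta> \<xi> = \<zero>\<^bsub>V\<^esub>" if "\<xi> \<in> balancing_relations R M N" for \<xi>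
    using that unfolding balancing_relations_def Let_def
    by (elim UnE CollectE exE conjE) (simp_all add: simps del: free_module_simps)
  show "induced_map \<Z> V ?\<beta> \<in> module_hom \<Z> MN V"
    unfolding tensor_product_def by (rule presentation.induced_map_hom[OF presentation V \<beta> kill])
  show "induced_map \<Z> V ?\<beta> (tensor m v) = \<beta> m v" if "m \<in> carrier M" "v \<in> carrier N"
    using presentation.induced_map_generator[OF presentation V \<beta> kill, of "(m, v)"] that
    by (simp add: tensor_def)
qed

lemma tensor_action:
  assumes B: "left_module B (with_action M f)"
    and f: "\<And>b r m. \<lbrakk>b \<in> carrier B; r \<in> carrier R; m \<in> carrier M\<rbrakk> \<Longrightarrow> f b (r \<odot>\<^bsub>M\<^esub> m) = r \<odot>\<^bsub>M\<^esub> f b m"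
    and b: "b \<in> carrier B"
  defines "g \<equiv> smult (tensor_product_left_module R M N f)"
  shows "g b \<in> module_hom \<Z> MN MN"
    and "\<lbrakk>m \<in> carrier M; v \<in> carrier N\<rbrakk> \<Longrightarrow> g b (tensor m v) = tensor (f b m) v"
proof -
  interpret B: left_module B "with_action M f" by fact
  have g: "g b = induced_map \<Z> MN (\<lambda>(m, v). tensor (f b m) v)"
    by (simp add: g_def tensor_product_left_module_def with_action_def Let_def tensor_def)
  note fc = B.smult_closed[OF b, simplified] and fa = B.smult_r_distr[OF b, simplified]
  note bal = balanced_map[OF MN_module, of "\<lambda>m v. tensor (f b m) v", folded g]
  have *: "s \<in> carrier R \<Longrightarrow> m \<in> carrier M \<Longrightarrow> v \<in> carrier N \<Longrightarrow>
    tensor (f b (s \<odot>\<^bsub>M\<^esub> m)) v = tensor (f b m) (s \<odot>\<^bsub>N\<^esub> v)" for s m v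
    using b by (simp add: f tensor_balanced fc)
  show "g b \<in> module_hom \<Z> MN MN"
    by (rule bal(1)) (simp_all add: tensor_closed fc fa tensor_add_left tensor_add_right *)
  show "g b (tensor m v) = tensor (f b m) v" if "m \<in> carrier M" "v \<in> carrier N"
    by (rule bal(2)) (simp_all add: tensor_closed fc fa tensor_add_left tensor_add_right * that)
qed

lemma tensor_product_left_module_carrier [simp]:
  "carrier (tensor_product_left_module R M N f) = carrier MN"
  "x \<oplus>\<^bsub>tensor_product_left_module R M N f\<^esub> y = x \<oplus>\<^bsub>MN\<^esub> y"
  by (simp_all add: tensor_product_left_module_def Let_def)

text \<open>All module axioms are identities between additive maps on \<open>M \<otimes>\<^sub>R N\<close>, hence inherited from \<open>M\<close> on
  the generators \<open>m \<otimes> v\<close>.\<close>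

lemma tensor_product_left_module:
  assumes B: "left_module B (with_action M f)"
    and f: "\<And>b r m. \<lbrakk>b \<in> carrier B; r \<in> carrier R; m \<in> carrier M\<rbrakk> \<Longrightarrow> f b (r \<odot>\<^bsub>M\<^esub> m) = r \<odot>\<^bsub>M\<^esub> f b m"
  shows "left_module B (tensor_product_left_module R M N f)"
proof -
  interpret B: left_module B "with_action M f" by fact
  interpret MN: module \<Z> MN by (rule MN_module)
  let ?S = "tensor_product_left_module R M N f"
  have act: "smult ?S b \<in> module_hom \<Z> MN MN"
      "\<And>m v. \<lbrakk>m \<in> carrier M; v \<in> carrier N\<rbrakk> \<Longrightarrow> b \<odot>\<^bsub>?S\<^esub> tensor m v = tensor (f b m) v"
    if "b \<in> carrier B" for b
    using tensor_action[OF B _ that] f by auto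
  note MN = MN.M.abelian_group_axioms
  note fc = B.smult_closed[simplified]
  show ?thesis
  proof (intro left_module.intro left_module_axioms.intro B.R.ring_axioms)
    show "abelian_group ?S"
      unfolding tensor_product_left_module_def Let_def by (rule with_action_abelian_group[OF MN])
    show "a \<odot>\<^bsub>?S\<^esub> x \<in> carrier ?S" if "a \<in> carrier B" "x \<in> carrier ?S" for a x
      using module_hom_closed[OF act(1)] that by simp
    show "a \<odot>\<^bsub>?S\<^esub> (x \<oplus>\<^bsub>?S\<^esub> y) = a \<odot>\<^bsub>?S\<^esub> x \<oplus>\<^bsub>?S\<^esub> a \<odot>\<^bsub>?S\<^esub> y"
      if "a \<in> carrier B" "x \<in> carrier ?S" "y \<in> carrier ?S" for a x y
      using module_hom_add[OF act(1)] that by simp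
    show "(a \<oplus>\<^bsub>B\<^esub> b) \<odot>\<^bsub>?S\<^esub> x = a \<odot>\<^bsub>?S\<^esub> x \<oplus>\<^bsub>?S\<^esub> b \<odot>\<^bsub>?S\<^esub> x"
      if ab: "a \<in> carrier B" "b \<in> carrier B" and x: "x \<in> carrier ?S" for a b x
      unfolding tensor_product_left_module_carrier
    proof (rule tensor_hom_ext[OF MN act(1) module_homs_add[OF MN_module act(1) act(1)]])
      show "(a \<oplus>\<^bsub>B\<^esub> b) \<odot>\<^bsub>?S\<^esub> tensor m v = a \<odot>\<^bsub>?S\<^esub> tensor m v \<oplus>\<^bsub>MN\<^esub> b \<odot>\<^bsub>?S\<^esub> tensor m v"
        if "m \<in> carrier M" "v \<in> carrier N" for m v
        using ab that B.smult_l_distr[of a b m]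
        by (simp add: act(2)[OF _ that] tensor_add_left fc)
    qed (use ab x in auto)
    show "(a \<otimes>\<^bsub>B\<^esub> b) \<odot>\<^bsub>?S\<^esub> x = a \<odot>\<^bsub>?S\<^esub> (b \<odot>\<^bsub>?S\<^esub> x)"
      if ab: "a \<in> carrier B" "b \<in> carrier B" and x: "x \<in> carrier ?S" for a b x
    proof (rule tensor_hom_ext[OF MN act(1) module_hom_compose[OF act(1) act(1)]])
      show "(a \<otimes>\<^bsub>B\<^esub> b) \<odot>\<^bsub>?S\<^esub> tensor m v = a \<odot>\<^bsub>?S\<^esub> (b \<odot>\<^bsub>?S\<^esub> tensor m v)"
        if "m \<in> carrier M" "v \<in> carrier N" for m v
        using ab that B.smult_assoc[of a b m] by (simp add: act(2) fc)
    qed (use ab x in auto)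
    show "\<one>\<^bsub>B\<^esub> \<odot>\<^bsub>?S\<^esub> x = x" if "x \<in> carrier ?S" for x
    proof (rule tensor_hom_ext[OF MN act(1) module_hom_ident])
      show "\<one>\<^bsub>B\<^esub> \<odot>\<^bsub>?S\<^esub> tensor m v = tensor m v"
        if "m \<in> carrier M" "v \<in> carrier N" for m v
        using that B.smult_one[of m] by (simp add: act(2))
    qed (use that in auto)
  qed
qed

end

section \<open>Linear algebra over the ground field\<close>

text \<open>By Zorn's lemma there is a maximal submodule \<open>C\<close> that meets the kernel of \<open>g\<close> trivially. If \<open>g v\<close>
  were not in the image of \<open>C\<close>, then \<open>C + K v\<close> would still meet the kernel trivially, since nonzero
  scalars are invertible. So \<open>g\<close> maps \<open>C\<close> bijectively and \<open>\<sigma>\<close> is the inverse of this bijection.\<close>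

lemma linear_section:
  assumes K: "field K" and V: "module K V" and W: "module K W"
    and g: "g \<in> module_hom K V W" and surj: "g ` carrier V = carrier W"
  obtains \<sigma> where "\<sigma> \<in> module_hom K W V" "\<And>w. w \<in> carrier W \<Longrightarrow> g (\<sigma> w) = w"
proof -
  interpret K: field K by fact
  interpret V: module K V by fact
  interpret W: module K W by fact
  note ag = V.M.abelian_group_axioms W.M.abelian_group_axioms
  define \<C> where "\<C> = {C. submodule C K V \<and> (\<forall>x\<in>C. g x = \<zero>\<^bsub>W\<^esub> \<longrightarrow> x = \<zero>\<^bsub>V\<^esub>)}"
  have \<C>D: "C \<subseteq> carrier V" "\<zero>\<^bsub>V\<^esub> \<in> C" "\<And>x. x \<in> C \<Longrightarrow> \<ominus>\<^bsub>V\<^esub> x \<in> C"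
      "\<And>x y. x \<in> C \<Longrightarrow> y \<in> C \<Longrightarrow> x \<oplus>\<^bsub>V\<^esub> y \<in> C" "\<And>k x. k \<in> carrier K \<Longrightarrow> x \<in> C \<Longrightarrow> k \<odot>\<^bsub>V\<^esub> x \<in> C"
      "\<And>x. x \<in> C \<Longrightarrow> g x = \<zero>\<^bsub>W\<^esub> \<Longrightarrow> x = \<zero>\<^bsub>V\<^esub>" if "C \<in> \<C>" for C
  proof -
    have C: "submodule C K V" using that by (simp add: \<C>_def)
    note E = V.submoduleE[OF C]
    show "C \<subseteq> carrier V" "\<And>x. x \<in> C \<Longrightarrow> \<ominus>\<^bsub>V\<^esub> x \<in> C" "\<And>x y. x \<in> C \<Longrightarrow> y \<in> C \<Longrightarrow> x \<oplus>\<^bsub>V\<^esub> y \<in> C"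
      "\<And>k x. k \<in> carrier K \<Longrightarrow> x \<in> C \<Longrightarrow> k \<odot>\<^bsub>V\<^esub> x \<in> C"
      using E by auto
    show "\<zero>\<^bsub>V\<^esub> \<in> C" using subgroup.one_closed[OF submodule.axioms(1)[OF C]] by simp
    show "\<And>x. x \<in> C \<Longrightarrow> g x = \<zero>\<^bsub>W\<^esub> \<Longrightarrow> x = \<zero>\<^bsub>V\<^esub>" using that by (auto simp: \<C>_def)
  qed
  have \<C>I: "C \<in> \<C>" if sub: "C \<subseteq> carrier V" and zero: "\<zero>\<^bsub>V\<^esub> \<in> C"
      and add: "\<And>x y. x \<in> C \<Longrightarrow> y \<in> C \<Longrightarrow> x \<oplus>\<^bsub>V\<^esub> y \<in> C"
      and smult: "\<And>k x. k \<in> carrier K \<Longrightarrow> x \<in> C \<Longrightarrow> k \<odot>\<^bsub>V\<^esub> x \<in> C"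
      and inj: "\<And>x. x \<in> C \<Longrightarrow> g x = \<zero>\<^bsub>W\<^esub> \<Longrightarrow> x = \<zero>\<^bsub>V\<^esub>" for C
  proof -
    have "\<ominus>\<^bsub>V\<^esub> x \<in> C" if x: "x \<in> C" for x
    proof -
      have "\<ominus>\<^bsub>V\<^esub> x = (\<ominus>\<^bsub>K\<^esub> \<one>\<^bsub>K\<^esub>) \<odot>\<^bsub>V\<^esub> x" using x sub by (subst V.smult_l_minus) auto
      then show ?thesis using smult[OF _ x] by simp
    qed
    then have "submodule C K V" using sub zero add smult by (intro V.submoduleI) auto
    then show ?thesis using inj by (auto simp: \<C>_def)
  qed
  have "\<exists>C\<in>\<C>. \<forall>D\<in>\<C>. C \<subseteq> D \<longrightarrow> D = C"
  proof (rule subset_Zorn)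
    fix Z assume Z: "subset.chain \<C> Z"
    show "\<exists>U\<in>\<C>. \<forall>C\<in>Z. C \<subseteq> U"
    proof (cases "Z = {}")
      case True
      have "{\<zero>\<^bsub>V\<^esub>} \<in> \<C>" by (rule \<C>I) auto
      then show ?thesis using True by auto
    next
      case False
      have Z\<C>: "C \<in> \<C>" if "C \<in> Z" for C using Z that by (auto simp: subset.chain_def)
      have dir: "\<exists>C\<in>Z. x \<in> C \<and> y \<in> C" if xy: "x \<in> \<Union>Z" "y \<in> \<Union>Z" for x y
      proof -
        obtain C D where "C \<in> Z" "x \<in> C" "D \<in> Z" "y \<in> D" using xy by auto
        moreover from this have "C \<subseteq> D \<or> D \<subseteq> C" using Z by (auto simp: subset.chain_def)
        ultimately show ?thesis by blast
      qed
      have "\<Union>Z \<in> \<C>"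
      proof (rule \<C>I)
        show "\<Union>Z \<subseteq> carrier V" using Z\<C> \<C>D(1) by blast
        show "\<zero>\<^bsub>V\<^esub> \<in> \<Union>Z" using Z\<C> \<C>D(2) False by blast
        show "x \<oplus>\<^bsub>V\<^esub> y \<in> \<Union>Z" if "x \<in> \<Union>Z" "y \<in> \<Union>Z" for x y
          using dir[OF that] Z\<C> \<C>D(4) by blast
        show "k \<odot>\<^bsub>V\<^esub> x \<in> \<Union>Z" if "k \<in> carrier K" "x \<in> \<Union>Z" for k x
          using that Z\<C> \<C>D(5) by blast
        show "x = \<zero>\<^bsub>V\<^esub>" if "x \<in> \<Union>Z" "g x = \<zero>\<^bsub>W\<^esub>" for x
          using that Z\<C> \<C>D(6) by blast
      qed
      then show ?thesis by blast
    qed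
  qed
  then obtain C where C: "C \<in> \<C>" and max: "\<And>D. D \<in> \<C> \<Longrightarrow> C \<subseteq> D \<Longrightarrow> D = C" by blast
  note CD = \<C>D[OF C]
  have C_carrier: "c \<in> carrier V" if "c \<in> C" for c using that CD(1) by auto
  have onto: "\<exists>c\<in>C. g c = w" if w: "w \<in> carrier W" for w
  proof (rule ccontr)
    assume no: "\<not> (\<exists>c\<in>C. g c = w)"
    obtain v where v: "v \<in> carrier V" "g v = w" using w surj by (metis imageE)
    define D where "D = (\<lambda>(c, k). c \<oplus>\<^bsub>V\<^esub> k \<odot>\<^bsub>V\<^esub> v) ` (C \<times> carrier K)"
    have DI: "c \<oplus>\<^bsub>V\<^esub> k \<odot>\<^bsub>V\<^esub> v \<in> D" if "c \<in> C" "k \<in> carrier K" for c k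
      using that by (force simp: D_def)
    have DE: "\<exists>c\<in>C. \<exists>k\<in>carrier K. x = c \<oplus>\<^bsub>V\<^esub> k \<odot>\<^bsub>V\<^esub> v" if "x \<in> D" for x
      using that by (auto simp: D_def)
    have "D \<in> \<C>"
    proof (rule \<C>I)
      show "D \<subseteq> carrier V" using C_carrier v by (auto simp: D_def)
      show "\<zero>\<^bsub>V\<^esub> \<in> D" using DI[OF CD(2) K.zero_closed] v by simp
      show "x \<oplus>\<^bsub>V\<^esub> y \<in> D" if xy: "x \<in> D" "y \<in> D" for x y
      proof -
        obtain c k d l where cd: "c \<in> C" "k \<in> carrier K" "x = c \<oplus>\<^bsub>V\<^esub> k \<odot>\<^bsub>V\<^esub> v"
          "d \<in> C" "l \<in> carrier K" "y = d \<oplus>\<^bsub>V\<^esub> l \<odot>\<^bsub>V\<^esub> v" using DE[OF xy(1)] DE[OF xy(2)] by auto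
        have "x \<oplus>\<^bsub>V\<^esub> y = (c \<oplus>\<^bsub>V\<^esub> d) \<oplus>\<^bsub>V\<^esub> (k \<oplus>\<^bsub>K\<^esub> l) \<odot>\<^bsub>V\<^esub> v"
          using cd C_carrier v by (simp add: V.smult_l_distr V.M.a_ac)
        then show ?thesis using DI[OF CD(4)[OF cd(1,4)]] cd by simp
      qed
      show "l \<odot>\<^bsub>V\<^esub> x \<in> D" if lx: "l \<in> carrier K" "x \<in> D" for l x
      proof -
        obtain c k where ck: "c \<in> C" "k \<in> carrier K" "x = c \<oplus>\<^bsub>V\<^esub> k \<odot>\<^bsub>V\<^esub> v"
          using DE[OF lx(2)] by auto
        have "l \<odot>\<^bsub>V\<^esub> x = l \<odot>\<^bsub>V\<^esub> c \<oplus>\<^bsub>V\<^esub> (l \<otimes>\<^bsub>K\<^esub> k) \<odot>\<^bsub>V\<^esub> v"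
          using ck C_carrier v lx by (simp add: V.smult_r_distr V.smult_assoc1)
        then show ?thesis using DI[OF CD(5)[OF lx(1) ck(1)]] ck lx by simp
      qed
      show "x = \<zero>\<^bsub>V\<^esub>" if x: "x \<in> D" "g x = \<zero>\<^bsub>W\<^esub>" for x
      proof -
        obtain c k where ck: "c \<in> C" "k \<in> carrier K" "x = c \<oplus>\<^bsub>V\<^esub> k \<odot>\<^bsub>V\<^esub> v"
          using DE[OF x(1)] by auto
        note cc = C_carrier[OF ck(1)]
        have gx: "g c \<oplus>\<^bsub>W\<^esub> k \<odot>\<^bsub>W\<^esub> w = \<zero>\<^bsub>W\<^esub>"
          using x(2) ck cc v by (simp add: module_hom_add[OF g] module_hom_smult[OF g])
        show ?thesis
        proof (cases "k = \<zero>\<^bsub>K\<^esub>")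
          case True
          then have "x = c" using ck cc v by simp
          then show ?thesis using x(2) CD(6) ck(1) by blast
        next
          case False
          then have k: "k \<in> Units K" using ck K.field_Units by auto
          have gc: "g c \<in> carrier W" by (rule module_hom_closed[OF g cc])
          let ?l = "\<ominus>\<^bsub>K\<^esub> (inv\<^bsub>K\<^esub> k)"
          have ik: "inv\<^bsub>K\<^esub> k \<in> carrier K" using k by simp
          have "g c = \<ominus>\<^bsub>W\<^esub> (k \<odot>\<^bsub>W\<^esub> w)"
            using gx gc w ck(2) by (intro W.M.minus_equality[symmetric]) auto
          then have "g (?l \<odot>\<^bsub>V\<^esub> c) = inv\<^bsub>K\<^esub> k \<odot>\<^bsub>W\<^esub> (k \<odot>\<^bsub>W\<^esub> w)"
            using ik cc w ck(2) by (simp add: module_hom_smult[OF g] W.smult_l_minus W.smult_r_minus)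
          also have "\<dots> = w" using ik k w ck(2) by (simp add: W.smult_assoc1[symmetric])
          finally have "g (?l \<odot>\<^bsub>V\<^esub> c) = w" .
          moreover have "?l \<odot>\<^bsub>V\<^esub> c \<in> C" using ik ck(1) by (intro CD(5)) auto
          ultimately show ?thesis using no by blast
        qed
      qed
    qed
    moreover have "C \<subseteq> D"
    proof
      fix c assume c: "c \<in> C"
      then show "c \<in> D" using DI[OF c K.zero_closed] v C_carrier[OF c] by simp
    qed
    ultimately have "D = C" by (rule max)
    moreover have "v \<in> D" using DI[OF CD(2) K.one_closed] v by simp
    ultimately show False using no v by blast
  qed
  have inj: "c = d" if "c \<in> C" "d \<in> C" "g c = g d" for c d
  proof -
    note cd = C_carrier[OF that(1)] C_carrier[OF that(2)]
    have "g (c \<oplus>\<^bsub>V\<^esub> \<ominus>\<^bsub>V\<^esub> d) = \<zero>\<^bsub>W\<^esub>"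
      using that(3) cd module_hom_closed[OF g]
      by (simp add: module_hom_add[OF g] module_hom_uminus[OF ag g] W.M.r_neg)
    then have "c \<oplus>\<^bsub>V\<^esub> \<ominus>\<^bsub>V\<^esub> d = \<zero>\<^bsub>V\<^esub>" using CD(6) CD(4)[OF that(1) CD(3)[OF that(2)]] by blast
    then show ?thesis using V.M.minus_equality[of c "\<ominus>\<^bsub>V\<^esub> d"] cd by simp
  qed
  define \<sigma> where "\<sigma> w = (SOME c. c \<in> C \<and> g c = w)" for w
  have \<sigma>: "\<sigma> w \<in> C" "g (\<sigma> w) = w" if "w \<in> carrier W" for w
  proof -
    have "\<exists>c. c \<in> C \<and> g c = w" using onto[OF that] by auto
    then have "\<sigma> w \<in> C \<and> g (\<sigma> w) = w" unfolding \<sigma>_def by (rule someI_ex)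
    then show "\<sigma> w \<in> C" "g (\<sigma> w) = w" by auto
  qed
  have "\<sigma> \<in> module_hom K W V"
  proof (rule module_homI)
    show "\<sigma> x \<in> carrier V" if "x \<in> carrier W" for x using \<sigma>(1)[OF that] C_carrier by auto
    show "\<sigma> (x \<oplus>\<^bsub>W\<^esub> y) = \<sigma> x \<oplus>\<^bsub>V\<^esub> \<sigma> y" if "x \<in> carrier W" "y \<in> carrier W" for x y
      using that \<sigma> by (intro inj CD(4)) (auto simp: module_hom_add[OF g] C_carrier)
    show "\<sigma> (r \<odot>\<^bsub>W\<^esub> x) = r \<odot>\<^bsub>V\<^esub> \<sigma> x" if "r \<in> carrier K" "x \<in> carrier W" for r x
      using that \<sigma> by (intro inj CD(5)) (auto simp: module_hom_smult[OF g] C_carrier)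
  qed
  then show ?thesis using that \<sigma>(2) by blast
qed

lemma ring_char_dvd:
  assumes "field K" "[m] \<cdot>\<^bsub>K\<^esub> \<one>\<^bsub>K\<^esub> = \<zero>\<^bsub>K\<^esub>"
  shows "ring_char K dvd (m::nat)"
proof (cases "m = 0")
  case False
  interpret K: field K by fact
  let ?P = "\<lambda>m::nat. m > 0 \<and> [m] \<cdot>\<^bsub>K\<^esub> \<one>\<^bsub>K\<^esub> = \<zero>\<^bsub>K\<^esub>"
  define p where "p = (LEAST m. ?P m)"
  have ex: "?P m" using False assms by simp
  have p: "?P p" unfolding p_def using ex by (rule LeastI)
  have least: "p \<le> q" if "?P q" for q unfolding p_def using that by (rule Least_le)
  have c: "ring_char K = p" unfolding ring_char_def p_def using ex by (subst if_P) blast+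
  have "[(p * (m div p))] \<cdot>\<^bsub>K\<^esub> \<one>\<^bsub>K\<^esub> = [(m div p)] \<cdot>\<^bsub>K\<^esub> ([p] \<cdot>\<^bsub>K\<^esub> \<one>\<^bsub>K\<^esub>)"
    by (simp add: K.add.nat_pow_pow)
  then have "[(p * (m div p))] \<cdot>\<^bsub>K\<^esub> \<one>\<^bsub>K\<^esub> = \<zero>\<^bsub>K\<^esub>"
    using p by simp
  moreover have "[m] \<cdot>\<^bsub>K\<^esub> \<one>\<^bsub>K\<^esub> = [(p * (m div p))] \<cdot>\<^bsub>K\<^esub> \<one>\<^bsub>K\<^esub> \<oplus>\<^bsub>K\<^esub> [(m mod p)] \<cdot>\<^bsub>K\<^esub> \<one>\<^bsub>K\<^esub>"
    by (subst K.add.nat_pow_mult) auto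
  ultimately have "[(m mod p)] \<cdot>\<^bsub>K\<^esub> \<one>\<^bsub>K\<^esub> = \<zero>\<^bsub>K\<^esub>" using assms(2) by simp
  then have "m mod p = 0" using least[of "m mod p"] p by (metis mod_less_divisor not_gr0 not_le)
  then show ?thesis by (simp add: c mod_eq_0_iff_dvd)
qed simp

section \<open>Lifting invariant maps\<close>

context hopf_algebra
begin

definition restrict_scalars :: "('a, 'n, 'y) module_scheme \<Rightarrow> ('k, 'n) module"
  where "restrict_scalars N = with_action N (\<lambda>c x. (c \<odot>\<^bsub>A\<^esub> \<one>\<^bsub>A\<^esub>) \<odot>\<^bsub>N\<^esub> x)"

lemma restrict_scalars_simps [simp]:
  "carrier (restrict_scalars N) = carrier N" "\<zero>\<^bsub>restrict_scalars N\<^esub> = \<zero>\<^bsub>N\<^esub>"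
  "x \<oplus>\<^bsub>restrict_scalars N\<^esub> y = x \<oplus>\<^bsub>N\<^esub> y"
  "c \<odot>\<^bsub>restrict_scalars N\<^esub> x = (c \<odot>\<^bsub>A\<^esub> \<one>\<^bsub>A\<^esub>) \<odot>\<^bsub>N\<^esub> x"
  by (simp_all add: restrict_scalars_def)

lemma restrict_scalars_module:
  assumes "left_module A N"
  shows "module K (restrict_scalars N)"
proof -
  interpret N: left_module A N by fact
  have "abelian_group (restrict_scalars N)"
    unfolding restrict_scalars_def by (rule with_action_abelian_group[OF N.M.abelian_group_axioms])
  then show ?thesis
    by (intro moduleI K.cring_axioms)
      (auto simp: N.smult_closed smult_l_distr N.smult_l_distr N.smult_r_distr N.smult_one
        N.smult_assoc[symmetric] smult_mult_left smult_assoc1)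
qed

lemma hom_action_left [hom_intros]:
  assumes N: "left_module A N" and f: "f \<in> Hom U A" and v: "v \<in> carrier N"
  shows "(\<lambda>x. f x \<odot>\<^bsub>N\<^esub> v) \<in> Hom U (restrict_scalars N)"
proof -
  interpret N: left_module A N by fact
  show ?thesis using f v
    by (auto simp: module_hom_def N.smult_closed N.smult_l_distr N.smult_assoc[symmetric]
        smult_mult_left)
qed

lemma hom_action_right [hom_intros]:
  assumes N: "left_module A N" and f: "f \<in> Hom U (restrict_scalars N)" and a: "a \<in> carrier A"
  shows "(\<lambda>x. a \<odot>\<^bsub>N\<^esub> f x) \<in> Hom U (restrict_scalars N)"
proof -
  interpret N: left_module A N by fact
  show ?thesis using f a
    by (auto simp: module_hom_def N.smult_closed N.smult_r_distr N.smult_assoc[symmetric]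
        smult_mult_left smult_mult_right)
qed

lemma module_hom_restrict_scalars:
  "f \<in> module_hom A N P \<Longrightarrow> f \<in> Hom (restrict_scalars N) (restrict_scalars P)"
  by (auto simp: module_hom_def)

lemma iterated_sweedler_2:
  assumes V: "module K V" and \<phi>: "multi 3 V \<phi>" and h: "h \<in> carrier A"
  shows "iterated_sweedler 2 V \<phi> h = sweedler V (\<lambda>x z. sweedler V (\<lambda>u v. \<phi> [u, v, z]) x) h"
proof -
  have \<phi>3: "multi (Suc (Suc (Suc 0))) V \<phi>" using \<phi> by (simp add: numeral_3_eq_3)
  note m1 = multi_split_head[OF V \<phi>3]
  note m0 = multi_split_head[OF V m1]
  show ?thesis
    using iterated_sweedler_Suc[OF V \<phi>3 h] iterated_sweedler_Suc[OF V m1 h]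
      iterated_sweedler_0[OF V _ h, of "\<lambda>xs. sweedler V (\<lambda>u v. sweedler V (\<lambda>ua va. \<phi> (ua # va # v #
          tl xs)) u) (hd xs)"] m0
    by (simp add: numeral_2_eq_2)
qed

text \<open>The first entry of \<open>xs\<close> replaced by the three entries of its coproduct, in the bracketing
  \<open>(\<Delta> \<otimes> id) \<Delta>\<close> that two steps of \<open>iterated_comult\<close> produce.\<close>

definition split_head_twice ::
  "('k, 'v, 'y) module_scheme \<Rightarrow> ('a list \<Rightarrow> 'v) \<Rightarrow> 'a list \<Rightarrow> 'v"
  where "split_head_twice V \<Psi> xs = sweedler V (\<lambda>x z.
    sweedler V (\<lambda>u v. \<Psi> (u # v # z # tl xs)) x) (hd xs)"

lemma split_head_twice_multilinear:
  assumes V: "module K V" and \<Psi>: "multi (Suc (Suc (Suc n))) V \<Psi>"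
  shows "multi (Suc n) V (split_head_twice V \<Psi>)"
  using multi_split_head[OF V multi_split_head[OF V \<Psi>]] by (simp add: split_head_twice_def[abs_def])

lemma split_head_twice_iterated:
  assumes V: "module K V" and \<Psi>: "multi (Suc (Suc (Suc n))) V \<Psi>" and bs: "bs \<in> tuples A (Suc n)"
  shows "iterated_sweedler 2 V (\<lambda>es. \<Psi> (es @ tl bs)) (hd bs) = split_head_twice V \<Psi> bs"
proof -
  obtain h us where h: "bs = h # us" "h \<in> carrier A" "us \<in> tuples A n"
    using bs by (rule tuples_SucE)
  have app: "es @ us \<in> tuples A (Suc (Suc (Suc n)))" if "es \<in> tuples A 3" for es
    using tuples_append[OF that h(3)] by (simp add: numeral_3_eq_3)
  have "multi 3 V (\<lambda>es. \<Psi> (es @ us))"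
  proof (rule multilinearI)
    fix es i assume es: "es \<in> tuples A 3" "i < (3::nat)"
    show "(\<lambda>x. \<Psi> (es[i := x] @ us)) \<in> Hom A V"
      using multilinear_slot[OF \<Psi> app[OF es(1)], of i] es by (simp add: list_update_append
          tuples_length)
  qed (intro multilinear_closed[OF \<Psi>] app)
  then show ?thesis using h by (simp add: iterated_sweedler_2[OF V] split_head_twice_def)
qed

lemma iterated_sweedler_nested_multilinear:
  assumes V: "module K V" and \<Psi>: "multi (Suc (Suc (Suc n))) V \<Psi>"
  shows "multi (Suc n) V (\<lambda>bs. iterated_sweedler 2 V (\<lambda>es. \<Psi> (es @ tl bs)) (hd bs))"
  by (rule multilinear_cong[OF split_head_twice_multilinear[OF V \<Psi>] split_head_twice_iterated[OF V \<Psi>]])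
    (auto intro: A.is_abelian_group)

text \<open>Both sides are \<open>\<Sum> \<Psi> [b\<^sup>(\<^sup>1\<^sup>), \<dots>, b\<^sup>(\<^sup>n\<^sup>+\<^sup>3\<^sup>)]\<close>. On the left the first of \<open>n + 1\<close> entries is split into
  three, on the right two entries are split off from the front.\<close>

lemma iterated_sweedler_nested:
  assumes V: "module K V" and \<Psi>: "multi (Suc (Suc (Suc n))) V \<Psi>" and b: "b \<in> carrier A"
  shows "iterated_sweedler n V (\<lambda>bs. iterated_sweedler 2 V (\<lambda>es. \<Psi> (es @ tl bs)) (hd bs)) b =
    sweedler V (\<lambda>x w. sweedler V (\<lambda>y w'. iterated_sweedler n V (\<lambda>zs. \<Psi> (x # y # zs)) w') w) b"
proof -
  let ?\<Psi>1 = "\<lambda>xs. sweedler V (\<lambda>u v. \<Psi> (u # v # tl xs)) (hd xs)"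
  note m1 = multi_split_head[OF V \<Psi>]
  have "iterated_sweedler n V (\<lambda>bs. iterated_sweedler 2 V (\<lambda>es. \<Psi> (es @ tl bs)) (hd bs)) b =
      iterated_sweedler n V (split_head_twice V \<Psi>) b"
    by (intro iterated_sweedler_cong[OF V b] split_head_twice_iterated[OF V \<Psi>]
        multilinear_closed[OF split_head_twice_multilinear[OF V \<Psi>]])
  also have "\<dots> = iterated_sweedler (Suc (Suc n)) V \<Psi> b"
    by (simp add: iterated_sweedler_Suc[OF V \<Psi> b] iterated_sweedler_Suc[OF V m1 b]
        split_head_twice_def[abs_def])
  also have "\<dots> = sweedler V (\<lambda>x w. iterated_sweedler (Suc n) V (\<lambda>xs. \<Psi> (x # xs)) w) b"
    by (rule iterated_sweedler_split[OF V \<Psi> b])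
  also have "\<dots> = sweedler V (\<lambda>x w. sweedler V (\<lambda>y w'. iterated_sweedler n V (\<lambda>zs. \<Psi> (x # y # zs))
      w') w) b"
    using multilinear_closed[OF \<Psi>]
    by (intro sweedler_cong[OF V b] iterated_sweedler_split[OF V multi_Cons_tail[OF \<Psi>]]
        sweedler_closed[OF V] iterated_sweedler_closed[OF V]) (auto simp: tuples_Cons)
  finally show ?thesis .
qed

end

text \<open>The situation of the introduction: \<open>F\<close> is an invariant \<open>A\<close>-linear map on the tensor power, to be
  lifted through \<open>g\<close>, and \<open>\<sigma>\<close> is a section of \<open>g\<close> that is linear over the ground field only.\<close>

locale lifting_problem = hopf_algebra K A \<Delta> \<epsilon> S
  for K :: "('k, 'z) ring_scheme" (structure) and A :: "('k, 'a, 'x) module_scheme" (structure)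
    and \<Delta> \<epsilon> S +
  fixes n :: nat and N :: "('a, 'n, 'y) module_scheme" and P :: "('a, 'p, 'w) module_scheme"
    and F :: "('a list \<Rightarrow> 'k) set \<Rightarrow> 'p" and g :: "'n \<Rightarrow> 'p" and \<sigma> :: "'p \<Rightarrow> 'n"
  assumes cocomm: "cocommutative K A \<Delta>"
    and N: "left_module A N" and P: "left_module A P"
    and F_hom: "F \<in> module_hom K (tensor_power K A (Suc n)) (hopf_algebra.restrict_scalars A P)"
    and F_act: "\<lbrakk>b \<in> carrier A; t \<in> carrier (tensor_power K A (Suc n))\<rbrakk> \<Longrightarrow>
      F (hopf_algebra.act K A \<Delta> n b t) = b \<odot>\<^bsub>P\<^esub> F t"
    and F_permute: "\<lbrakk>p permutes {1..Suc n}; t \<in> carrier (tensor_power K A (Suc n))\<rbrakk> \<Longrightarrow>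
      F (signed_permutation_action K A n p t) = F t"
    and g: "g \<in> module_hom A N P"
    and \<sigma>_hom: "\<sigma> \<in> module_hom K (hopf_algebra.restrict_scalars A P) (hopf_algebra.restrict_scalars
        A N)"
    and \<sigma>: "y \<in> carrier P \<Longrightarrow> g (\<sigma> y) = y"
begin

sublocale N: left_module A N by (rule N)
sublocale P: left_module A P by (rule P)

abbreviation "NK \<equiv> restrict_scalars N"
abbreviation "PK \<equiv> restrict_scalars P"

lemmas NK = restrict_scalars_module[OF N]
lemmas PK = restrict_scalars_module[OF P]

lemma NK_group: "abelian_group NK" by (rule module.axioms(2)[OF NK])
lemma PK_group: "abelian_group PK" by (rule module.axioms(2)[OF PK])

lemma F_closed: "t \<in> carrier (T (Suc n)) \<Longrightarrow> F t \<in> carrier P"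
  using module_hom_closed[OF F_hom] by simp

lemma F_pure_closed: "xs \<in> tuples A (Suc n) \<Longrightarrow> F (pure xs) \<in> carrier P"
  by (intro F_closed pure_tensor_closed)

lemma \<sigma>_closed: "y \<in> carrier P \<Longrightarrow> \<sigma> y \<in> carrier N"
  using module_hom_closed[OF \<sigma>_hom] by simp

text \<open>A summand of \<open>L\<^sub>i\<close>: the section \<open>\<sigma>\<close>, conjugated by two entries of a coproduct.\<close>

definition twisted_section :: "'p \<Rightarrow> 'a \<Rightarrow> 'a \<Rightarrow> 'n"
  where "twisted_section p x y = x \<odot>\<^bsub>N\<^esub> \<sigma> (S y \<odot>\<^bsub>P\<^esub> p)"

lemma twisted_section_closed: "p \<in> carrier P \<Longrightarrow> x \<in> carrier A \<Longrightarrow> y \<in> carrier A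
    \<Longrightarrow> twisted_section p x y \<in> carrier N"
  by (simp add: twisted_section_def N.smult_closed P.smult_closed \<sigma>_closed)

lemma twisted_section_hom:
  "f \<in> Hom U PK \<Longrightarrow> x \<in> carrier A \<Longrightarrow> y \<in> carrier A \<Longrightarrow> (\<lambda>p. twisted_section (f p) x y) \<in> Hom U NK"
  "p \<in> carrier P \<Longrightarrow> y \<in> carrier A \<Longrightarrow> f' \<in> Hom U A \<Longrightarrow> (\<lambda>x. twisted_section p (f' x) y) \<in> Hom U NK"
  "p \<in> carrier P \<Longrightarrow> x \<in> carrier A \<Longrightarrow> f' \<in> Hom U A \<Longrightarrow> (\<lambda>y. twisted_section p x (f' y)) \<in> Hom U NK"
  unfolding twisted_section_def
  by (intro hom_intros N P module_hom_compose[OF _ \<sigma>_hom]; simp add: \<sigma>_closed P.smult_closed)+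

text \<open>\<open>lift_at i xs\<close> is \<open>\<Sum> x\<^sup>(\<^sup>1\<^sup>) \<sigma> (S(x\<^sup>(\<^sup>2\<^sup>)) F (\<dots> \<otimes> x\<^sup>(\<^sup>3\<^sup>) \<otimes> \<dots>))\<close> for \<open>x = xs ! i\<close>, where
  \<open>x\<^sup>(\<^sup>3\<^sup>)\<close> stands in position \<open>i\<close>.\<close>

definition lift_at :: "nat \<Rightarrow> 'a list \<Rightarrow> 'n"
  where "lift_at i xs = iterated_sweedler 2 NK
    (\<lambda>ds. twisted_section (F (pure (xs[i := ds ! 2]))) (ds ! 0) (ds ! 1)) (xs ! i)"

lemma F_slot:
  "xs \<in> tuples A (Suc n) \<Longrightarrow> i < Suc n \<Longrightarrow> (\<lambda>z. F (pure (xs[i := z]))) \<in> Hom A PK"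
  by (rule multilinear_slot[OF pure_tensor_compose_multilinear[OF F_hom]])

lemma twisted_section_multilinear:
  assumes "xs \<in> tuples A (Suc n)" "i < Suc n"
  shows "multi (Suc 2) NK (\<lambda>ds. twisted_section (F (pure (xs[i := ds ! 2]))) (ds ! 0) (ds ! 1))"
  using assms
  by (intro multilinear_triple[of "\<lambda>x y z. twisted_section (F (pure (xs[i := z]))) x y"]
      twisted_section_hom
      F_slot F_pure_closed tuples_update module_hom_ident)

lemma lift_at_multilinear:
  assumes i: "i < Suc n"
  shows "multi (Suc n) NK (lift_at i)"
proof (rule multilinearI)
  fix xs j assume xs: "xs \<in> tuples A (Suc n)" and j: "j < Suc n"
  note len = tuples_length[OF xs]
  show "(\<lambda>x. lift_at i (xs[j := x])) \<in> Hom A NK"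
  proof (cases "j = i")
    case True
    then show ?thesis
      using iterated_sweedler_hom[OF NK twisted_section_multilinear[OF xs i]] len i
          by (simp add: lift_at_def)
  next
    case False
    have "(\<lambda>x. iterated_sweedler 2 NK
        (\<lambda>ds. twisted_section (F (pure (xs[i := ds ! 2, j := x]))) (ds ! 0) (ds ! 1)) (xs ! i)) \<in>
            Hom A NK"
      using xs i j by (intro iterated_sweedler_parameter_hom[OF NK] twisted_section_hom F_slot
          tuples_update
          tuples_nth) auto
    then show ?thesis
      using False by (simp add: lift_at_def list_update_swap)
  qed
qed (use i in \<open>auto simp: lift_at_def tuples_nth intro!: iterated_sweedler_closed[OF NK, simplified]
    twisted_section_closed F_pure_closed tuples_update\<close>)

definition lift_map :: "nat \<Rightarrow> ('a list \<Rightarrow> 'k) set \<Rightarrow> 'n"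
  where "lift_map i = induced_map K NK (lift_at i)"

lemma lift_map_hom: "i < Suc n \<Longrightarrow> lift_map i \<in> Hom (T (Suc n)) NK"
  unfolding lift_map_def by (rule tensor_map_hom[OF NK lift_at_multilinear])

lemma lift_map_pure: "i < Suc n \<Longrightarrow> xs \<in> tuples A (Suc n) \<Longrightarrow> lift_map i (pure xs) = lift_at i xs"
  unfolding lift_map_def by (rule tensor_map_pure[OF NK lift_at_multilinear])

text \<open>After \<open>g\<close> is applied, \<open>x\<^sup>(\<^sup>1\<^sup>) S(x\<^sup>(\<^sup>2\<^sup>))\<close> collapses to \<open>\<epsilon> x\<^sup>(\<^sup>1\<^sup>)\<close>, which the counit then absorbs.\<close>

lemma lift_map_lifts:
  assumes i: "i < Suc n" and t: "t \<in> carrier (T (Suc n))"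
  shows "g (lift_map i t) = F t"
proof (rule tensor_hom_ext[OF PK_group module_hom_compose[OF lift_map_hom[OF i]
    module_hom_restrict_scalars[OF g]]
      F_hom _ t])
  fix xs assume xs: "xs \<in> tuples A (Suc n)"
  let ?q = "\<lambda>z. F (pure (xs[i := z]))"
  let ?\<phi> = "\<lambda>x y z. (x \<otimes>\<^bsub>A\<^esub> S y) \<odot>\<^bsub>P\<^esub> ?q z"
  have q: "?q z \<in> carrier P" if "z \<in> carrier A" for z
    using that by (intro F_pure_closed tuples_update xs)
  have h: "xs ! i \<in> carrier A" by (rule tuples_nth[OF xs i])
  have "g (lift_map i (pure xs)) = iterated_sweedler 2 PK
      (\<lambda>ds. g (twisted_section (F (pure (xs[i := ds ! 2]))) (ds ! 0) (ds ! 1))) (xs ! i)"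
    unfolding lift_map_pure[OF i xs] lift_at_def
    using multilinear_closed[OF twisted_section_multilinear[OF xs i]]
    by (intro iterated_sweedler_compose[OF NK PK module_hom_restrict_scalars[OF g] h])
  also have "\<dots> = iterated_sweedler 2 PK (\<lambda>ds. ?\<phi> (ds ! 0) (ds ! 1) (ds ! 2)) (xs ! i)"
  proof (rule iterated_sweedler_cong[OF PK h])
    fix ds assume ds: "ds \<in> tuples A (Suc 2)"
    then have d: "ds ! 0 \<in> carrier A" "ds ! 1 \<in> carrier A" "ds ! 2 \<in> carrier A"
      by (auto intro: tuples_nth)
    then show "g (twisted_section (?q (ds ! 2)) (ds ! 0) (ds ! 1)) = ?\<phi> (ds ! 0) (ds ! 1) (ds ! 2)"
      using q[OF d(3)]
      by (simp add: twisted_section_def module_hom_smult[OF g] \<sigma>_closed P.smult_closed \<sigma> P.smult_assoc)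
    show "?\<phi> (ds ! 0) (ds ! 1) (ds ! 2) \<in> carrier PK"
      using d q[OF d(3)] by (simp add: P.smult_closed)
  qed
  also have "\<dots> = sweedler PK (\<lambda>x z. sweedler PK (\<lambda>u v. ?\<phi> u v z) x) (xs ! i)"
  proof -
    have "multi (Suc 2) PK (\<lambda>ds. ?\<phi> (ds ! 0) (ds ! 1) (ds ! 2))"
      using q by (intro multilinear_triple[of ?\<phi>] hom_intros P F_slot xs i) auto
    then show ?thesis using iterated_sweedler_2[OF PK _ h] by (simp add: numeral_3_eq_3 numeral_2_eq_2)
  qed
  also have "\<dots> = sweedler PK (\<lambda>x z. \<epsilon> x \<odot>\<^bsub>PK\<^esub> ?q z) (xs ! i)"
  proof (rule sweedler_cong[OF PK h])
    fix x z assume x: "x \<in> carrier A" and z: "z \<in> carrier A"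
    have "sweedler PK (\<lambda>u v. ?\<phi> u v z) x = \<epsilon> x \<odot>\<^bsub>PK\<^esub> (\<one>\<^bsub>A\<^esub> \<odot>\<^bsub>P\<^esub> ?q z)"
      by (rule sweedler_antipode_right[OF PK x, of "\<lambda>c. c \<odot>\<^bsub>P\<^esub> ?q z"])
        (intro hom_intros P q z)
    then show "sweedler PK (\<lambda>u v. ?\<phi> u v z) x = \<epsilon> x \<odot>\<^bsub>PK\<^esub> ?q z" using q[OF z] by (simp add: P.smult_one)
    show "\<epsilon> x \<odot>\<^bsub>PK\<^esub> ?q z \<in> carrier PK" using x q[OF z] by (simp add: P.smult_closed)
  qed
  also have "\<dots> = ?q (xs ! i)" by (rule sweedler_counit_left[OF PK h F_slot[OF xs i]])
  finally show "g (lift_map i (pure xs)) = F (pure xs)" by simp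
qed

text \<open>Permuting the list moves the distinguished entry from position \<open>p (i + 1) - 1\<close> to position \<open>i\<close>.
  The sign in \<open>\<rho> n p\<close> cancels against the sign that \<open>F\<close> picks up on the permuted pure tensor.\<close>

lemma lift_map_permute:
  assumes p: "p permutes {1..Suc n}" and i: "i < Suc n" and t: "t \<in> carrier (T (Suc n))"
  shows "lift_map i (\<rho> n p t) = lift_map (p (Suc i) - 1) t"
proof -
  let ?k = "p (Suc i) - 1"
  note k = permutes_position(1)[OF p i]
  show ?thesis
  proof (rule tensor_hom_ext[OF NK_group module_hom_compose[OF signed_permutation_hom[OF p]
      lift_map_hom[OF i]]
        lift_map_hom[OF k] _ t])
    fix xs assume xs: "xs \<in> tuples A (Suc n)"
    note pxs = permute_tuple_tuple[OF p xs]
    have h: "xs ! ?k \<in> carrier A" by (rule tuples_nth[OF xs k])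
    let ?s = "\<lambda>V x. if evenperm p then x else \<ominus>\<^bsub>V\<^esub> x"
    have sN: "?s NK \<in> Hom NK NK"
      using module_hom_ident module_homs_uminus[OF NK module_hom_ident] by (cases "evenperm p") auto
    have "lift_map i (\<rho> n p (pure xs)) = ?s NK (lift_at i (permute_tuple p xs))"
      using lift_map_pure[OF i pxs] p xs pure_tensor_closed[OF pxs]
      by (simp add: signed_permutation_pure module_hom_uminus[OF tensor_group NK_group
          lift_map_hom[OF i]])
    also have "lift_at i (permute_tuple p xs) = iterated_sweedler 2 NK
        (\<lambda>ds. twisted_section (F (pure (permute_tuple p (xs[?k := ds ! 2])))) (ds ! 0) (ds ! 1)) (xs
            ! ?k)"
      using i p xs by (simp add: lift_at_def permute_tuple_nth[unfolded One_nat_def]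
          permute_tuple_update[unfolded One_nat_def] tuples_length)
    also have "?s NK \<dots> = iterated_sweedler 2 NK (\<lambda>ds. ?s NK
        (twisted_section (F (pure (permute_tuple p (xs[?k := ds ! 2])))) (ds ! 0) (ds ! 1))) (xs ! ?k)"
      using xs by (intro iterated_sweedler_compose[OF NK NK sN h])
        (auto intro!: twisted_section_closed F_pure_closed permute_tuple_tuple[OF p] tuples_update
            tuples_nth)
    also have "\<dots> = lift_at ?k xs"
      unfolding lift_at_def
    proof (rule iterated_sweedler_cong[OF NK h])
      fix ds assume ds: "ds \<in> tuples A (Suc 2)"
      then have d: "ds ! 0 \<in> carrier A" "ds ! 1 \<in> carrier A" "ds ! 2 \<in> carrier A"
        by (auto intro: tuples_nth)
      let ?ys = "xs[?k := ds ! 2]"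
      have ys: "?ys \<in> tuples A (Suc n)" by (rule tuples_update[OF xs d(3)])
      note pys = permute_tuple_tuple[OF p ys]
      have "F (pure ?ys) = F (\<rho> n p (pure ?ys))"
        by (rule F_permute[OF p pure_tensor_closed[OF ys], symmetric])
      also have "\<dots> = ?s PK (F (pure (permute_tuple p ?ys)))"
        using signed_permutation_pure[OF p ys]
          module_hom_uminus[OF tensor_group PK_group F_hom pure_tensor_closed[OF pys]] by simp
      finally have "twisted_section (F (pure ?ys)) (ds ! 0) (ds ! 1) =
          twisted_section (?s PK (F (pure (permute_tuple p ?ys)))) (ds ! 0) (ds ! 1)" by simp
      also have "\<dots> = ?s NK (twisted_section (F (pure (permute_tuple p ?ys))) (ds ! 0) (ds ! 1))"
        using module_hom_uminus[OF PK_group NK_group twisted_section_hom(1)[OF module_hom_ident d(1,2)]]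
          F_pure_closed[OF pys] by simp
      finally show "?s NK (twisted_section (F (pure (permute_tuple p ?ys))) (ds ! 0) (ds ! 1)) =
          twisted_section (F (pure ?ys)) (ds ! 0) (ds ! 1)" by simp
      show "twisted_section (F (pure ?ys)) (ds ! 0) (ds ! 1) \<in> carrier NK"
        using twisted_section_closed[OF F_pure_closed[OF ys] d(1,2)] by simp
    qed
    also have "\<dots> = lift_map ?k (pure xs)" by (rule lift_map_pure[OF k xs, symmetric])
    finally show "lift_map i (\<rho> n p (pure xs)) = lift_map ?k (pure xs)" .
  qed
qed

text \<open>With \<open>xs = [x\<^sub>1, \<dots>, x\<^sub>n]\<close> the left hand side is
  \<open>\<Sum> b\<^sup>(\<^sup>1\<^sup>) a\<^sup>(\<^sup>1\<^sup>) \<sigma> (S(b\<^sup>(\<^sup>2\<^sup>) a\<^sup>(\<^sup>2\<^sup>)) F (b\<^sup>(\<^sup>3\<^sup>) a\<^sup>(\<^sup>3\<^sup>) \<otimes> b\<^sup>(\<^sup>4\<^sup>) x\<^sub>1 \<otimes> \<dots>))\<close>. As \<open>F\<close> is \<open>A\<close>-linear, the argument of \<open>\<sigma>\<close> is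
  \<open>S(a\<^sup>(\<^sup>2\<^sup>)) S(b\<^sup>(\<^sup>2\<^sup>)) b\<^sup>(\<^sup>3\<^sup>) F (a\<^sup>(\<^sup>3\<^sup>) \<otimes> x\<^sub>1 \<otimes> \<dots>)\<close>, and the antipode and counit axioms remove \<open>b\<close> from it and
  leave \<open>b a\<^sup>(\<^sup>1\<^sup>)\<close> in front.\<close>

lemma lift_map_0_act_pure:
  assumes b: "b \<in> carrier A" and axs: "a # xs \<in> tuples A (Suc n)"
  shows "lift_map 0 (act n b (pure (a # xs))) = b \<odot>\<^bsub>N\<^esub> lift_map 0 (pure (a # xs))"
proof -
  have a: "a \<in> carrier A" and xs: "xs \<in> tuples A n" using axs by (auto simp: tuples_Cons)
  have 0: "0 < Suc n" by simp
  let ?m = "map2 (monoid.mult A)"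
  note mem = tuples_map2[OF A.ring_axioms]
  note actN = N.smult_closed and actP = P.smult_closed
  \<comment> \<open>\<open>ds\<close> holds the three coproduct entries of \<open>a\<close> and \<open>zs\<close> the \<open>n + 3\<close> coproduct entries of \<open>b\<close>.\<close>
  define \<Psi> where "\<Psi> ds zs = twisted_section (F (pure (?m (drop 2 zs) (ds ! 2 # xs))))
    (zs ! 0 \<otimes>\<^bsub>A\<^esub> ds ! 0) (zs ! 1 \<otimes>\<^bsub>A\<^esub> ds ! 1)" for ds zs
  have \<Psi>_Cons: "\<Psi> ds (x # y # zs) = twisted_section (F (pure (?m zs (ds ! 2 # xs))))
      (x \<otimes>\<^bsub>A\<^esub> ds ! 0) (y \<otimes>\<^bsub>A\<^esub> ds ! 1)" for ds x y zs
    by (simp add: \<Psi>_def)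
  have d: "ds ! 0 \<in> carrier A" "ds ! 1 \<in> carrier A" "ds ! 2 \<in> carrier A"
      "ds ! 2 # xs \<in> tuples A (Suc n)"
    if "ds \<in> tuples A (Suc 2)" for ds
    using that xs by (auto intro: tuples_nth simp: tuples_Cons)
  have \<Psi>_closed: "\<Psi> ds (x # y # zs) \<in> carrier N"
    if "ds \<in> tuples A (Suc 2)" "x \<in> carrier A" "y \<in> carrier A" "zs \<in> tuples A (Suc n)" for ds x y zs
    unfolding \<Psi>_Cons using that d[OF that(1)]
    by (intro twisted_section_closed F_pure_closed mem A.m_closed)
  have \<Psi>: "multi (Suc (Suc (Suc n))) NK (\<Psi> ds)" if "ds \<in> tuples A (Suc 2)" for ds
    unfolding multi_Suc[where m = "Suc (Suc n)"]
  proof (intro conjI ballI)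
    fix ys assume "ys \<in> tuples A (Suc (Suc n))"
    then obtain y zs where y: "ys = y # zs" "y \<in> carrier A" "zs \<in> tuples A (Suc n)"
        by (rule tuples_SucE)
    show "(\<lambda>x. \<Psi> ds (x # ys)) \<in> Hom A NK"
      unfolding y(1) \<Psi>_Cons using d[OF that] y(2,3)
      by (intro twisted_section_hom(2) hom_intros F_pure_closed mem A.m_closed)
  next
    fix x assume x: "x \<in> carrier A"
    show "multi (Suc (Suc n)) NK (\<lambda>ys. \<Psi> ds (x # ys))"
      unfolding multi_Suc[where m = "Suc n"] \<Psi>_Cons
    proof (intro conjI ballI)
      fix zs assume "zs \<in> tuples A (Suc n)"
      then show "(\<lambda>y. twisted_section (F (pure (?m zs (ds ! 2 # xs)))) (x \<otimes>\<^bsub>A\<^esub> ds ! 0) (y \<otimes>\<^bsub>A\<^esub> ds ! 1))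
          \<in> Hom A NK"
        using d[OF that] x by (intro twisted_section_hom(3) hom_intros F_pure_closed mem A.m_closed)
    next
      fix y assume "y \<in> carrier A"
      then show "multi (Suc n) NK (\<lambda>zs. twisted_section (F (pure (?m zs (ds ! 2 # xs))))
          (x \<otimes>\<^bsub>A\<^esub> ds ! 0) (y \<otimes>\<^bsub>A\<^esub> ds ! 1))"
        using d[OF that] x
        by (intro multilinear_map2_hom[of "\<lambda>t. twisted_section (F t) _ _"] twisted_section_hom(1)
            F_hom A.m_closed)
    qed
  qed
  \<comment> \<open>Here the comultiplication is applied to the product of an entry of \<open>b\<close> with \<open>a\<close>.\<close>
  have first: "lift_at 0 (?m bs (a # xs)) =
      iterated_sweedler 2 NK (\<lambda>ds. iterated_sweedler 2 NK (\<lambda>es. \<Psi> ds (es @ tl bs)) (hd bs)) a"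
    if "bs \<in> tuples A (Suc n)" for bs
  proof -
    obtain u us where u: "bs = u # us" "u \<in> carrier A" "us \<in> tuples A n"
      using \<open>bs \<in> _\<close> by (rule tuples_SucE)
    have ua: "u \<otimes>\<^bsub>A\<^esub> a # ?m us xs \<in> tuples A (Suc n)"
      using u a mem[OF u(3) xs] by (simp add: tuples_Cons)
    define \<phi> where "\<phi> ds = twisted_section (F (pure (ds ! 2 # ?m us xs))) (ds ! 0) (ds ! 1)" for ds
    have \<phi>: "multi (Suc 2) NK \<phi>"
      using twisted_section_multilinear[OF ua 0] by (simp add: \<phi>_def[abs_def])
    have "lift_at 0 (?m bs (a # xs)) = iterated_sweedler 2 NK \<phi> (u \<otimes>\<^bsub>A\<^esub> a)"
      by (simp add: lift_at_def u(1) \<phi>_def[abs_def])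
    also have "\<dots> = iterated_sweedler 2 NK (\<lambda>es. iterated_sweedler 2 NK (\<lambda>ds. \<phi> (?m es ds)) a) u"
      by (rule iterated_sweedler_mult[OF NK \<phi> u(2) a])
    also have "\<dots> = iterated_sweedler 2 NK (\<lambda>ds. iterated_sweedler 2 NK (\<lambda>es. \<phi> (?m es ds)) u) a"
      by (intro iterated_sweedler_swap[OF NK u(2) a] map2_multilinear_left[OF \<phi>])
    also have "\<dots> = iterated_sweedler 2 NK (\<lambda>ds. iterated_sweedler 2 NK (\<lambda>es. \<Psi> ds (es @ us)) u) a"
    proof (intro iterated_sweedler_cong[OF NK a] iterated_sweedler_cong[OF NK u(2)]
        iterated_sweedler_closed[OF NK u(2)])
      fix ds es assume ds: "ds \<in> tuples A (Suc 2)" and es: "es \<in> tuples A (Suc 2)"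
      obtain x y z where e: "es = [x, y, z]" "x \<in> carrier A" "y \<in> carrier A" "z \<in> carrier A"
        using es by (auto simp: tuples_def length_Suc_conv numeral_2_eq_2)
      show "\<Psi> ds (es @ us) \<in> carrier NK" "\<Psi> ds (es @ us) \<in> carrier NK"
        using \<Psi>_closed[OF ds e(2,3), of "z # us"] e u by (simp_all add: tuples_Cons)
      show "\<phi> (?m es ds) = \<Psi> ds (es @ us)"
        using tuples_length[OF ds] by (simp add: e \<Psi>_Cons \<phi>_def)
    qed
    finally show ?thesis by (simp add: u(1))
  qed
  have last: "sweedler NK (\<lambda>x w. sweedler NK (\<lambda>y w'. iterated_sweedler n NK (\<lambda>zs. \<Psi> ds (x # y # zs))
      w') w) b =
      b \<odot>\<^bsub>N\<^esub> twisted_section (F (pure (ds ! 2 # xs))) (ds ! 0) (ds ! 1)"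
    if ds: "ds \<in> tuples A (Suc 2)" for ds
  proof -
    note dd = d[OF ds]
    define q where "q = F (pure (ds ! 2 # xs))"
    have q: "q \<in> carrier P" unfolding q_def by (rule F_pure_closed[OF dd(4)])
    define v where "v = \<sigma> (S (ds ! 1) \<odot>\<^bsub>P\<^esub> q)"
    have v: "v \<in> carrier N" unfolding v_def using dd q by (intro \<sigma>_closed actP) auto
    have "sweedler NK (\<lambda>x w. sweedler NK (\<lambda>y w'. iterated_sweedler n NK (\<lambda>zs. \<Psi> ds (x # y # zs)) w')
        w) b =
        sweedler NK (\<lambda>x w. \<epsilon> w \<odot>\<^bsub>NK\<^esub> ((x \<otimes>\<^bsub>A\<^esub> ds ! 0) \<odot>\<^bsub>N\<^esub> v)) b"
    proof (rule sweedler_cong[OF NK b])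
      fix x w assume x: "x \<in> carrier A" and w: "w \<in> carrier A"
      let ?x = "x \<otimes>\<^bsub>A\<^esub> ds ! 0"
      have xc: "?x \<in> carrier A" using x dd by simp
      let ?\<psi> = "\<lambda>c. ?x \<odot>\<^bsub>N\<^esub> \<sigma> (S (ds ! 1) \<odot>\<^bsub>P\<^esub> (c \<odot>\<^bsub>P\<^esub> q))"
      have \<psi>: "?\<psi> \<in> Hom A NK"
        using xc dd q by (intro hom_intros N P module_hom_compose[OF _ \<sigma>_hom]) auto
      have "sweedler NK (\<lambda>y w'. iterated_sweedler n NK (\<lambda>zs. \<Psi> ds (x # y # zs)) w') w =
          sweedler NK (\<lambda>y w'. ?\<psi> (S y \<otimes>\<^bsub>A\<^esub> w')) w"
      proof (rule sweedler_cong[OF NK w])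
        fix y w' assume y: "y \<in> carrier A" and w': "w' \<in> carrier A"
        let ?y = "y \<otimes>\<^bsub>A\<^esub> ds ! 1"
        have yc: "?y \<in> carrier A" using y dd by simp
        have "iterated_sweedler n NK (\<lambda>zs. \<Psi> ds (x # y # zs)) w' =
            twisted_section (F (act n w' (pure (ds ! 2 # xs)))) ?x ?y"
          unfolding \<Psi>_Cons
          by (rule hom_act_pure[OF NK twisted_section_hom(1)[OF F_hom xc yc] dd(4) w', symmetric])
        also have "\<dots> = twisted_section (w' \<odot>\<^bsub>P\<^esub> q) ?x ?y"
          using w' dd by (simp add: F_act pure_tensor_closed q_def)
        also have "\<dots> = ?\<psi> (S y \<otimes>\<^bsub>A\<^esub> w')"
          using xc y w' dd q
          by (simp add: twisted_section_def antipode_mult P.smult_assoc[symmetric] A.m_assoc)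
        finally show "iterated_sweedler n NK (\<lambda>zs. \<Psi> ds (x # y # zs)) w' = ?\<psi> (S y \<otimes>\<^bsub>A\<^esub> w')" .
        show "?\<psi> (S y \<otimes>\<^bsub>A\<^esub> w') \<in> carrier NK"
          using y w' by (intro module_hom_closed[OF \<psi>]) simp
      qed
      also have "\<dots> = \<epsilon> w \<odot>\<^bsub>NK\<^esub> ?\<psi> \<one>\<^bsub>A\<^esub>" by (rule sweedler_antipode_left[OF NK w \<psi>])
      finally show "sweedler NK (\<lambda>y w'. iterated_sweedler n NK (\<lambda>zs. \<Psi> ds (x # y # zs)) w') w =
          \<epsilon> w \<odot>\<^bsub>NK\<^esub> (?x \<odot>\<^bsub>N\<^esub> v)"
        using q by (simp add: v_def P.smult_one)
      show "\<epsilon> w \<odot>\<^bsub>NK\<^esub> (?x \<odot>\<^bsub>N\<^esub> v) \<in> carrier NK"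
        using w xc v by (simp add: actN)
    qed
    also have "\<dots> = (b \<otimes>\<^bsub>A\<^esub> ds ! 0) \<odot>\<^bsub>N\<^esub> v"
      using b dd v by (intro sweedler_counit_right[OF NK] hom_intros N)
    also have "\<dots> = b \<odot>\<^bsub>N\<^esub> twisted_section q (ds ! 0) (ds ! 1)"
      using b dd v by (simp add: N.smult_assoc twisted_section_def v_def)
    finally show ?thesis by (simp add: q_def)
  qed
  have Lb: "(\<lambda>v. b \<odot>\<^bsub>N\<^esub> v) \<in> Hom NK NK"
    by (rule hom_action_right[OF N module_hom_ident b])
  have "lift_map 0 (act n b (pure (a # xs))) =
      iterated_sweedler n NK (\<lambda>bs. lift_map 0 (pure (?m bs (a # xs)))) b"
    by (rule hom_act_pure[OF NK lift_map_hom[OF 0] axs b])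
  also have "\<dots> = iterated_sweedler n NK (\<lambda>bs.
      iterated_sweedler 2 NK (\<lambda>ds. iterated_sweedler 2 NK (\<lambda>es. \<Psi> ds (es @ tl bs)) (hd bs)) a) b"
  proof (rule iterated_sweedler_cong[OF NK b])
    fix bs assume bs: "bs \<in> tuples A (Suc n)"
    note m = mem[OF bs axs]
    show "lift_map 0 (pure (?m bs (a # xs))) = iterated_sweedler 2 NK
        (\<lambda>ds. iterated_sweedler 2 NK (\<lambda>es. \<Psi> ds (es @ tl bs)) (hd bs)) a"
      using lift_map_pure[OF 0 m] first[OF bs] by simp
    then show "iterated_sweedler 2 NK
        (\<lambda>ds. iterated_sweedler 2 NK (\<lambda>es. \<Psi> ds (es @ tl bs)) (hd bs)) a \<in> carrier NK"
      using module_hom_closed[OF lift_map_hom[OF 0] pure_tensor_closed[OF m]] by simp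
  qed
  also have "\<dots> = iterated_sweedler 2 NK (\<lambda>ds. iterated_sweedler n NK (\<lambda>bs.
      iterated_sweedler 2 NK (\<lambda>es. \<Psi> ds (es @ tl bs)) (hd bs)) b) a"
    by (intro iterated_sweedler_swap[OF NK b a] iterated_sweedler_nested_multilinear[OF NK] \<Psi>)
  also have "\<dots> = iterated_sweedler 2 NK
      (\<lambda>ds. b \<odot>\<^bsub>N\<^esub> twisted_section (F (pure (ds ! 2 # xs))) (ds ! 0) (ds ! 1)) a"
  proof (rule iterated_sweedler_cong[OF NK a])
    fix ds assume ds: "ds \<in> tuples A (Suc 2)"
    show "iterated_sweedler n NK (\<lambda>bs. iterated_sweedler 2 NK (\<lambda>es. \<Psi> ds (es @ tl bs)) (hd bs)) b =
        b \<odot>\<^bsub>N\<^esub> twisted_section (F (pure (ds ! 2 # xs))) (ds ! 0) (ds ! 1)"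
      by (simp only: iterated_sweedler_nested[OF NK \<Psi>[OF ds] b] last[OF ds])
    show "b \<odot>\<^bsub>N\<^esub> twisted_section (F (pure (ds ! 2 # xs))) (ds ! 0) (ds ! 1) \<in> carrier NK"
      using actN[OF b twisted_section_closed[OF F_pure_closed[OF d(4)[OF ds]] d(1,2)[OF ds]]] by simp
  qed
  also have "\<dots> = b \<odot>\<^bsub>N\<^esub> iterated_sweedler 2 NK
      (\<lambda>ds. twisted_section (F (pure (ds ! 2 # xs))) (ds ! 0) (ds ! 1)) a"
  proof (rule iterated_sweedler_compose[OF NK NK Lb a, symmetric])
    fix ds assume "ds \<in> tuples A (Suc 2)"
    then show "twisted_section (F (pure (ds ! 2 # xs))) (ds ! 0) (ds ! 1) \<in> carrier NK"
      using twisted_section_closed[OF F_pure_closed] d by simp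
  qed
  also have "\<dots> = b \<odot>\<^bsub>N\<^esub> lift_at 0 (a # xs)"
    by (simp add: lift_at_def)
  also have "lift_at 0 (a # xs) = lift_map 0 (pure (a # xs))"
    by (rule lift_map_pure[OF 0 axs, symmetric])
  finally show ?thesis .
qed

text \<open>The transposition of the first factor with factor \<open>i\<close> carries \<open>L\<^sub>0\<close> to \<open>L\<^sub>i\<close> and commutes with the
  action.\<close>

lemma lift_map_act:
  assumes i: "i < Suc n" and b: "b \<in> carrier A" and t: "t \<in> carrier (T (Suc n))"
  shows "lift_map i (act n b t) = b \<odot>\<^bsub>N\<^esub> lift_map i t"
proof -
  have 0: "0 < Suc n" by simp
  have first: "lift_map 0 (act n b t) = b \<odot>\<^bsub>N\<^esub> lift_map 0 t" if t: "t \<in> carrier (T (Suc n))" for t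
  proof (rule tensor_hom_ext[OF NK_group module_hom_compose[OF act_hom[OF b] lift_map_hom[OF 0]]
        hom_action_right[OF N lift_map_hom[OF 0] b] _ t])
    fix xs assume xs: "xs \<in> tuples A (Suc n)"
    then show "lift_map 0 (act n b (pure xs)) = b \<odot>\<^bsub>N\<^esub> lift_map 0 (pure xs)"
      by (cases xs) (use xs lift_map_0_act_pure[OF b] in \<open>auto simp: tuples_def\<close>)
  qed
  let ?p = "Transposition.transpose 1 (Suc i)"
  have p: "?p permutes {1..Suc n}" using i by (intro permutes_swap_id) auto
  have e: "lift_map i s = lift_map 0 (\<rho> n ?p s)" if "s \<in> carrier (T (Suc n))" for s
    using lift_map_permute[OF p 0 that] by simp
  have "lift_map i (act n b t) = lift_map 0 (act n b (\<rho> n ?p t))"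
    by (simp only: e[OF act_closed[OF b t]] act_signed_permutation[OF cocomm p b t])
  also have "\<dots> = b \<odot>\<^bsub>N\<^esub> lift_map i t"
    using first[OF module_hom_closed[OF signed_permutation_hom[OF p] t]] e[OF t] by simp
  finally show ?thesis .
qed

definition average_lift :: "'k \<Rightarrow> ('a list \<Rightarrow> 'k) set \<Rightarrow> 'n"
  where "average_lift c t = c \<odot>\<^bsub>NK\<^esub> (\<Oplus>\<^bsub>NK\<^esub>i\<in>{..<Suc n}. lift_map i t)"

lemma average_lift_hom: "c \<in> carrier K \<Longrightarrow> average_lift c \<in> Hom (T (Suc n)) NK"
  unfolding average_lift_def[abs_def]
  by (intro module_homs_smult[OF NK] module_homs_finsum[OF NK] lift_map_hom) auto

lemma lift_map_funcset: "t \<in> carrier (T (Suc n)) \<Longrightarrow> (\<lambda>i. lift_map i t) \<in> {..<Suc n} \<rightarrow> carrier NK"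
  using module_hom_closed[OF lift_map_hom] by auto

lemma average_lift_act:
  assumes c: "c \<in> carrier K" and b: "b \<in> carrier A" and t: "t \<in> carrier (T (Suc n))"
  shows "average_lift c (act n b t) = b \<odot>\<^bsub>N\<^esub> average_lift c t"
proof -
  interpret NK: module K NK by (rule NK)
  have Lb: "(\<lambda>v. b \<odot>\<^bsub>N\<^esub> v) \<in> Hom NK NK"
    by (rule hom_action_right[OF N module_hom_ident b])
  note l = lift_map_funcset[OF t]
  have "(\<Oplus>\<^bsub>NK\<^esub>i\<in>{..<Suc n}. lift_map i (act n b t)) = (\<Oplus>\<^bsub>NK\<^esub>i\<in>{..<Suc n}. b \<odot>\<^bsub>N\<^esub> lift_map i t)"
    using l module_hom_closed[OF Lb] by (intro NK.M.finsum_cong') (auto simp: lift_map_act b t)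
  also have "\<dots> = b \<odot>\<^bsub>N\<^esub> (\<Oplus>\<^bsub>NK\<^esub>i\<in>{..<Suc n}. lift_map i t)"
    by (rule module_hom_finsum[OF NK_group NK_group Lb l, symmetric])
  finally show ?thesis
    unfolding average_lift_def
    using module_hom_smult[OF Lb c NK.M.finsum_closed[OF l]] by simp
qed

text \<open>A permutation merely reorders the summands.\<close>

lemma average_lift_permute:
  assumes p: "p permutes {1..Suc n}" and t: "t \<in> carrier (T (Suc n))"
  shows "average_lift c (\<rho> n p t) = average_lift c t"
proof -
  interpret NK: module K NK by (rule NK)
  let ?h = "\<lambda>i. p (Suc i) - 1"
  have img: "?h ` {..<Suc n} = {..<Suc n}"
  proof
    show "?h ` {..<Suc n} \<subseteq> {..<Suc n}" using permutes_position(1)[OF p] by auto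
    show "{..<Suc n} \<subseteq> ?h ` {..<Suc n}"
    proof
      fix i assume "i \<in> {..<Suc n}"
      then obtain j where "j < Suc n" "?h j = i" using permutes_position_surj[OF p] by blast
      then show "i \<in> ?h ` {..<Suc n}" by auto
    qed
  qed
  then have inj: "inj_on ?h {..<Suc n}" by (intro eq_card_imp_inj_on) auto
  note l = lift_map_funcset[OF t]
  have "(\<Oplus>\<^bsub>NK\<^esub>i\<in>{..<Suc n}. lift_map i (\<rho> n p t)) = (\<Oplus>\<^bsub>NK\<^esub>i\<in>{..<Suc n}. lift_map (?h i) t)"
    using l permutes_position(1)[OF p]
    by (intro NK.M.finsum_cong') (auto simp: lift_map_permute[OF p _ t])
  also have "\<dots> = (\<Oplus>\<^bsub>NK\<^esub>i\<in>?h ` {..<Suc n}. lift_map i t)"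
    by (intro NK.M.finsum_reindex[OF _ inj, symmetric]) (simp only: img l)
  finally show ?thesis by (simp only: average_lift_def img)
qed

lemma average_lift_lifts:
  assumes c: "c \<in> carrier K" "c \<otimes> ([Suc n] \<cdot> \<one>) = \<one>" and t: "t \<in> carrier (T (Suc n))"
  shows "g (average_lift c t) = F t"
proof -
  interpret NK: module K NK by (rule NK)
  interpret PK: module K PK by (rule PK)
  note gK = module_hom_restrict_scalars[OF g]
  note l = lift_map_funcset[OF t]
  have y: "F t \<in> carrier PK" using F_closed[OF t] by simp
  have const: "(\<Oplus>\<^bsub>PK\<^esub>i\<in>{..<m}. F t) = ([m] \<cdot> \<one>) \<odot>\<^bsub>PK\<^esub> F t" for m :: nat
  proof (induction m)
    case (Suc m)
    have "(\<Oplus>\<^bsub>PK\<^esub>i\<in>{..<Suc m}. F t) = F t \<oplus>\<^bsub>PK\<^esub> ([m] \<cdot> \<one>) \<odot>\<^bsub>PK\<^esub> F t"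
      using Suc y by (simp add: lessThan_Suc del: restrict_scalars_simps)
    also have "\<dots> = ([Suc m] \<cdot> \<one>) \<odot>\<^bsub>PK\<^esub> F t"
      using y by (simp add: PK.smult_l_distr PK.M.a_comm del: restrict_scalars_simps)
    finally show ?case .
  qed (use y in \<open>simp del: restrict_scalars_simps\<close>)
  have "g (average_lift c t) = c \<odot>\<^bsub>PK\<^esub> (\<Oplus>\<^bsub>PK\<^esub>i\<in>{..<Suc n}. g (lift_map i t))"
    unfolding average_lift_def
    using module_hom_smult[OF gK c(1) NK.M.finsum_closed[OF l]]
      module_hom_finsum[OF NK_group PK_group gK l] by (simp del: restrict_scalars_simps)
  also have "(\<Oplus>\<^bsub>PK\<^esub>i\<in>{..<Suc n}. g (lift_map i t)) = (\<Oplus>\<^bsub>PK\<^esub>i\<in>{..<Suc n}. F t)"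
    using y by (intro PK.M.finsum_cong') (auto simp: lift_map_lifts[OF _ t])
  also have "c \<odot>\<^bsub>PK\<^esub> \<dots> = (c \<otimes> ([Suc n] \<cdot> \<one>)) \<odot>\<^bsub>PK\<^esub> F t"
    using y c(1) by (simp add: const PK.smult_assoc1 del: restrict_scalars_simps)
  also have "\<dots> = F t" using c(2) PK.smult_one[OF y] by simp
  finally show ?thesis .
qed

end

section \<open>Projectivity\<close>

lemma regular_module_module:
  assumes "cring K"
  shows "module K (regular_module K)"
proof -
  interpret cring K by fact
  show ?thesis
    unfolding regular_module_def
    by (intro moduleI assms with_action_abelian_group abelian_group_axioms)
      (simp_all add: l_distr r_distr m_assoc)
qed

context hopf_algebra
begin

abbreviation "sym_algebra n \<equiv> group_algebra K (sym_group (Suc n))"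
abbreviation "signed_tensors n \<equiv> group_algebra_module K (T (Suc n)) (\<rho> n)"

lemma sym_algebra_carrier: "carrier (sym_algebra n) = carrier (free_module K {p. p permutes {1..Suc
    n}})"
  by (simp add: group_algebra_def Let_def sym_group_def)

lemma signed_permutation_funcset:
  "t \<in> carrier (T (Suc n)) \<Longrightarrow> (\<lambda>p. \<rho> n p t) \<in> {p. p permutes {1..Suc n}} \<rightarrow> carrier (T (Suc n))"
  using module_hom_closed[OF signed_permutation_hom] by auto

lemma signed_tensors_simps [simp]:
  "carrier (signed_tensors n) = carrier (T (Suc n))"
  "x \<oplus>\<^bsub>signed_tensors n\<^esub> y = x \<oplus>\<^bsub>T (Suc n)\<^esub> y"
  "r \<odot>\<^bsub>signed_tensors n\<^esub> t = linear_extension K (T (Suc n)) (\<lambda>p. \<rho> n p t) r"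
  by (simp_all add: group_algebra_module_def)

lemma trivial_module_simps [simp]:
  "carrier (trivial_module K) = carrier K"
  "x \<oplus>\<^bsub>trivial_module K\<^esub> y = x \<oplus> y"
  "r \<odot>\<^bsub>trivial_module K\<^esub> c = linear_extension K (regular_module K) (\<lambda>p. c) r"
  by (simp_all add: trivial_module_def group_algebra_module_def regular_module_def)

lemma S_tilde_balanced_tensor:
  "balanced_tensor (sym_algebra n) (signed_tensors n) (trivial_module K)"
proof (rule balanced_tensor.intro)
  show "abelian_group (signed_tensors n)"
    unfolding group_algebra_module_def by (rule with_action_abelian_group[OF tensor_group])
  show "abelian_group (trivial_module K)"
    unfolding trivial_module_def group_algebra_module_def regular_module_def
    by (intro with_action_abelian_group K.abelian_group_axioms)
  show "r \<odot>\<^bsub>signed_tensors n\<^esub> t \<in> carrier (signed_tensors n)"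
    if "r \<in> carrier (sym_algebra n)" "t \<in> carrier (signed_tensors n)" for r t
    using module_hom_closed[OF linear_extension_hom[OF tensor_module signed_permutation_funcset]] that
    by (simp add: sym_algebra_carrier)
  show "r \<odot>\<^bsub>trivial_module K\<^esub> c \<in> carrier (trivial_module K)"
    if "r \<in> carrier (sym_algebra n)" "c \<in> carrier (trivial_module K)" for r c
    using module_hom_closed[OF linear_extension_hom[OF regular_module_module[OF K.cring_axioms]],
        of "\<lambda>p. c" "{p. p permutes {1..Suc n}}" r] that
    by (simp add: sym_algebra_carrier regular_module_def)
qed

lemma signed_tensors_left_module: "left_module A (with_action (signed_tensors n) (act n))"
proof (intro left_module.intro left_module_axioms.intro A.ring_axioms with_action_abelian_group)
  show "abelian_group (signed_tensors n)"
    by (rule balanced_tensor.M_group[OF S_tilde_balanced_tensor])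
qed (auto simp: act_closed act_one act_mult module_hom_add[OF act_hom] module_hom_add[OF act_hom_left])

lemma S_tilde_eq:
  "S_tilde K A \<Delta> n = tensor_product_left_module (sym_algebra n) (signed_tensors n) (trivial_module
      K) (act n)"
proof -
  have "smult (T_tilde K A \<Delta> n) = act n"
    by (intro ext) (simp add: T_tilde_def act_def)
  then show ?thesis by (simp add: S_tilde_def)
qed

lemma act_signed_tensors:
  assumes cc: "cocommutative K A \<Delta>" and b: "b \<in> carrier A" and r: "r \<in> carrier (sym_algebra n)"
    and t: "t \<in> carrier (signed_tensors n)"
  shows "act n b (r \<odot>\<^bsub>signed_tensors n\<^esub> t) = r \<odot>\<^bsub>signed_tensors n\<^esub> act n b t"
proof -
  let ?X = "{p. p permutes {1..Suc n}}"
  have t': "t \<in> carrier (T (Suc n))" using t by simp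
  have r': "r \<in> carrier (free_module K ?X)" using r by (simp add: sym_algebra_carrier)
  have "act n b (r \<odot>\<^bsub>signed_tensors n\<^esub> t) = linear_extension K (T (Suc n)) (\<lambda>p. act n b (\<rho> n p t)) r"
    using linear_extension_compose[OF tensor_module tensor_module act_hom[OF b]
        signed_permutation_funcset[OF t'] r'] by simp
  also have "\<dots> = linear_extension K (T (Suc n)) (\<lambda>p. \<rho> n p (act n b t)) r"
    using act_signed_permutation[OF cc _ b t']
    by (intro linear_extension_cong[OF tensor_module _ _ r'] signed_permutation_funcset act_closed b
        t') auto
  finally show ?thesis by simp
qed

lemma S_tilde_left_module:
  assumes "cocommutative K A \<Delta>"
  shows "left_module A (S_tilde K A \<Delta> n)"
  unfolding S_tilde_eq
  by (intro balanced_tensor.tensor_product_left_module[OF S_tilde_balanced_tensor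
        signed_tensors_left_module] act_signed_tensors assms)

text \<open>The lift is \<open>t \<otimes> v \<mapsto> v h(t)\<close> for the averaged lift \<open>h\<close> of \<open>F t = f (t \<otimes> 1)\<close>. It respects the
  balancing relations because \<open>h\<close> is invariant and linear over the ground field.\<close>

lemma S_tilde_lifting:
  assumes cc: "cocommutative K A \<Delta>" and c: "c \<in> carrier K" "c \<otimes> ([Suc n] \<cdot> \<one>) = \<one>"
    and N: "left_module A N" and P: "left_module A P"
    and f: "f \<in> module_hom A (S_tilde K A \<Delta> n) P" and g: "g \<in> module_hom A N P"
    and surj: "g ` carrier N = carrier P"
  shows "\<exists>h \<in> module_hom A (S_tilde K A \<Delta> n) N. \<forall>x \<in> carrier (S_tilde K A \<Delta> n). g (h x) = f x"
proof -
  interpret N: left_module A N by fact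
  interpret P: left_module A P by fact
  let ?R = "sym_algebra n" and ?M = "signed_tensors n" and ?k = "trivial_module K"
  let ?X = "{p. p permutes {1..Suc n}}"
  interpret B: balanced_tensor ?R ?M ?k by (rule S_tilde_balanced_tensor)
  let ?S = "S_tilde K A \<Delta> n"
  have S_simps: "carrier ?S = carrier B.MN" "\<And>x y. x \<oplus>\<^bsub>?S\<^esub> y = x \<oplus>\<^bsub>B.MN\<^esub> y"
    unfolding S_tilde_eq by simp_all
  have S_act: "smult ?S b \<in> module_hom \<Z> B.MN B.MN"
      "\<And>t v. \<lbrakk>t \<in> carrier (T (Suc n)); v \<in> carrier K\<rbrakk> \<Longrightarrow> b \<odot>\<^bsub>?S\<^esub> B.tensor t v = B.tensor (act n b t) v"
    if "b \<in> carrier A" for b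
    unfolding S_tilde_eq
    using B.tensor_action[OF signed_tensors_left_module _ that] act_signed_tensors[OF cc] by auto
  define F where "F t = f (B.tensor t \<one>)" for t
  have tc: "B.tensor t v \<in> carrier ?S" if "t \<in> carrier (T (Suc n))" "v \<in> carrier K" for t v
    using B.tensor_closed that by (simp add: S_simps)
  have F_act: "F (act n b t) = b \<odot>\<^bsub>P\<^esub> F t" if "b \<in> carrier A" "t \<in> carrier (T (Suc n))" for b t
    using S_act(2)[OF that(1) that(2) K.one_closed] module_hom_smult[OF f that(1) tc[OF that(2)
        K.one_closed]]
    by (simp add: F_def)
  \<comment> \<open>The ground field acts on \<open>A\<close>-modules through multiples of the unit of \<open>A\<close>.\<close>
  have scalar: "act n (k \<odot>\<^bsub>A\<^esub> \<one>\<^bsub>A\<^esub>) t = k \<odot>\<^bsub>T (Suc n)\<^esub> t"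
    if "k \<in> carrier K" "t \<in> carrier (T (Suc n))" for k t
    using module_hom_smult[OF act_hom_left[OF that(2)] that(1) A.one_closed] act_one[OF that(2)] by simp
  have F_hom: "F \<in> Hom (T (Suc n)) (restrict_scalars P)"
  proof (rule module_homI)
    fix k t assume kt: "k \<in> carrier K" "t \<in> carrier (T (Suc n))"
    then show "F (k \<odot>\<^bsub>T (Suc n)\<^esub> t) = k \<odot>\<^bsub>restrict_scalars P\<^esub> F t"
      using F_act[of "k \<odot>\<^bsub>A\<^esub> \<one>\<^bsub>A\<^esub>" t] scalar[OF kt] by simp
  next
    fix s t assume st: "s \<in> carrier (T (Suc n))" "t \<in> carrier (T (Suc n))"
    then show "F (s \<oplus>\<^bsub>T (Suc n)\<^esub> t) = F s \<oplus>\<^bsub>restrict_scalars P\<^esub> F t"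
      using B.tensor_add_left[of s t \<one>] module_hom_add[OF f tc[OF st(1)] tc[OF st(2)]]
      by (simp add: F_def S_simps)
  qed (use module_hom_closed[OF f tc] in \<open>simp add: F_def\<close>)
  have basis: "basis_vector K p \<in> carrier ?R" if "p permutes {1..Suc n}" for p
    unfolding sym_algebra_carrier using that by (intro basis_vector_carrier K.cring_axioms) simp
  have rho_basis: "basis_vector K p \<odot>\<^bsub>?M\<^esub> t = \<rho> n p t"
    if "p permutes {1..Suc n}" "t \<in> carrier (T (Suc n))" for p t
    using linear_extension_basis_vector[OF tensor_module, of "\<lambda>p. \<rho> n p t" p "Suc n"]
      module_hom_closed[OF signed_permutation_hom] that by simp
  have F_permute: "F (\<rho> n p t) = F t" if p: "p permutes {1..Suc n}" and t: "t \<in> carrier (T (Suc n))"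
      for p t
  proof -
    have "basis_vector K p \<odot>\<^bsub>?k\<^esub> \<one> = \<one>"
      using linear_extension_basis_vector[OF regular_module_module[OF K.cring_axioms], of "\<lambda>p. \<one>" p]
      by (simp add: regular_module_def)
    then show ?thesis
      using B.tensor_balanced[OF basis[OF p], of t \<one>] rho_basis[OF p t] t by (simp add: F_def)
  qed
  obtain \<sigma> where \<sigma>: "\<sigma> \<in> Hom (restrict_scalars P) (restrict_scalars N)"
      "\<And>y. y \<in> carrier (restrict_scalars P) \<Longrightarrow> g (\<sigma> y) = y"
    using linear_section[OF K.field_axioms restrict_scalars_module[OF N] restrict_scalars_module[OF P]
        module_hom_restrict_scalars[OF g]] surj by auto
  interpret L: lifting_problem K A \<Delta> \<epsilon> S n N P F g \<sigma>
    using \<sigma> by unfold_locales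
      (simp_all add: cc F_hom F_act F_permute g)
  let ?h = "L.average_lift c"
  interpret NK: module K L.NK by (rule L.NK)
  have h_hom: "?h \<in> Hom (T (Suc n)) L.NK" by (rule L.average_lift_hom[OF c(1)])
  note hc = module_hom_closed[OF h_hom]
  define \<beta> where "\<beta> t v = v \<odot>\<^bsub>L.NK\<^esub> ?h t" for t v
  have \<beta>_closed: "\<beta> t v \<in> carrier N" if "t \<in> carrier (T (Suc n))" "v \<in> carrier K" for t v
    using NK.smult_closed[OF that(2) hc[OF that(1)]] by (simp add: \<beta>_def)
  have \<beta>_balanced: "\<beta> (r \<odot>\<^bsub>?M\<^esub> t) v = \<beta> t (r \<odot>\<^bsub>?k\<^esub> v)"
    if r: "r \<in> carrier ?R" and t: "t \<in> carrier (T (Suc n))" and v: "v \<in> carrier K" for r t v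
  proof -
    note reg = regular_module_module[OF K.cring_axioms]
    have r': "r \<in> carrier (free_module K ?X)" using r by (simp add: sym_algebra_carrier)
    have "?h (r \<odot>\<^bsub>?M\<^esub> t) = linear_extension K L.NK (\<lambda>p. ?h (\<rho> n p t)) r"
      using linear_extension_compose[OF tensor_module L.NK h_hom signed_permutation_funcset[OF t]
          r'] by simp
    also have "\<dots> = linear_extension K L.NK (\<lambda>p. ?h t) r"
      using hc[OF t] L.average_lift_permute[OF _ t] by (intro linear_extension_cong[OF L.NK _ _ r'])
          auto
    finally have "\<beta> (r \<odot>\<^bsub>?M\<^esub> t) v = v \<odot>\<^bsub>L.NK\<^esub> linear_extension K L.NK (\<lambda>p. ?h t) r"
      by (simp add: \<beta>_def)
    also have "\<dots> = linear_extension K L.NK (\<lambda>p. v \<odot>\<^bsub>L.NK\<^esub> ?h t) r"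
      using hc[OF t]
      by (intro linear_extension_compose[OF L.NK L.NK module_homs_smult[OF L.NK module_hom_ident v]
          _ r']) auto
    also have "\<dots> = linear_extension K (regular_module K) (\<lambda>p. v) r \<odot>\<^bsub>L.NK\<^esub> ?h t"
    proof -
      have "(\<lambda>v. v \<odot>\<^bsub>L.NK\<^esub> ?h t) \<in> Hom (regular_module K) L.NK"
        using hc[OF t] NK.smult_closed[OF _ hc[OF t]]
        by (intro module_homI) (simp_all add: regular_module_def NK.smult_l_distr NK.smult_assoc1
            del: restrict_scalars_simps(4))
      from linear_extension_compose[OF reg L.NK this _ r', of "\<lambda>p. v"] v show ?thesis
        by (simp add: regular_module_def del: restrict_scalars_simps)
    qed
    finally show ?thesis by (simp add: \<beta>_def)
  qed
  let ?N = "int_module N" and ?P = "int_module P"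
  note N\<Z> = int_module_module[OF N.M.abelian_group_axioms]
  note P\<Z> = int_module_module[OF P.M.abelian_group_axioms]
  define h where "h = induced_map \<Z> ?N (\<lambda>(t, v). \<beta> t v)"
  have \<beta>_add: "\<beta> (s \<oplus>\<^bsub>T (Suc n)\<^esub> t) v = \<beta> s v \<oplus>\<^bsub>N\<^esub> \<beta> t v"
    if "s \<in> carrier (T (Suc n))" "t \<in> carrier (T (Suc n))" "v \<in> carrier K" for s t v
    using NK.smult_r_distr[OF that(3) hc[OF that(1)] hc[OF that(2)]] module_hom_add[OF h_hom that(1,2)]
    by (simp add: \<beta>_def)
  have \<beta>_add': "\<beta> t (u \<oplus> v) = \<beta> t u \<oplus>\<^bsub>N\<^esub> \<beta> t v"
    if "t \<in> carrier (T (Suc n))" "u \<in> carrier K" "v \<in> carrier K" for t u v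
    using NK.smult_l_distr[OF that(2,3) hc[OF that(1)]] by (simp add: \<beta>_def)
  have h: "h \<in> module_hom \<Z> B.MN ?N"
      "\<And>t v. \<lbrakk>t \<in> carrier (T (Suc n)); v \<in> carrier K\<rbrakk> \<Longrightarrow> h (B.tensor t v) = \<beta> t v"
    unfolding h_def
    by (rule B.balanced_map[OF N\<Z>];
        use \<beta>_closed \<beta>_add \<beta>_add' \<beta>_balanced in \<open>simp add: int_module_def\<close>)+
  have h_closed: "h x \<in> carrier N" if "x \<in> carrier B.MN" for x
    using module_hom_closed[OF h(1) that] by (simp add: int_module_def)
  have h_smult: "h (b \<odot>\<^bsub>?S\<^esub> x) = b \<odot>\<^bsub>N\<^esub> h x" if b: "b \<in> carrier A" and x: "x \<in> carrier B.MN" for b x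
  proof -
    have "(\<lambda>v. b \<odot>\<^bsub>N\<^esub> v) \<in> module_hom \<Z> ?N ?N"
      by (rule additive_map_int_hom[OF N\<Z> N.M.abelian_group_axioms])
        (simp_all add: int_module_def N.smult_closed N.smult_r_distr b)
    note hom = module_hom_compose[OF h(1) this]
    show ?thesis
    proof (rule B.tensor_hom_ext[OF module.axioms(2)[OF N\<Z>] module_hom_compose[OF S_act(1)[OF b]
        h(1)] hom _ x])
      fix t v assume t: "t \<in> carrier ?M" and v: "v \<in> carrier ?k"
      then have t': "t \<in> carrier (T (Suc n))" and v': "v \<in> carrier K" by simp_all
      have hN: "?h t \<in> carrier N" using hc[OF t'] by simp
      have "h (b \<odot>\<^bsub>?S\<^esub> B.tensor t v) = v \<odot>\<^bsub>L.NK\<^esub> (b \<odot>\<^bsub>N\<^esub> ?h t)"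
        by (simp add: S_act(2)[OF b t' v'] h(2)[OF act_closed[OF b t'] v'] \<beta>_def
            L.average_lift_act[OF c(1) b t'])
      also have "\<dots> = b \<odot>\<^bsub>N\<^esub> \<beta> t v"
        using b v' hN by (simp add: \<beta>_def N.smult_assoc[symmetric] smult_mult_left smult_mult_right)
      finally show "h (b \<odot>\<^bsub>?S\<^esub> B.tensor t v) = b \<odot>\<^bsub>N\<^esub> h (B.tensor t v)" by (simp add: h(2)[OF t' v'])
    qed
  qed
  have "h \<in> module_hom A ?S N"
    using module_hom_add[OF h(1)]
    by (intro module_homI) (simp_all add: S_simps h_closed h_smult int_module_def)
  moreover have "g (h x) = f x" if x: "x \<in> carrier ?S" for x
  proof -
    have g\<Z>: "g \<in> module_hom \<Z> ?N ?P"
      by (rule additive_map_int_hom[OF N\<Z> P.M.abelian_group_axioms])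
        (simp_all add: int_module_def module_hom_closed[OF g] module_hom_add[OF g])
    have f\<Z>: "f \<in> module_hom \<Z> B.MN ?P"
      by (rule additive_map_int_hom[OF B.MN_module P.M.abelian_group_axioms])
        (use module_hom_closed[OF f] module_hom_add[OF f] in \<open>simp_all add: S_simps\<close>)
    have x': "x \<in> carrier B.MN" using x by (simp add: S_simps)
    show ?thesis
    proof (rule B.tensor_hom_ext[OF module.axioms(2)[OF P\<Z>] module_hom_compose[OF h(1) g\<Z>] f\<Z> _ x'])
      fix t v assume t: "t \<in> carrier ?M" and v: "v \<in> carrier ?k"
      then have t': "t \<in> carrier (T (Suc n))" and v': "v \<in> carrier K" by simp_all
      have "g (h (B.tensor t v)) = (v \<odot>\<^bsub>A\<^esub> \<one>\<^bsub>A\<^esub>) \<odot>\<^bsub>P\<^esub> g (?h t)"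
        using hc[OF t'] v' by (simp add: h(2)[OF t' v'] \<beta>_def module_hom_smult[OF g])
      also have "\<dots> = F (v \<odot>\<^bsub>T (Suc n)\<^esub> t)"
        using v' t' by (simp add: L.average_lift_lifts[OF c t'] F_act[symmetric] scalar)
      \<comment> \<open>Move the scalar to the other side of the tensor, as a multiple of the identity permutation.\<close>
      also have "v \<odot>\<^bsub>T (Suc n)\<^esub> t = (v \<odot>\<^bsub>free_module K ?X\<^esub> basis_vector K id) \<odot>\<^bsub>?M\<^esub> t"
        using module_hom_smult[OF linear_extension_hom[OF tensor_module
            signed_permutation_funcset[OF t']] v'
            basis[OF permutes_id, unfolded sym_algebra_carrier]]
          rho_basis[OF permutes_id t'] signed_permutation_id[OF t'] by (simp del: free_module_simps
              id_apply)
      also have "F \<dots> = f (B.tensor t ((v \<odot>\<^bsub>free_module K ?X\<^esub> basis_vector K id) \<odot>\<^bsub>?k\<^esub> \<one>))"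
      proof -
        interpret FX: module K "free_module K ?X" by (rule free_module_module[OF K.cring_axioms])
        have "v \<odot>\<^bsub>free_module K ?X\<^esub> basis_vector K id \<in> carrier ?R"
          unfolding sym_algebra_carrier
          by (intro FX.smult_closed v' basis[OF permutes_id, unfolded sym_algebra_carrier])
        from B.tensor_balanced[OF this t, of \<one>] show ?thesis
          by (simp add: F_def del: signed_tensors_simps(3) trivial_module_simps(3) free_module_simps)
      qed
      also have "(v \<odot>\<^bsub>free_module K ?X\<^esub> basis_vector K id) \<odot>\<^bsub>?k\<^esub> \<one> = v"
        using module_hom_smult[OF linear_extension_hom[OF regular_module_module[OF K.cring_axioms],
              of "\<lambda>p. \<one>" ?X] v' basis[OF permutes_id, unfolded sym_algebra_carrier]]
          linear_extension_basis_vector[OF regular_module_module[OF K.cring_axioms], of "\<lambda>p. \<one>" "id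
              :: nat \<Rightarrow> nat"] v'
        by (simp add: regular_module_def del: free_module_simps id_apply)
      finally show "g (h (B.tensor t v)) = f (B.tensor t v)" .
    qed
  qed
  ultimately show ?thesis by blast
qed

end

theorem theorem4p9:
  fixes K :: "('k, 'z) ring_scheme" and A :: "('k, 'a, 'x) module_scheme"
    and \<Delta> :: "'a \<Rightarrow> ('a list \<Rightarrow> 'k) set" and \<epsilon> :: "'a \<Rightarrow> 'k" and S :: "'a \<Rightarrow> 'a"
    and n :: nat
  assumes "hopf_algebra K A \<Delta> \<epsilon> S"
    and "cocommutative K A \<Delta>"
    and "n \<ge> 1"
    and "\<not> ring_char K dvd (n + 1)"
  shows "projective_module TYPE('n) TYPE('p) A (S_tilde K A \<Delta> n)"
proof -
  interpret hopf_algebra K A \<Delta> \<epsilon> S by fact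
  let ?m = "[Suc n] \<cdot>\<^bsub>K\<^esub> \<one>\<^bsub>K\<^esub>"
  have "?m \<noteq> \<zero>\<^bsub>K\<^esub>" using ring_char_dvd[OF K.field_axioms, of "Suc n"] assms(4) by auto
  then have m: "?m \<in> Units K" using K.field_Units by auto
  let ?c = "inv\<^bsub>K\<^esub> ?m"
  have c: "?c \<in> carrier K" "?c \<otimes>\<^bsub>K\<^esub> ?m = \<one>\<^bsub>K\<^esub>"
    using K.Units_inv_closed[OF m] K.Units_l_inv[OF m] by auto
  show ?thesis
    unfolding projective_module_def
    using S_tilde_left_module[OF assms(2)] S_tilde_lifting[OF assms(2) c] by blast
qed

end
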